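(* Let $1\le k\le\infty$, let $M$ be a $C^k$ manifold, and let $\mathcal B$ be one of $C^k(M,\mathbb R)$, $C^k_c(M,\mathbb R)$, or (when $M=\mathbb R^n$ and $k=\infty$) $\mathcal S_{\mathbb R}(n)$. Let $T:\mathcal B\to\mathcal B$ be a bijection with $T(fg)=Tf\cdot Tg$ for all $f,g\in\mathcal B$. Then there exists a $C^k$-diffeomorphism $u:M\to M$ such that $(Tf)(u(x))=f(x)$ for all $f\in\mathcal B$ and $x\in M$. In particular $T$ is linear.
   Context: Manifolds are Hausdorff and second countable. $C^k(M,\mathbb R)$ is the space of $k$ times continuously differentiable real functions on $M$, $C^k_c(M,\mathbb R)$ the compactly supported ones, and $\mathcal S_{\mathbb R}(n)$ the real-valued Schwartz functions on $\mathbb R^n$ (smooth $f$ with $\sup_x|\partial^\alpha f(x)|(1+|x|^l)<\infty$ for all $l$ and multi-indices $\alpha$). Products are pointwise.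
   Formalization: The manifold M is taken nonempty and of a fixed dimension at least 1 (n ≥ 1 in the Schwartz case); in dimension 0 the claim is false, e.g. for M a single point and T(f) = f³. *)

theory Defs
  imports "HOL-Analysis.Analysis" "HOL-Library.Extended_Nat"
begin

fun Ck_nat :: "nat \<Rightarrow> 'e::euclidean_space set \<Rightarrow> ('e \<Rightarrow> 'b::real_normed_vector) \<Rightarrow> bool" where
  "Ck_nat 0 U f = continuous_on U f"
| "Ck_nat (Suc k) U f =
     ((\<forall>x\<in>U. f differentiable (at x)) \<and>
      (\<forall>i\<in>Basis. Ck_nat k U (\<lambda>x. frechet_derivative f (at x) i)))"

definition Ck :: "enat \<Rightarrow> 'e::euclidean_space set \<Rightarrow> ('e \<Rightarrow> 'b::real_normed_vector) \<Rightarrow> bool" where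
  "Ck k U f = (\<forall>n. enat n \<le> k \<longrightarrow> Ck_nat n U f)"

definition Ck_atlas :: "enat \<Rightarrow> ('a::topological_space set \<times> ('a \<Rightarrow> 'e::euclidean_space)) set \<Rightarrow> bool" where
  "Ck_atlas k A =
    ((\<forall>(U,\<phi>)\<in>A. open U \<and> inj_on \<phi> U \<and> open (\<phi> ` U) \<and> continuous_on U \<phi>
                   \<and> continuous_on (\<phi> ` U) (inv_into U \<phi>)) \<and>
     (\<Union>(fst ` A) = UNIV) \<and>
     (\<forall>(U,\<phi>)\<in>A. \<forall>(V,\<psi>)\<in>A. Ck k (\<phi> ` (U \<inter> V)) (\<psi> \<circ> inv_into U \<phi>)))"

definition Ck_funs :: "enat \<Rightarrow> ('a::topological_space set \<times> ('a \<Rightarrow> 'e::euclidean_space)) set \<Rightarrow> ('a \<Rightarrow> real) set" where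
  "Ck_funs k A = {f. \<forall>(U,\<phi>)\<in>A. Ck k (\<phi> ` U) (f \<circ> inv_into U \<phi>)}"

definition Ck_c_funs :: "enat \<Rightarrow> ('a::topological_space set \<times> ('a \<Rightarrow> 'e::euclidean_space)) set \<Rightarrow> ('a \<Rightarrow> real) set" where
  "Ck_c_funs k A = {f \<in> Ck_funs k A. compact (closure {x. f x \<noteq> 0})}"

definition Ck_map :: "enat \<Rightarrow> ('a::topological_space set \<times> ('a \<Rightarrow> 'e::euclidean_space)) set \<Rightarrow> ('a \<Rightarrow> 'a) \<Rightarrow> bool" where
  "Ck_map k A u =
    (continuous_on UNIV u \<and>
     (\<forall>(U,\<phi>)\<in>A. \<forall>(V,\<psi>)\<in>A. Ck k (\<phi> ` (U \<inter> u -` V)) (\<psi> \<circ> u \<circ> inv_into U \<phi>)))"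

definition Ck_diffeo :: "enat \<Rightarrow> ('a::topological_space set \<times> ('a \<Rightarrow> 'e::euclidean_space)) set \<Rightarrow> ('a \<Rightarrow> 'a) \<Rightarrow> bool" where
  "Ck_diffeo k A u = (bij u \<and> Ck_map k A u \<and> Ck_map k A (inv u))"

fun pderivs :: "'e::euclidean_space list \<Rightarrow> ('e \<Rightarrow> real) \<Rightarrow> 'e \<Rightarrow> real" where
  "pderivs [] f = f"
| "pderivs (i # is) f = (\<lambda>x. frechet_derivative (pderivs is f) (at x) i)"

definition Schwartz :: "('e::euclidean_space \<Rightarrow> real) set" where
  "Schwartz = {f. Ck \<infinity> UNIV f \<and>
     (\<forall>is l. set is \<subseteq> Basis \<longrightarrow>
        bounded ((\<lambda>x. \<bar>pderivs is f x\<bar> * (1 + norm x ^ l)) ` UNIV))}"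

definition id_atlas :: "('e::euclidean_space set \<times> ('e \<Rightarrow> 'e)) set" where
  "id_atlas = {(UNIV, id)}"

definition mult_bij :: "('a \<Rightarrow> real) set \<Rightarrow> (('a \<Rightarrow> real) \<Rightarrow> ('a \<Rightarrow> real)) \<Rightarrow> bool" where
  "mult_bij B T = (bij_betw T B B \<and>
     (\<forall>f\<in>B. \<forall>g\<in>B. T (\<lambda>x. f x * g x) = (\<lambda>x. T f x * T g x)))"

definition induced_by_diffeo :: "enat \<Rightarrow> ('a::topological_space set \<times> ('a \<Rightarrow> 'e::euclidean_space)) set \<Rightarrow>
     ('a \<Rightarrow> real) set \<Rightarrow> (('a \<Rightarrow> real) \<Rightarrow> ('a \<Rightarrow> real)) \<Rightarrow> bool" where
  "induced_by_diffeo k A B T =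
    ((\<exists>u. Ck_diffeo k A u \<and> (\<forall>f\<in>B. \<forall>x. T f (u x) = f x)) \<and>
     (\<forall>f\<in>B. \<forall>g\<in>B. \<forall>a b::real. T (\<lambda>x. a * f x + b * g x) = (\<lambda>x. a * T f x + b * T g x)))"

end

theory Submission
  imports Defs "HOL-Real_Asymp.Real_Asymp"
begin

text \<open>
  A multiplicative bijection respects the relation \<open>f g = f\<close>, hence the system of functions that are \<open>1\<close> near a
  given point, and so it induces a homeomorphism \<open>u\<close> such that \<open>T f (u x)\<close> only depends on the germ of \<open>f\<close> at \<open>x\<close>.
  For positive germs, \<open>A h x = ln (T (exp h) (u x))\<close> is additive in \<open>h\<close> and continuous in \<open>x\<close>. If \<open>A h x\<close> differed
  from \<open>h x * A 1 x\<close>, then functions which near points \<open>x\<^sub>n \<longlongrightarrow> x\<close> equal \<open>exp (n\<^sup>2 h + l\<^sub>n)\<close>, with integers \<open>l\<^sub>n\<close>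
  that bring the exponent close to \<open>-n\<close>, would be of class \<open>C\<^sup>k\<close> but have unbounded images. Hence
  \<open>T f (u x) = sgn (f x) * \<bar>f x\<bar> powr p x\<close> with \<open>p = A 1\<close>. Taking logarithms shows that \<open>p\<close> and \<open>u\<close> are
  of class \<open>C\<^sup>k\<close>, and likewise for the inverse. Differentiability at a simple zero of \<open>f\<close> gives \<open>p \<ge> 1\<close>, and the same argument
  for the inverse of \<open>T\<close>, whose exponent is \<open>1 / p\<close>, gives \<open>p \<le> 1\<close>.
\<close>

section \<open>Calculus of continuously differentiable functions\<close>

text \<open>Two obstacles shape the argument. The first is to find \<open>u x\<close> at all: it has
  to be a common point of the supports of all \<open>T g\<close> with \<open>g = 1\<close> near
  \<open>x\<close>. The second is that the logarithmic map \<open>log_map\<close> is only known to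
  be additive: even on constants it could be a wild solution of Cauchy's equation, so only integer
  factors can be moved through it. This explains the squares and the integer shifts in the spikes.
  The deviation from \<open>h * exponent\<close> enters with a factor n^2, the shifted exponent
  itself only with a factor of order n, and an exponent near -n supplies the weight that beats the
  polynomial growth of the derivatives. The work is done with germs, because \<open>B\<close> need
  not contain constants, inverses or logarithms.\<close>

lemma has_derivative_frechet: "f differentiable (at x) \<Longrightarrow> (f has_derivative frechet_derivative f (at x)) (at x)"
  by (simp add: frechet_derivative_works)

text \<open>Openness of \<open>U\<close> matters: the derivatives in \<open>Ck_nat\<close> are taken
  at \<open>x\<close> in the full space, so agreement is needed on a neighbourhood of each
  point.\<close>

lemma Ck_nat_cong:
  assumes "open U" "\<And>x. x \<in> U \<Longrightarrow> f x = g x" "Ck_nat n U f"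
  shows "Ck_nat n U g"
  using assms(2,3)
proof (induction n arbitrary: f g)
  case 0
  then show ?case by (simp cong: continuous_on_cong)
next
  case (Suc n)
  have D: "(g has_derivative frechet_derivative f (at x)) (at x)" if "x \<in> U" for x
    by (rule has_derivative_transform_within_open[OF has_derivative_frechet assms(1) that])
      (use Suc.prems that in auto)
  have E: "frechet_derivative g (at x) = frechet_derivative f (at x)" if "x \<in> U" for x
    using frechet_derivative_at[OF D[OF that]] by simp
  have "Ck_nat n U (\<lambda>x. frechet_derivative g (at x) i)" if "i \<in> Basis" for i
  proof (rule Suc.IH[of "\<lambda>x. frechet_derivative f (at x) i"])
    show "Ck_nat n U (\<lambda>x. frechet_derivative f (at x) i)" using Suc.prems(2) that by simp
  qed (simp add: E)
  then show ?case using D by (auto simp: differentiable_def)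
qed

lemma Ck_nat_subset: "V \<subseteq> U \<Longrightarrow> Ck_nat n U f \<Longrightarrow> Ck_nat n V f"
  by (induction n arbitrary: f) (auto intro: continuous_on_subset)

lemma Ck_nat_SucD: "Ck_nat (Suc n) U f \<Longrightarrow> Ck_nat n U f"
proof (induction n arbitrary: f)
  case 0
  then show ?case
    by (auto intro!: continuous_at_imp_continuous_on differentiable_imp_continuous_within)
qed simp

lemma Ck_nat_local:
  assumes "\<And>x. x \<in> U \<Longrightarrow> \<exists>V. open V \<and> x \<in> V \<and> Ck_nat n V f"
  shows "Ck_nat n U f"
  using assms
proof (induction n arbitrary: f)
  case 0
  show ?case unfolding Ck_nat.simps
  proof (intro continuous_at_imp_continuous_on ballI)
    fix x assume "x \<in> U"
    then obtain V where "open V" "x \<in> V" "continuous_on V f" using 0 by auto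
    then show "isCont f x" by (simp add: continuous_on_eq_continuous_at)
  qed
next
  case (Suc n)
  have "Ck_nat n U (\<lambda>x. frechet_derivative f (at x) i)" if "i \<in> Basis" for i
    by (rule Suc.IH) (use Suc.prems that in fastforce)
  then show ?case using Suc.prems by fastforce
qed

lemma frechet_derivative_eqI: "(f has_derivative f') (at x) \<Longrightarrow> frechet_derivative f (at x) = f'"
  using frechet_derivative_at by metis

text \<open>The working rule for the closure properties below: an explicit formula for the
  differential may replace \<open>frechet_derivative\<close>.\<close>

lemma Ck_nat_Suc_I:
  assumes "\<And>x. x \<in> U \<Longrightarrow> (f has_derivative f' x) (at x)"
    and "\<And>i. i \<in> Basis \<Longrightarrow> Ck_nat n U (\<lambda>x. f' x i)" and "open U"
  shows "Ck_nat (Suc n) U f"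
proof -
  have "Ck_nat n U (\<lambda>x. frechet_derivative f (at x) i)" if "i \<in> Basis" for i
    by (rule Ck_nat_cong[OF assms(3) _ assms(2)[OF that]])
      (simp add: frechet_derivative_eqI[OF assms(1)])
  then show ?thesis using assms(1) by (auto simp: differentiable_def)
qed

lemma Ck_nat_const: "open U \<Longrightarrow> Ck_nat n U (\<lambda>x. c)"
proof (induction n arbitrary: c)
  case (Suc n)
  show ?case by (rule Ck_nat_Suc_I[where f'="\<lambda>x h. 0"]) (use Suc in auto)
qed auto

lemma Ck_nat_bounded_linear:
  assumes "bounded_linear L" "open U" "Ck_nat n U f"
  shows "Ck_nat n U (\<lambda>x. L (f x))"
  using assms(3)
proof (induction n arbitrary: f)
  case 0
  then show ?case
    using assms(1) by (auto intro: bounded_linear.continuous_on)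
next
  case (Suc n)
  show ?case
    by (rule Ck_nat_Suc_I[where f'="\<lambda>x h. L (frechet_derivative f (at x) h)"])
      (use Suc assms in \<open>auto intro!: bounded_linear.has_derivative[OF assms(1)] has_derivative_frechet\<close>)
qed

lemma Ck_nat_id: "open U \<Longrightarrow> Ck_nat n U (\<lambda>x. x)"
proof (cases n)
  case (Suc m)
  assume "open U"
  then show ?thesis unfolding Suc
    by (intro Ck_nat_Suc_I[where f'="\<lambda>x h. h"] Ck_nat_const) auto
qed auto

lemma Ck_nat_add:
  assumes "open U" "Ck_nat n U f" "Ck_nat n U g"
  shows "Ck_nat n U (\<lambda>x. f x + g x)"
  using assms(2,3)
proof (induction n arbitrary: f g)
  case (Suc n)
  show ?case
    by (rule Ck_nat_Suc_I[where f'="\<lambda>x h. frechet_derivative f (at x) h + frechet_derivative g (at x) h"])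
      (use Suc assms in \<open>auto intro!: has_derivative_add has_derivative_frechet\<close>)
qed (auto intro: continuous_on_add)

lemma Ck_nat_mult:
  fixes f g :: "'e::euclidean_space \<Rightarrow> real"
  assumes "open U" "Ck_nat n U f" "Ck_nat n U g"
  shows "Ck_nat n U (\<lambda>x. f x * g x)"
  using assms(2,3)
proof (induction n arbitrary: f g)
  case (Suc n)
  show ?case
  proof (rule Ck_nat_Suc_I[where f'="\<lambda>x h. f x * frechet_derivative g (at x) h + frechet_derivative f (at x) h * g x"])
    show "Ck_nat n U (\<lambda>x. f x * frechet_derivative g (at x) i + frechet_derivative f (at x) i * g x)"
      if "i \<in> Basis" for i
      using Suc.prems Ck_nat_SucD[OF Suc.prems(1)] Ck_nat_SucD[OF Suc.prems(2)] that assms(1)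
      by (intro Ck_nat_add Suc.IH) auto
  qed (use Suc assms in \<open>auto intro!: has_derivative_mult has_derivative_frechet\<close>)
qed (auto intro: continuous_on_mult)

lemma Ck_nat_scaleR:
  assumes "open U" "Ck_nat n U f" "Ck_nat n U g"
  shows "Ck_nat n U (\<lambda>x. f x *\<^sub>R g x)"
  using assms(2,3)
proof (induction n arbitrary: f g)
  case (Suc n)
  show ?case
  proof (rule Ck_nat_Suc_I[where f'="\<lambda>x h. f x *\<^sub>R frechet_derivative g (at x) h + frechet_derivative f (at x) h *\<^sub>R g x"])
    show "Ck_nat n U (\<lambda>x. f x *\<^sub>R frechet_derivative g (at x) i + frechet_derivative f (at x) i *\<^sub>R g x)"
      if "i \<in> Basis" for i
      using Suc.prems Ck_nat_SucD[OF Suc.prems(1)] Ck_nat_SucD[OF Suc.prems(2)] that assms(1)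
      by (intro Ck_nat_add Suc.IH) auto
  qed (use Suc assms in \<open>auto intro!: has_derivative_scaleR has_derivative_frechet\<close>)
qed (auto intro: continuous_on_scaleR)

lemma Ck_nat_sum:
  assumes "open U" "\<And>i. i \<in> I \<Longrightarrow> Ck_nat n U (f i)"
  shows "Ck_nat n U (\<lambda>x. \<Sum>i\<in>I. f i x)"
  using assms(2)
  by (induction I rule: infinite_finite_induct) (auto intro: Ck_nat_const Ck_nat_add assms(1))

lemma Ck_nat_euclideanI:
  fixes f :: "'e::euclidean_space \<Rightarrow> 'd::euclidean_space"
  assumes "open U" "\<And>j. j \<in> Basis \<Longrightarrow> Ck_nat n U (\<lambda>x. f x \<bullet> j)"
  shows "Ck_nat n U f"
proof -
  have "Ck_nat n U (\<lambda>x. \<Sum>j\<in>Basis. (f x \<bullet> j) *\<^sub>R j)"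
    using assms by (intro Ck_nat_sum Ck_nat_scaleR Ck_nat_const) auto
  then show ?thesis by (simp add: euclidean_representation)
qed

lemma frechet_derivative_sum_Basis:
  fixes f :: "'d::euclidean_space \<Rightarrow> real"
  assumes "f differentiable (at y)"
  shows "frechet_derivative f (at y) w = (\<Sum>j\<in>Basis. frechet_derivative f (at y) j * (w \<bullet> j))"
proof -
  have lin: "linear (frechet_derivative f (at y))"
    using assms by (rule linear_frechet_derivative)
  have "frechet_derivative f (at y) w = frechet_derivative f (at y) (\<Sum>j\<in>Basis. (w \<bullet> j) *\<^sub>R j)"
    by (simp add: euclidean_representation)
  also have "\<dots> = (\<Sum>j\<in>Basis. (w \<bullet> j) *\<^sub>R frechet_derivative f (at y) j)"
    by (simp add: linear_sum[OF lin] linear_scale[OF lin] o_def)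
  finally show ?thesis by (simp add: mult.commute)
qed

text \<open>The chain rule is written in coordinates so that the induction hypothesis applies to
  each partial derivative of \<open>f\<close>, with \<open>g\<close> kept fixed. A scalar
  \<open>f\<close> is enough, since vector-valued maps are tested on their components.\<close>

lemma Ck_nat_compose:
  fixes f :: "'d::euclidean_space \<Rightarrow> real" and g :: "'e::euclidean_space \<Rightarrow> 'd"
  assumes "open U" "open V" "g ` U \<subseteq> V" "Ck_nat n V f" "Ck_nat n U g"
  shows "Ck_nat n U (\<lambda>x. f (g x))"
  using assms(4,5)
proof (induction n arbitrary: f)
  case 0
  then show ?case using assms(3) by (auto intro: continuous_on_compose2)
next
  case (Suc n)
  have df: "f differentiable (at (g x))" and dg: "g differentiable (at x)" if "x \<in> U" for x
    using that assms(3) Suc.prems by auto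
  show ?case
  proof (rule Ck_nat_Suc_I[where f'="\<lambda>x h. \<Sum>j\<in>Basis. frechet_derivative f (at (g x)) j * (frechet_derivative g (at x) h \<bullet> j)"])
    fix x assume "x \<in> U"
    then show "((\<lambda>x. f (g x)) has_derivative (\<lambda>h. \<Sum>j\<in>Basis. frechet_derivative f (at (g x)) j * (frechet_derivative g (at x) h \<bullet> j))) (at x)"
      using has_derivative_compose[OF has_derivative_frechet[OF dg] has_derivative_frechet[OF df]]
        frechet_derivative_sum_Basis[OF df] by simp
  next
    fix i :: 'e assume i: "i \<in> Basis"
    have "Ck_nat n U (\<lambda>x. frechet_derivative f (at (g x)) j)" if "j \<in> Basis" for j
      using Suc.prems Suc.IH[of "\<lambda>y. frechet_derivative f (at y) j"] Ck_nat_SucD[OF Suc.prems(2)] that by simp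
    moreover have "Ck_nat n U (\<lambda>x. frechet_derivative g (at x) i \<bullet> j)" for j
      using Suc.prems i by (intro Ck_nat_bounded_linear[OF bounded_linear_inner_left] assms(1)) auto
    ultimately show "Ck_nat n U (\<lambda>x. \<Sum>j\<in>Basis. frechet_derivative f (at (g x)) j * (frechet_derivative g (at x) i \<bullet> j))"
      by (intro Ck_nat_sum Ck_nat_mult assms(1)) auto
  qed (rule assms(1))
qed

lemma Ck_nat_real_Suc_I:
  fixes f :: "real \<Rightarrow> real"
  assumes "open U" "\<And>t. t \<in> U \<Longrightarrow> (f has_real_derivative f' t) (at t)" "Ck_nat n U f'"
  shows "Ck_nat (Suc n) U f"
  by (rule Ck_nat_Suc_I[where f'="\<lambda>x h. f' x * h"])
    (use assms in \<open>auto simp: has_field_derivative_def\<close>)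

lemma Ck_nat_exp: "Ck_nat n UNIV (exp :: real \<Rightarrow> real)"
proof (induction n)
  case (Suc n)
  then show ?case by (intro Ck_nat_real_Suc_I[where f'=exp]) (auto intro: DERIV_exp)
qed (auto intro!: continuous_intros)

lemma Ck_nat_inverse: "Ck_nat n (- {0}) (inverse :: real \<Rightarrow> real)"
proof (induction n)
  case (Suc n)
  have "open (- {0::real})" by auto
  moreover have "Ck_nat n (- {0}) (\<lambda>t::real. - 1 * (inverse t * inverse t))"
    by (intro Ck_nat_mult Ck_nat_const Suc) auto
  ultimately show ?case 
    by (intro Ck_nat_real_Suc_I[where f'="\<lambda>t. - 1 * (inverse t * inverse t)"])
       (auto intro!: derivative_eq_intros simp: power2_eq_square)
qed (auto intro!: continuous_intros)

lemma Ck_nat_ln: "Ck_nat n {0<..} (ln :: real \<Rightarrow> real)"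
proof (cases n)
  case 0
  then show ?thesis by (auto intro!: continuous_intros)
next
  case (Suc m)
  have "Ck_nat m {0<..} (inverse :: real \<Rightarrow> real)"
    by (rule Ck_nat_subset[OF _ Ck_nat_inverse]) auto
  then show ?thesis unfolding Suc
    by (intro Ck_nat_real_Suc_I[where f'=inverse]) (auto intro: DERIV_ln)
qed

section \<open>Smooth cut-off functions\<close>

lemma power_div_fact_le_exp:
  assumes "s \<ge> (0::real)"
  shows "s ^ n / fact n \<le> exp s"
proof -
  have "(\<Sum>i\<in>{n}. s ^ i /\<^sub>R fact i) \<le> (\<Sum>i. s ^ i /\<^sub>R fact i)"
    using assms by (intro sum_le_suminf summable_exp_generic) auto
  then show ?thesis by (simp add: exp_def divide_inverse_commute)
qed

text \<open>Differentiation raises \<open>m\<close>, so smoothness has to be proved for all \<open>m\<close> at once.\<close>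
definition flat_fun :: "nat \<Rightarrow> real \<Rightarrow> real" where
  "flat_fun m t = (if t > 0 then inverse t ^ m * exp (- inverse t) else 0)"

text \<open>With \<open>s = inverse t\<close> this is
  \<open>s ^ (m + 2) * exp (- s) \<le> fact (m + 2)\<close>. The two extra powers make the
  derivative at the origin exist and vanish.\<close>

lemma flat_fun_bound: "\<bar>flat_fun m t\<bar> \<le> fact (m + 2) * t\<^sup>2"
proof (cases "t > 0")
  case True
  define s where "s = inverse t"
  have s: "s > 0" "t = inverse s" using True by (auto simp: s_def)
  have "s ^ (m + 2) / fact (m + 2) \<le> exp s"
    using s by (intro power_div_fact_le_exp) simp
  then have "s ^ (m + 2) * exp (-s) \<le> fact (m + 2)"
    by (simp add: exp_minus divide_simps mult.commute del: fact_Suc power_Suc)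
  then have "s ^ (m + 2) * exp (-s) * t\<^sup>2 \<le> fact (m + 2) * t\<^sup>2"
    by (rule mult_right_mono) simp
  moreover have "s ^ (m + 2) * exp (-s) * t\<^sup>2 = s ^ m * exp (-s) * (s * t)\<^sup>2"
    by (simp add: power_add power_mult_distrib power2_eq_square)
  moreover have "s * t = 1" using s by simp
  ultimately have "s ^ m * exp (-s) \<le> fact (m + 2) * t\<^sup>2"
    by (simp only: one_power2 mult_1_right)
  then show ?thesis using True s by (simp add: flat_fun_def)
qed (simp add: flat_fun_def)

lemma flat_fun_deriv: "(flat_fun m has_real_derivative (flat_fun (m + 2) t - m * flat_fun (m + 1) t)) (at t)"
proof (cases "t = 0")
  case True
  have "((\<lambda>h. flat_fun m h / h) \<longlongrightarrow> 0) (at 0)"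
  proof (rule Lim_null_comparison)
    show "\<forall>\<^sub>F h in at 0. norm (flat_fun m h / h) \<le> fact (m + 2) * \<bar>h\<bar>"
    proof (rule always_eventually, rule allI)
      fix h :: real
      have "\<bar>flat_fun m h\<bar> \<le> fact (m + 2) * \<bar>h\<bar> * \<bar>h\<bar>"
        using flat_fun_bound[of m h] by (simp add: power2_eq_square abs_mult_self_eq mult.assoc del: fact_Suc)
      then show "norm (flat_fun m h / h) \<le> fact (m + 2) * \<bar>h\<bar>"
        by (cases "h = 0") (simp_all add: divide_le_eq del: fact_Suc)
    qed
    show "((\<lambda>h::real. fact (m + 2) * \<bar>h\<bar>) \<longlongrightarrow> 0) (at 0)"
      by (auto intro!: tendsto_eq_intros simp del: fact_Suc)
  qed
  then show ?thesis using True by (simp add: has_field_derivative_iff flat_fun_def)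
next
  case False
  show ?thesis
  proof (cases "t > 0")
    case True
    have "((\<lambda>t. inverse t ^ m * exp (- inverse t)) has_real_derivative (flat_fun (m + 2) t - m * flat_fun (m + 1) t)) (at t)"
    proof (cases m)
      case (Suc j)
      show ?thesis unfolding Suc
        by (rule derivative_eq_intros refl | use True in \<open>simp add: flat_fun_def power2_eq_square algebra_simps\<close>)+
    qed (use True in \<open>auto intro!: derivative_eq_intros simp: flat_fun_def field_simps power2_eq_square\<close>)
    then show ?thesis
      by (rule has_field_derivative_transform_within_open[where S="{0<..}"]) (use True in \<open>auto simp: flat_fun_def\<close>)
  next
    case f: False
    have "((\<lambda>t. 0) has_real_derivative 0) (at t)" by auto
    then have "(flat_fun m has_real_derivative 0) (at t)"
      by (rule has_field_derivative_transform_within_open[where S="{..<0}"]) (use f False in \<open>auto simp: flat_fun_def\<close>)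
    then show ?thesis using f by (simp add: flat_fun_def)
  qed
qed

lemma Ck_nat_flat_fun: "Ck_nat n UNIV (flat_fun m)"
proof (induction n arbitrary: m)
  case 0
  show ?case unfolding Ck_nat.simps
    by (rule continuous_at_imp_continuous_on) (use flat_fun_deriv DERIV_isCont in blast)
next
  case (Suc n)
  have "Ck_nat n UNIV (\<lambda>t. flat_fun (m + 2) t + (- real m) * flat_fun (m + 1) t)"
    by (intro Ck_nat_add Ck_nat_mult Ck_nat_const Suc) auto
  then show ?case
    by (intro Ck_nat_real_Suc_I[OF _ flat_fun_deriv]) (auto)
qed

text \<open>The quotient a / (a + b) of flat functions. It is written with
  \<open>z \<bullet> z\<close> because the norm is not differentiable at the origin; 4 and 1 are
  therefore squared radii.\<close>

definition std_bump :: "'e::euclidean_space \<Rightarrow> real" where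
  "std_bump z = flat_fun 0 (4 - z \<bullet> z) * inverse (flat_fun 0 (4 - z \<bullet> z) + flat_fun 0 (z \<bullet> z - 1))"

lemma std_bump_eq_1: "norm z \<le> 1 \<Longrightarrow> std_bump z = 1"
proof -
  assume "norm z \<le> 1"
  then have "z \<bullet> z \<le> 1" by (simp add: norm_le_square dot_square_norm power_le_one)
  then show ?thesis by (simp add: std_bump_def flat_fun_def)
qed

lemma std_bump_eq_0: "norm z \<ge> 2 \<Longrightarrow> std_bump z = 0"
proof -
  assume "norm z \<ge> 2"
  then have "z \<bullet> z \<ge> 4" using power_mono[of 2 "norm z" 2] by (simp add: dot_square_norm)
  then show ?thesis by (simp add: std_bump_def flat_fun_def)
qed

lemma Ck_nat_inner_self: "open U \<Longrightarrow> Ck_nat n U (\<lambda>z::'e::euclidean_space. z \<bullet> z)"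
  by (subst euclidean_inner, intro Ck_nat_sum Ck_nat_mult Ck_nat_bounded_linear[OF bounded_linear_inner_left] Ck_nat_id)

lemma Ck_nat_std_bump: "Ck_nat n UNIV (std_bump :: 'e::euclidean_space \<Rightarrow> real)"
proof -
  have 1: "Ck_nat n UNIV (\<lambda>z::'e. flat_fun 0 (4 + (-1) * (z \<bullet> z)))"
    by (rule Ck_nat_compose[OF _ _ _ Ck_nat_flat_fun]) (intro subset_UNIV open_UNIV Ck_nat_add Ck_nat_const Ck_nat_mult Ck_nat_inner_self)+
  have 2: "Ck_nat n UNIV (\<lambda>z::'e. flat_fun 0 ((z \<bullet> z) + (- 1)))"
    by (rule Ck_nat_compose[OF _ _ _ Ck_nat_flat_fun]) (intro subset_UNIV open_UNIV Ck_nat_add Ck_nat_const Ck_nat_mult Ck_nat_inner_self)+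
  have pos: "flat_fun 0 (4 - t) + flat_fun 0 (t - 1) \<noteq> 0" for t
  proof -
    have "flat_fun 0 (4 - t) \<ge> 0" "flat_fun 0 (t - 1) \<ge> 0" "flat_fun 0 (4 - t) > 0 \<or> flat_fun 0 (t - 1) > 0"
      by (auto simp: flat_fun_def)
    then show ?thesis by linarith
  qed
  have 3: "Ck_nat n UNIV (\<lambda>z::'e. inverse (flat_fun 0 (4 + (-1) * (z \<bullet> z)) + flat_fun 0 ((z \<bullet> z) + (- 1))))"
    by (rule Ck_nat_compose[OF _ _ _ Ck_nat_inverse]) (use pos in \<open>auto intro!: Ck_nat_add[OF open_UNIV 1 2, simplified]\<close>)
  show ?thesis
    unfolding std_bump_def using Ck_nat_mult[OF _ 1 3] by simp
qed

section \<open>Series with polynomially bounded derivatives\<close>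

text \<open>The hypothesis of the Weierstrass M-test for all partial derivatives up to the given
  order, with the same recursion as \<open>Ck_nat\<close>.\<close>

fun sum_bdd :: "nat \<Rightarrow> (nat \<Rightarrow> 'e::euclidean_space \<Rightarrow> real) \<Rightarrow> bool" where
  "sum_bdd 0 F = (\<exists>M. summable M \<and> (\<forall>n z. \<bar>F n z\<bar> \<le> M n))"
| "sum_bdd (Suc j) F = (sum_bdd 0 F \<and> (\<forall>i\<in>Basis. sum_bdd j (\<lambda>n z. frechet_derivative (F n) (at z) i)))"

lemma sum_bdd_0: "sum_bdd j F \<Longrightarrow> sum_bdd 0 F"
  by (cases j) auto

lemma sum_bdd_uniform_limit:
  assumes "sum_bdd 0 F"
  shows "uniform_limit UNIV (\<lambda>n z. \<Sum>i<n. F i z) (\<lambda>z. \<Sum>i. F i z) sequentially"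
proof -
  obtain M where "summable M" "\<And>n z. \<bar>F n z\<bar> \<le> M n" using assms by auto
  then show ?thesis by (intro Weierstrass_m_test[where M=M]) auto
qed

lemma Ck_nat_suminf:
  assumes "\<And>n. Ck_nat j UNIV (F n)" "sum_bdd j F"
  shows "Ck_nat j UNIV (\<lambda>z. \<Sum>n. F n z)"
  using assms
proof (induction j arbitrary: F)
  case 0
  then show ?case unfolding Ck_nat.simps
    by (intro uniform_limit_theorem[OF _ sum_bdd_uniform_limit]) (auto intro!: continuous_on_sum always_eventually simp del: sum_bdd.simps)
next
  case (Suc j)
  define G where "G i z = (\<Sum>n. frechet_derivative (F n) (at z) i)" for i z
  have D: "(F n has_derivative frechet_derivative (F n) (at z)) (at z)" for n z
    using Suc.prems(1)[of n] by (intro has_derivative_frechet) simp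
  have S: "summable (\<lambda>n. F n z)" for z
  proof -
    obtain M where M: "summable M" "\<And>n z. \<bar>F n z\<bar> \<le> M n"
      using sum_bdd_0[OF Suc.prems(2)] unfolding sum_bdd.simps by blast
    show ?thesis by (rule summable_comparison_test[OF _ M(1)]) (use M(2) in auto)
  qed
  have U: "uniform_limit UNIV (\<lambda>n z. \<Sum>m<n. frechet_derivative (F m) (at z) i) (G i) sequentially"
    if "i \<in> Basis" for i
  proof -
    have "sum_bdd j (\<lambda>n z. frechet_derivative (F n) (at z) i)" using Suc.prems(2) that by simp
    from sum_bdd_uniform_limit[OF sum_bdd_0[OF this]] show ?thesis by (simp add: G_def[abs_def])
  qed
  have "\<exists>g. \<forall>x\<in>UNIV. (\<lambda>n. F n x) sums g x \<and> (g has_derivative (\<lambda>h. \<Sum>i\<in>Basis. G i x * (h \<bullet> i))) (at x within UNIV)"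
  proof (rule has_derivative_series)
    fix e :: real assume e: "e > 0"
    \<comment> \<open>The differentials must converge in operator norm; each of the
      \<open>DIM('a)\<close> partial derivatives contributes at most \<open>d\<close> times the norm
      of \<open>h\<close>.\<close>
    define d where "d = e / DIM('a)"
    have d: "d > 0" using e by (simp add: d_def)
    have "\<forall>\<^sub>F n in sequentially. \<forall>i\<in>Basis. \<forall>x\<in>UNIV. dist (\<Sum>m<n. frechet_derivative (F m) (at x) i) (G i x) < d"
      by (rule eventually_ball_finite) (use U d in \<open>auto simp: uniform_limit_iff\<close>)
    then show "\<forall>\<^sub>F n in sequentially. \<forall>x\<in>UNIV. \<forall>h. norm ((\<Sum>m<n. frechet_derivative (F m) (at x) h) - (\<Sum>i\<in>Basis. G i x * (h \<bullet> i))) \<le> e * norm h"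
    proof (eventually_elim, intro ballI allI)
      fix n x h
      assume *: "\<forall>i\<in>Basis. \<forall>x\<in>UNIV. dist (\<Sum>m<n. frechet_derivative (F m) (at x) i) (G i x) < d"
      have "(\<Sum>m<n. frechet_derivative (F m) (at x) h) = (\<Sum>m<n. \<Sum>i\<in>Basis. frechet_derivative (F m) (at x) i * (h \<bullet> i))"
        by (intro sum.cong refl frechet_derivative_sum_Basis) (use D differentiableI in blast)
      also have "\<dots> = (\<Sum>i\<in>Basis. (\<Sum>m<n. frechet_derivative (F m) (at x) i) * (h \<bullet> i))"
        by (subst sum.swap) (simp add: sum_distrib_right)
      finally have "norm ((\<Sum>m<n. frechet_derivative (F m) (at x) h) - (\<Sum>i\<in>Basis. G i x * (h \<bullet> i)))
        = norm (\<Sum>i\<in>Basis. ((\<Sum>m<n. frechet_derivative (F m) (at x) i) - G i x) * (h \<bullet> i))"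
        by (simp add: sum_subtractf left_diff_distrib)
      also have "\<dots> \<le> (\<Sum>i\<in>(Basis::'a set). d * norm h)"
      proof (rule sum_norm_le)
        fix i :: 'a assume i: "i \<in> Basis"
        have "\<bar>(\<Sum>m<n. frechet_derivative (F m) (at x) i) - G i x\<bar> \<le> d"
          using * i by (auto simp: dist_real_def intro: less_imp_le)
        moreover have "\<bar>h \<bullet> i\<bar> \<le> norm h" using i by (rule Basis_le_norm)
        ultimately show "norm (((\<Sum>m<n. frechet_derivative (F m) (at x) i) - G i x) * (h \<bullet> i)) \<le> d * norm h"
          using d by (auto simp: abs_mult intro!: mult_mono)
      qed
      also have "\<dots> = e * norm h" by (simp add: d_def)
      finally show "norm ((\<Sum>m<n. frechet_derivative (F m) (at x) h) - (\<Sum>i\<in>Basis. G i x * (h \<bullet> i))) \<le> e * norm h" .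
    qed
  qed (use D S[THEN summable_sums, of 0] in auto)
  then obtain g where g: "\<And>x. (\<lambda>n. F n x) sums g x" "\<And>x. (g has_derivative (\<lambda>h. \<Sum>i\<in>Basis. G i x * (h \<bullet> i))) (at x)"
    by auto
  have geq: "(\<lambda>z. \<Sum>n. F n z) = g" by (rule ext) (simp add: sums_unique[OF g(1), symmetric])
  show ?case unfolding geq
  proof (rule Ck_nat_Suc_I[OF g(2)])
    fix i :: 'a assume i: "i \<in> Basis"
    have "Ck_nat j UNIV (G i)"
      unfolding G_def[abs_def] by (rule Suc.IH) (use Suc.prems i in auto)
    then show "Ck_nat j UNIV (\<lambda>x. \<Sum>ia\<in>Basis. G ia x * (i \<bullet> ia))"
      using i by (simp add: inner_Basis if_distrib cong: if_cong)
  qed auto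
qed

section \<open>Polynomial growth of derivatives and exponential weights\<close>

definition poly_bdd :: "(nat \<Rightarrow> 'e::euclidean_space set) \<Rightarrow> (nat \<Rightarrow> 'e \<Rightarrow> real) \<Rightarrow> bool" where
  "poly_bdd S F = (\<exists>C N. \<forall>n. \<forall>z\<in>S n. \<bar>F n z\<bar> \<le> C * (real n + 1) ^ N)"

text \<open>The domains \<open>S n\<close> may vary with \<open>n\<close>: the exponential factors
  used later are bounded only on the shrinking supports of the bumps that multiply them.\<close>

fun poly_bdd_Ck :: "nat \<Rightarrow> (nat \<Rightarrow> 'e::euclidean_space set) \<Rightarrow> (nat \<Rightarrow> 'e \<Rightarrow> real) \<Rightarrow> bool" where
  "poly_bdd_Ck 0 S F = poly_bdd S F"
| "poly_bdd_Ck (Suc j) S F = (poly_bdd S F \<and> (\<forall>i\<in>Basis. poly_bdd_Ck j S (\<lambda>n z. frechet_derivative (F n) (at z) i)))"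

lemma poly_bdd_add:
  assumes "poly_bdd S F" "poly_bdd S G"
  shows "poly_bdd S (\<lambda>n z. F n z + G n z)"
proof -
  obtain C N D M where F: "\<And>n z. z \<in> S n \<Longrightarrow> \<bar>F n z\<bar> \<le> C * (real n + 1) ^ N"
    and G: "\<And>n z. z \<in> S n \<Longrightarrow> \<bar>G n z\<bar> \<le> D * (real n + 1) ^ M"
    using assms unfolding poly_bdd_def by blast
  have "\<bar>F n z + G n z\<bar> \<le> (\<bar>C\<bar> + \<bar>D\<bar>) * (real n + 1) ^ (N + M)" if "z \<in> S n" for n z
  proof -
    have "C * (real n + 1) ^ N \<le> \<bar>C\<bar> * (real n + 1) ^ (N + M)"
      "D * (real n + 1) ^ M \<le> \<bar>D\<bar> * (real n + 1) ^ (N + M)"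
      by (intro mult_mono power_increasing; simp)+
    then show ?thesis using F[OF that] G[OF that] by (simp add: algebra_simps)
  qed
  then show ?thesis unfolding poly_bdd_def by blast
qed

lemma poly_bdd_mult:
  assumes "poly_bdd S F" "poly_bdd S G"
  shows "poly_bdd S (\<lambda>n z. F n z * G n z)"
proof -
  obtain C N D M where F: "\<And>n z. z \<in> S n \<Longrightarrow> \<bar>F n z\<bar> \<le> C * (real n + 1) ^ N"
    and G: "\<And>n z. z \<in> S n \<Longrightarrow> \<bar>G n z\<bar> \<le> D * (real n + 1) ^ M"
    using assms unfolding poly_bdd_def by blast
  have "\<bar>F n z * G n z\<bar> \<le> (C * D) * (real n + 1) ^ (N + M)" if "z \<in> S n" for n z
  proof -
    have "\<bar>F n z * G n z\<bar> \<le> (C * (real n + 1) ^ N) * (D * (real n + 1) ^ M)"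
      using mult_mono'[OF F[OF that] G[OF that]] by (simp add: abs_mult)
    then show ?thesis by (simp add: power_add mult_ac)
  qed
  then show ?thesis unfolding poly_bdd_def by blast
qed

lemma poly_bdd_Ck_poly_bdd: "poly_bdd_Ck j S F \<Longrightarrow> poly_bdd S F"
  by (cases j) auto

lemma poly_bdd_Ck_SucD: "poly_bdd_Ck (Suc j) S F \<Longrightarrow> poly_bdd_Ck j S F"
  by (induction j arbitrary: F) auto

lemma poly_bdd_Ck_subset:
  assumes "poly_bdd_Ck j S F" "\<And>n. S' n \<subseteq> S n"
  shows "poly_bdd_Ck j S' F"
proof -
  have *: "poly_bdd S' F" if "poly_bdd S F" for F
    using that assms(2) unfolding poly_bdd_def by (meson subsetD)
  show ?thesis using assms(1) by (induction j arbitrary: F) (auto simp: *)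
qed

lemma poly_bdd_Ck_add:
  assumes "poly_bdd_Ck j S F" "poly_bdd_Ck j S G" "\<And>n. Ck_nat j UNIV (F n)" "\<And>n. Ck_nat j UNIV (G n)"
  shows "poly_bdd_Ck j S (\<lambda>n z. F n z + G n z)"
  using assms
proof (induction j arbitrary: F G)
  case (Suc j)
  have "frechet_derivative (\<lambda>z. F n z + G n z) (at z) = (\<lambda>h. frechet_derivative (F n) (at z) h + frechet_derivative (G n) (at z) h)" for n z
    using Suc.prems(3,4)[of n] by (intro frechet_derivative_eqI has_derivative_add has_derivative_frechet) auto
  then show ?case using Suc by (auto intro: poly_bdd_add)
qed (simp add: poly_bdd_add)

lemma poly_bdd_Ck_mult:
  assumes "poly_bdd_Ck j S F" "poly_bdd_Ck j S G" "\<And>n. Ck_nat j UNIV (F n)" "\<And>n. Ck_nat j UNIV (G n)"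
  shows "poly_bdd_Ck j S (\<lambda>n z. F n z * G n z)"
  using assms
proof (induction j arbitrary: F G)
  case (Suc j)
  have eq: "frechet_derivative (\<lambda>z. F n z * G n z) (at z) = (\<lambda>h. F n z * frechet_derivative (G n) (at z) h + frechet_derivative (F n) (at z) h * G n z)" for n z
    using Suc.prems(3,4)[of n] by (intro frechet_derivative_eqI has_derivative_mult has_derivative_frechet) auto
  have "poly_bdd_Ck j S (\<lambda>n z. F n z * frechet_derivative (G n) (at z) i + frechet_derivative (F n) (at z) i * G n z)"
    if "i \<in> Basis" for i
  proof (intro poly_bdd_Ck_add Suc.IH Ck_nat_mult open_UNIV)
    show "Ck_nat j UNIV (F n)" "Ck_nat j UNIV (F n)" "Ck_nat j UNIV (G n)" "Ck_nat j UNIV (G n)" for n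
      using Suc.prems(3,4)[THEN Ck_nat_SucD] by auto
  qed (use Suc.prems that poly_bdd_Ck_SucD[OF Suc.prems(1)] poly_bdd_Ck_SucD[OF Suc.prems(2)] in auto)
  moreover have "poly_bdd S F" "poly_bdd S G" using Suc.prems(1,2) by auto
  ultimately show ?case by (simp add: eq poly_bdd_mult)
qed (simp add: poly_bdd_mult)

lemma poly_bdd_Ck_const: "\<exists>C N. \<forall>n. \<bar>c n\<bar> \<le> C * (real n + 1) ^ N \<Longrightarrow> poly_bdd_Ck j S (\<lambda>n z. c n)"
proof (induction j arbitrary: c)
  case 0
  then show ?case by (auto simp: poly_bdd_def)
next
  case (Suc j)
  have "\<exists>C N. \<forall>n. \<bar>0::real\<bar> \<le> C * (real n + 1) ^ N" by (rule exI[of _ 0]) auto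
  from Suc.IH[OF this] Suc.prems show ?case by (auto simp: poly_bdd_def)
qed

lemma poly_bdd_Ck_fixed:
  assumes "compact K" "\<And>n. S n \<subseteq> K" "Ck_nat j UNIV g"
  shows "poly_bdd_Ck j S (\<lambda>n. g)"
  using assms(3)
proof (induction j arbitrary: g)
  case 0
  then have "compact (g ` K)" using assms(1) by (auto intro: compact_continuous_image continuous_on_subset)
  then obtain C where "\<And>z. z \<in> K \<Longrightarrow> \<bar>g z\<bar> \<le> C" using compact_imp_bounded[of "g ` K"] unfolding bounded_iff by auto
  then have "\<forall>n. \<forall>z\<in>S n. \<bar>g z\<bar> \<le> C * (real n + 1) ^ 0" using assms(2) by auto
  then show ?case by (auto simp: poly_bdd_def simp del: power_0)
next
  case (Suc j)
  have "poly_bdd_Ck j S (\<lambda>n. g)" using Suc.IH Ck_nat_SucD[OF Suc.prems] .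
  then show ?case using Suc poly_bdd_Ck_poly_bdd by auto
qed

lemma frechet_derivative_eq_0_outside:
  assumes "closed K" "\<And>z. z \<notin> K \<Longrightarrow> g z = 0" "z \<notin> K"
  shows "frechet_derivative g (at z) h = (0::real)"
proof -
  have "(g has_derivative (\<lambda>h. 0)) (at z)"
    by (rule has_derivative_transform_within_open[OF has_derivative_const[of 0], of "- K"]) (use assms in auto)
  then show ?thesis by (simp add: frechet_derivative_eqI)
qed

lemma Ck_nat_affine: "Ck_nat j UNIV (\<lambda>z::'e::euclidean_space. s *\<^sub>R (z - p))"
  using Ck_nat_scaleR[OF open_UNIV Ck_nat_const[OF open_UNIV, of j s] Ck_nat_add[OF open_UNIV Ck_nat_id[OF open_UNIV] Ck_nat_const[OF open_UNIV, of _ "-p"]]]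
  by simp

text \<open>Each differentiation brings out one factor \<open>s n\<close>, and a derivative of
  \<open>g\<close> of fixed order is bounded because it is continuous and vanishes outside
  \<open>K\<close>.\<close>

lemma poly_bdd_Ck_scaled:
  fixes g :: "'e::euclidean_space \<Rightarrow> real"
  assumes s: "\<And>n. \<bar>s n\<bar> \<le> C * (real n + 1) ^ N" and "compact K"
  and "Ck_nat j UNIV g" "\<And>z. z \<notin> K \<Longrightarrow> g z = 0"
  shows "poly_bdd_Ck j (\<lambda>_. UNIV) (\<lambda>n z. g (s n *\<^sub>R (z - p n)))"
  using assms(3,4)
proof (induction j arbitrary: g)
  case 0
  then have "compact (g ` K)" using assms(2) by (auto intro: compact_continuous_image continuous_on_subset)
  then obtain C where "\<And>z. z \<in> K \<Longrightarrow> \<bar>g z\<bar> \<le> C" using compact_imp_bounded[of "g ` K"] unfolding bounded_iff by auto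
  then have "\<bar>g z\<bar> \<le> \<bar>C\<bar>" for z using 0(2)[of z] by (cases "z \<in> K") force+
  then have "\<forall>n z. \<bar>g (s n *\<^sub>R (z - p n))\<bar> \<le> \<bar>C\<bar> * (real n + 1) ^ 0" by auto
  then show ?case by (auto simp: poly_bdd_def simp del: power_0)
next
  case (Suc j)
  have D: "(g has_derivative frechet_derivative g (at z)) (at z)" for z
    using Suc.prems(1) by (intro has_derivative_frechet) simp
  have eq: "frechet_derivative (\<lambda>z. g (s n *\<^sub>R (z - p n))) (at z) i = s n * frechet_derivative g (at (s n *\<^sub>R (z - p n))) i" for n z i
  proof -
    have "((\<lambda>z. g (s n *\<^sub>R (z - p n))) has_derivative (\<lambda>h. frechet_derivative g (at (s n *\<^sub>R (z - p n))) (s n *\<^sub>R h))) (at z)"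
      by (rule has_derivative_compose[OF _ D]) (auto intro!: derivative_eq_intros)
    moreover have "linear (frechet_derivative g (at w))" for w
      using D has_derivative_linear by blast
    ultimately show ?thesis by (simp add: frechet_derivative_eqI linear_scale)
  qed
  have "poly_bdd_Ck j (\<lambda>_. UNIV) (\<lambda>n z. s n * frechet_derivative g (at (s n *\<^sub>R (z - p n))) i)" if i: "i \<in> Basis" for i
  proof (rule poly_bdd_Ck_mult)
    show "poly_bdd_Ck j (\<lambda>_. UNIV) (\<lambda>n z. s n)" using s by (intro poly_bdd_Ck_const) blast
    show "poly_bdd_Ck j (\<lambda>_. UNIV) (\<lambda>n z. frechet_derivative g (at (s n *\<^sub>R (z - p n))) i)"
      by (rule Suc.IH) (use Suc.prems i frechet_derivative_eq_0_outside[OF compact_imp_closed[OF assms(2)]] in auto)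
    show "Ck_nat j UNIV (\<lambda>z. frechet_derivative g (at (s n *\<^sub>R (z - p n))) i)" for n
      by (rule Ck_nat_compose[OF _ open_UNIV subset_UNIV _ Ck_nat_affine, where f="\<lambda>z. frechet_derivative g (at z) i"]) (use Suc.prems i in auto)
  qed (simp add: Ck_nat_const)
  moreover have "poly_bdd_Ck j (\<lambda>_. UNIV) (\<lambda>n z. g (s n *\<^sub>R (z - p n)))"
    using Suc.IH[OF Ck_nat_SucD[OF Suc.prems(1)] Suc.prems(2)] .
  ultimately show ?case using eq poly_bdd_Ck_poly_bdd by simp
qed

text \<open>An upper bound on the exponent bounds the exponential itself; each differentiation only
  adds a factor \<open>m n\<close> and a derivative of \<open>h\<close>, both of polynomial
  growth.\<close>

lemma poly_bdd_Ck_exp: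
  fixes h :: "'e::euclidean_space \<Rightarrow> real"
  assumes m: "\<And>n. \<bar>m n\<bar> \<le> C * (real n + 1) ^ N"
    and b: "\<And>n z. z \<in> S n \<Longrightarrow> m n * h z + c n \<le> D"
    and h: "Ck_nat j UNIV h" "poly_bdd_Ck j S (\<lambda>n. h)"
  shows "poly_bdd_Ck j S (\<lambda>n z. exp (m n * h z + c n))"
  using h
proof (induction j)
  case 0
  have "\<forall>n. \<forall>z\<in>S n. \<bar>exp (m n * h z + c n)\<bar> \<le> exp D * (real n + 1) ^ 0" using b by auto
  then show ?case unfolding poly_bdd_Ck.simps poly_bdd_def by blast
next
  case (Suc j)
  have D: "(h has_derivative frechet_derivative h (at z)) (at z)" for z
    using Suc.prems(1) by (intro has_derivative_frechet) simp
  have C: "Ck_nat j UNIV (\<lambda>z. exp (m n * h z + c n))" for n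
    by (rule Ck_nat_compose[OF _ _ _ Ck_nat_exp])
      (auto intro!: Ck_nat_add Ck_nat_mult Ck_nat_const Ck_nat_SucD[OF Suc.prems(1)])
  have eq: "frechet_derivative (\<lambda>z. exp (m n * h z + c n)) (at z) i = exp (m n * h z + c n) * (m n * frechet_derivative h (at z) i)" for n z i
  proof -
    have "((\<lambda>z. exp (m n * h z + c n)) has_derivative (\<lambda>i. exp (m n * h z + c n) * (m n * frechet_derivative h (at z) i))) (at z)"
      by (auto intro!: derivative_eq_intros D)
    then show ?thesis by (simp add: frechet_derivative_eqI)
  qed
  have IH: "poly_bdd_Ck j S (\<lambda>n z. exp (m n * h z + c n))"
    using Suc.IH Ck_nat_SucD[OF Suc.prems(1)] poly_bdd_Ck_SucD[OF Suc.prems(2)] .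
  have "poly_bdd_Ck j S (\<lambda>n z. exp (m n * h z + c n) * (m n * frechet_derivative h (at z) i))" if "i \<in> Basis" for i
    by (intro poly_bdd_Ck_mult IH C Ck_nat_mult Ck_nat_const open_UNIV poly_bdd_Ck_const)
      (use Suc.prems that m in auto)
  then show ?case using poly_bdd_Ck_poly_bdd[OF IH] by (simp add: eq)
qed

text \<open>Off the closed set \<open>S n\<close> the function vanishes on an open set, hence so do
  its derivatives.\<close>

lemma poly_bdd_Ck_UNIV:
  assumes "poly_bdd_Ck j S F" "\<And>n. closed (S n)" "\<And>n z. z \<notin> S n \<Longrightarrow> F n z = 0"
  shows "poly_bdd_Ck j (\<lambda>_. UNIV) F"
proof -
  have *: "poly_bdd (\<lambda>_. UNIV) F" if pb: "poly_bdd S F" and 0: "\<And>n z. z \<notin> S n \<Longrightarrow> F n z = 0" for F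
  proof -
    obtain C N where F: "\<And>n z. z \<in> S n \<Longrightarrow> \<bar>F n z\<bar> \<le> C * (real n + 1) ^ N"
      using pb unfolding poly_bdd_def by blast
    have "\<bar>F n z\<bar> \<le> \<bar>C\<bar> * (real n + 1) ^ N" for n z
    proof (cases "z \<in> S n")
      case True
      have "C * (real n + 1) ^ N \<le> \<bar>C\<bar> * (real n + 1) ^ N" by (intro mult_right_mono) auto
      then show ?thesis using F[OF True] by linarith
    qed (use 0 in auto)
    then show ?thesis unfolding poly_bdd_def by blast
  qed
  show ?thesis using assms(1,3)
  proof (induction j arbitrary: F)
    case (Suc j)
    have "poly_bdd_Ck j (\<lambda>_. UNIV) (\<lambda>n z. frechet_derivative (F n) (at z) i)" if "i \<in> Basis" for i
    proof (rule Suc.IH)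
      show "poly_bdd_Ck j S (\<lambda>n z. frechet_derivative (F n) (at z) i)"
        using Suc.prems(1) that by simp
      show "frechet_derivative (F n) (at z) i = 0" if "z \<notin> S n" for n z
        using frechet_derivative_eq_0_outside[OF assms(2) _ that] Suc.prems(2) by blast
    qed
    then show ?case using *[of F] Suc.prems by simp
  qed (use * in auto)
qed

lemma summable_exp_poly: "summable (\<lambda>n. C * exp (- real n) * (real n + 1) ^ N)"
proof (rule summable_comparison_test)
  \<comment> \<open>From \<open>t ^ (N + 2) \<le> fact (N + 2) * exp t\<close> with t = n + 1: two
    spare powers leave the summable inverse square, and \<open>exp 1\<close> accounts for the shift
    from n to n + 1.\<close>
  define D where "D = \<bar>C\<bar> * exp 1 * fact (N + 2)"
  show "\<exists>M. \<forall>n\<ge>M. norm (C * exp (- real n) * (real n + 1) ^ N) \<le> D * inverse (real (Suc n) ^ 2)"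
  proof (intro exI allI impI)
    fix n :: nat
    define t where "t = real n + 1"
    have t: "t > 0" by (simp add: t_def)
    have "t ^ (N + 2) / fact (N + 2) \<le> exp t" using t by (intro power_div_fact_le_exp) simp
    then have "t ^ (N + 2) \<le> exp t * fact (N + 2)" by (simp add: divide_le_eq del: fact_Suc)
    then have "exp (- t) * t ^ (N + 2) \<le> fact (N + 2)" by (simp add: exp_minus field_simps del: fact_Suc power_Suc power_Suc2)
    then have "exp (- t) * (t ^ N * t\<^sup>2) * inverse (t\<^sup>2) \<le> fact (N + 2) * inverse (t\<^sup>2)"
      by (intro mult_right_mono) (simp_all only: power_add, simp)
    then have "exp (- t) * t ^ N \<le> fact (N + 2) * inverse (t\<^sup>2)" using t by (simp only: mult.assoc) simp
    then have "exp 1 * (exp (- t) * t ^ N) \<le> exp 1 * (fact (N + 2) * inverse (t\<^sup>2))" by (intro mult_left_mono) auto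
    moreover have "exp 1 * exp (- t) = exp (- real n)" by (simp add: t_def flip: exp_add)
    ultimately have "exp (- real n) * t ^ N \<le> exp 1 * (fact (N + 2) * inverse (t\<^sup>2))"
      by (simp only: mult.assoc[symmetric])
    then have "\<bar>C\<bar> * (exp (- real n) * t ^ N) \<le> \<bar>C\<bar> * (exp 1 * (fact (N + 2) * inverse (t\<^sup>2)))" by (rule mult_left_mono) simp
    then show "norm (C * exp (- real n) * (real n + 1) ^ N) \<le> D * inverse (real (Suc n) ^ 2)"
      by (simp add: D_def abs_mult t_def[symmetric] power_abs mult.assoc add.commute del: fact_Suc) (simp add: t_def add.commute)
  qed
  show "summable (\<lambda>n. D * inverse (real (Suc n) ^ 2))"
    by (intro summable_mult) (subst summable_Suc_iff, rule inverse_power_summable, simp)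
qed

lemma sum_bdd_exp_weight:
  assumes "poly_bdd_Ck j (\<lambda>_. UNIV) F" "\<And>n. Ck_nat j UNIV (F n)"
  shows "sum_bdd j (\<lambda>n z. exp (- real n) * F n z)"
proof -
  have *: "sum_bdd 0 (\<lambda>n z. exp (- real n) * F n z)" if pb: "poly_bdd (\<lambda>_. UNIV) F" for F :: "nat \<Rightarrow> 'a \<Rightarrow> real"
  proof -
    obtain C N where F: "\<And>n z. \<bar>F n z\<bar> \<le> C * (real n + 1) ^ N"
      using pb unfolding poly_bdd_def by blast
    have "\<bar>exp (- real n) * F n z\<bar> \<le> C * exp (- real n) * (real n + 1) ^ N" for n z
      using F[of n z] by (simp add: abs_mult mult_ac)
    then show ?thesis using summable_exp_poly[of C N] by auto
  qed
  show ?thesis using assms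
  proof (induction j arbitrary: F)
    case (Suc j)
    have eq: "frechet_derivative (\<lambda>z. exp (- real n) * F n z) (at z) = (\<lambda>i. exp (- real n) * frechet_derivative (F n) (at z) i)" for n z
      by (intro frechet_derivative_eqI has_derivative_mult_right has_derivative_frechet) (use Suc.prems(2)[of n] in auto)
    have "sum_bdd j (\<lambda>n z. exp (- real n) * frechet_derivative (F n) (at z) i)" if "i \<in> Basis" for i
      by (rule Suc.IH) (use Suc.prems that in auto)
    then show ?case using *[of F] Suc.prems(1) by (simp add: eq)
  qed (use * in \<open>auto simp del: sum_bdd.simps\<close>)
qed

section \<open>Spike functions in Euclidean space\<close>

lemma Ck_nat_1_lipschitz_on_cball:
  fixes h :: "'e::euclidean_space \<Rightarrow> real"
  assumes "Ck_nat 1 UNIV h"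
  obtains L where "L \<ge> 0" "\<And>x y. x \<in> cball p r \<Longrightarrow> y \<in> cball p r \<Longrightarrow> \<bar>h x - h y\<bar> \<le> L * norm (x - y)"
proof -
  have "\<forall>i\<in>Basis. \<exists>C. \<forall>x\<in>cball p r. \<bar>frechet_derivative h (at x) i\<bar> \<le> C"
  proof
    fix i :: 'e assume i: "i \<in> Basis"
    have "compact ((\<lambda>x. frechet_derivative h (at x) i) ` cball p r)"
      by (intro compact_continuous_image) (use assms i in \<open>auto intro: continuous_on_subset\<close>)
    from compact_imp_bounded[OF this] show "\<exists>C. \<forall>x\<in>cball p r. \<bar>frechet_derivative h (at x) i\<bar> \<le> C"
      unfolding bounded_iff by auto
  qed
  then obtain C where C: "\<And>i x. i \<in> Basis \<Longrightarrow> x \<in> cball p r \<Longrightarrow> \<bar>frechet_derivative h (at x) i\<bar> \<le> C i"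
    by metis
  define L where "L = (\<Sum>i\<in>Basis. \<bar>C i\<bar>)"
  have L: "L \<ge> 0" by (simp add: L_def sum_nonneg)
  have d: "(h has_derivative frechet_derivative h (at x)) (at x)" for x
    using assms by (intro has_derivative_frechet) simp
  have on: "onorm (frechet_derivative h (at x)) \<le> L" if "x \<in> cball p r" for x
  proof (rule onorm_bound[OF L])
    fix v
    have "norm (frechet_derivative h (at x) v) = norm (\<Sum>i\<in>Basis. frechet_derivative h (at x) i * (v \<bullet> i))"
      by (rule arg_cong[OF frechet_derivative_sum_Basis[OF differentiableI[OF d]]])
    also have "\<dots> \<le> (\<Sum>i\<in>Basis. \<bar>C i\<bar> * norm v)"
    proof (rule sum_norm_le)
      fix i :: 'e assume i: "i \<in> Basis"
      have "\<bar>frechet_derivative h (at x) i\<bar> \<le> \<bar>C i\<bar>" using C[OF i that] by linarith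
      then show "norm (frechet_derivative h (at x) i * (v \<bullet> i)) \<le> \<bar>C i\<bar> * norm v"
        using Basis_le_norm[OF i, of v] by (auto simp: abs_mult intro!: mult_mono)
    qed
    also have "\<dots> = L * norm v" by (simp add: L_def sum_distrib_right)
    finally show "norm (frechet_derivative h (at x) v) \<le> L * norm v" .
  qed
  have "\<bar>h x - h y\<bar> \<le> L * norm (x - y)" if "x \<in> cball p r" "y \<in> cball p r" for x y
    using differentiable_bound[OF convex_cball has_derivative_at_withinI[OF d] on that] by simp
  then show ?thesis using that L by blast
qed

text \<open>The functions \<open>F\<close> below refute any growth of a multiplicative map beyond the order-zero one: near 
  \<open>z n\<close> the exponent is \<open>(n+1)\<^sup>2 h\<close> shifted by an integer to a value of order \<open>-n\<close>. The bump at \<open>z n\<close>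
  has radius of order \<open>n\<^sup>-\<^sup>3\<close>, so that \<open>(n+1)\<^sup>2 h\<close> varies boundedly on it and all partial derivatives are
  bounded by \<open>exp (-n)\<close> times a polynomial in \<open>n\<close>.\<close>
lemma exists_spikes:
  fixes h :: "'e::euclidean_space \<Rightarrow> real"
  assumes h: "Ck k UNIV h" "1 \<le> k" and \<rho>: "\<rho> > 0"
  obtains F z and l :: "nat \<Rightarrow> int" where
    "Ck k UNIV F" "\<And>x. x \<notin> cball p (2 * \<rho>) \<Longrightarrow> F x = 0" "z \<longlonglongrightarrow> p" "\<And>n. z n \<in> cball p \<rho>"
    "\<And>n. \<exists>W. open W \<and> z n \<in> W \<and> (\<forall>w\<in>W. F w = exp ((real n + 1)\<^sup>2 * h w + of_int (l n)))"
    "\<And>n. \<bar>(real n + 1)\<^sup>2 * h (z n) + of_int (l n)\<bar> \<le> real n + 1"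
proof -
  obtain e :: 'e where e: "e \<in> Basis" using nonempty_Basis by blast
  have ne: "norm e = 1" using e by simp
  define N :: "nat \<Rightarrow> real" where "N n = real n + 1" for n
  have N: "N n \<ge> 1" for n by (simp add: N_def)
  \<comment> \<open>This makes the support radius \<open>2 / s n\<close> equal to \<rho> / (8 N^3)
    with N = \<open>N n\<close>. Two supports, n being the smaller index, then extend together over
    at most \<rho> / (4 N^2), while their centres are at least \<rho> / (N (N + 1)) \<ge> \<rho> /
    (2 N^2) apart.\<close>
  define K where "K = 16 / \<rho>"
  have K: "K > 0" using \<rho> by (simp add: K_def)
  define z where "z n = p + (\<rho> / N n) *\<^sub>R e" for n
  define s where "s n = K * N n ^ 3" for n
  have s: "s n > 0" for n using K N[of n] by (simp add: s_def)
  define S where "S n = cball (z n) (2 / s n)" for n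
  define fl where "fl n = \<lfloor>(N n)\<^sup>2 * h (z n)\<rfloor>" for n
  \<comment> \<open>\<open>c n\<close> brings the exponent at \<open>z n\<close> into the unit
    interval, which keeps the factors \<open>G n\<close> under control. The further shift by -n is
    left to the weight \<open>exp (- real n)\<close> of the series; \<open>l n\<close> collects
    both.\<close>
  define c :: "nat \<Rightarrow> real" where "c n = - of_int (fl n)" for n
  define l where "l n = - fl n - int n" for n
  define G where "G n x = std_bump (s n *\<^sub>R (x - z n)) * exp ((N n)\<^sup>2 * h x + c n)" for n x
  define F where "F x = (\<Sum>n. exp (- real n) * G n x)" for x
  have fl: "of_int (fl n) \<le> (N n)\<^sup>2 * h (z n)" "(N n)\<^sup>2 * h (z n) \<le> of_int (fl n) + 1" for n
    by (auto simp: fl_def real_of_int_floor_add_one_ge)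
  have zb: "norm (z n - p) \<le> \<rho>" for n
    using \<rho> N[of n] by (simp add: z_def ne divide_le_eq mult_le_cancel_left1)
  have rad: "2 / s n \<le> \<rho> / (8 * (N n)\<^sup>2)" for n
  proof -
    have "(N n)\<^sup>2 \<le> N n ^ 3" using N[of n] by (intro power_increasing) auto
    then show ?thesis using \<rho> N[of n] by (simp add: s_def K_def field_simps)
  qed
  have rad1: "2 / s n \<le> \<rho>" for n
  proof -
    have "1 \<le> 8 * (N n)\<^sup>2" using one_le_power[OF N[of n], of 2] by linarith
    then have "\<rho> * 1 \<le> \<rho> * (8 * (N n)\<^sup>2)" using \<rho> by (intro mult_left_mono) auto
    then have "\<rho> / (8 * (N n)\<^sup>2) \<le> \<rho>" using N[of n] \<rho> by (simp add: divide_le_eq)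
    then show ?thesis using rad[of n] by linarith
  qed
  have Ssub: "S n \<subseteq> cball p (2 * \<rho>)" for n
  proof
    fix x assume "x \<in> S n"
    then have "norm (x - z n) \<le> \<rho>" using rad1[of n] by (simp add: S_def dist_norm norm_minus_commute)
    then show "x \<in> cball p (2 * \<rho>)" 
      using zb[of n] norm_triangle_ineq[of "x - z n" "z n - p"] by (simp add: dist_norm norm_minus_commute)
  qed
  have disj: "S n \<inter> S m = {}" if "n < m" for n m
  proof (rule ccontr)
    assume "S n \<inter> S m \<noteq> {}"
    then obtain x where x: "norm (x - z n) \<le> 2 / s n" "norm (x - z m) \<le> 2 / s m"
      by (auto simp: S_def dist_norm norm_minus_commute)
    have nm: "N n + 1 \<le> N m" using that by (simp add: N_def)
    have "2 / s m \<le> 2 / s n"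
      using K N[of n] nm s by (intro divide_left_mono) (auto simp: s_def intro!: mult_left_mono power_mono)
    then have A: "norm (z n - z m) \<le> 2 * (\<rho> / (8 * (N n)\<^sup>2))"
      using x rad[of n] norm_triangle_ineq4[of "x - z m" "x - z n"] by (simp add: algebra_simps)
    have "z n - z m = (\<rho> / N n - \<rho> / N m) *\<^sub>R e" by (simp add: z_def algebra_simps)
    then have B: "\<rho> / N n - \<rho> / N m \<le> norm (z n - z m)" by (simp add: ne)
    have "\<rho> / N m \<le> \<rho> / (N n + 1)" using nm N[of n] \<rho> by (intro divide_left_mono) auto
    moreover have "\<rho> / N n - \<rho> / (N n + 1) = \<rho> / (N n * (N n + 1))" using N[of n] by (simp add: field_simps)
    moreover have "\<rho> / (2 * (N n)\<^sup>2) \<le> \<rho> / (N n * (N n + 1))"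
      using N[of n] \<rho> by (intro divide_left_mono) (auto simp: power2_eq_square mult_ac intro!: mult_left_mono)
    ultimately have "\<rho> / (2 * (N n)\<^sup>2) \<le> 2 * (\<rho> / (8 * (N n)\<^sup>2))" using A B by linarith
    then show False using N[of n] \<rho> by (simp add: field_simps)
  qed
  \<comment> \<open>This is where \<open>1 \<le> k\<close> enters the construction: on
    \<open>S n\<close> the function \<open>h\<close> exceeds its value at the centre by at most
    \<open>L * (2 / s n)\<close>, of order N^-3, which remains bounded after multiplication by
    N^2.\<close>
  have "Ck_nat 1 UNIV h" using h unfolding Ck_def by (simp only: one_enat_def)
  then obtain L where L: "L \<ge> 0" "\<And>x y. x \<in> cball p (2 * \<rho>) \<Longrightarrow> y \<in> cball p (2 * \<rho>) \<Longrightarrow> \<bar>h x - h y\<bar> \<le> L * norm (x - y)"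
    by (rule Ck_nat_1_lipschitz_on_cball[of h p "2 * \<rho>"]) blast
  have expb: "(N n)\<^sup>2 * h x + c n \<le> L * (2 / K) + 1" if x: "x \<in> S n" for n x
  proof -
    have "z n \<in> S n" using s[of n] by (simp add: S_def)
    then have "h x - h (z n) \<le> L * norm (x - z n)" using L(2)[of x "z n"] x Ssub[of n] by fastforce
    also have "\<dots> \<le> L * (2 / s n)" using x L(1) by (intro mult_left_mono) (auto simp: S_def dist_norm norm_minus_commute)
    finally have "(N n)\<^sup>2 * (h x - h (z n)) \<le> (N n)\<^sup>2 * (L * (2 / s n))" by (rule mult_left_mono) simp
    also have "\<dots> = L * (2 / K) / N n" using N[of n] K by (simp add: s_def power2_eq_square power3_eq_cube field_simps)
    also have "\<dots> \<le> L * (2 / K)" using N[of n] L(1) K by (simp add: divide_le_eq mult_le_cancel_left1)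
    finally show ?thesis using fl(2)[of n] by (simp add: c_def algebra_simps)
  qed
  have bump0: "std_bump (s n *\<^sub>R (x - z n)) = 0" if "x \<notin> S n" for n x
  proof (rule std_bump_eq_0)
    have "2 / s n < norm (x - z n)" using that by (simp add: S_def dist_norm norm_minus_commute)
    then show "2 \<le> norm (s n *\<^sub>R (x - z n))" using s[of n] by (simp add: divide_less_eq mult.commute)
  qed
  have G0: "G n x = 0" if "x \<notin> S n" for n x using bump0[OF that] by (simp add: G_def)
  have CkG: "Ck_nat j UNIV (G n)" if "enat j \<le> k" for j n
    unfolding G_def
    by (intro Ck_nat_mult Ck_nat_compose[OF open_UNIV open_UNIV subset_UNIV Ck_nat_std_bump Ck_nat_affine]
        Ck_nat_compose[OF open_UNIV open_UNIV subset_UNIV Ck_nat_exp] Ck_nat_add Ck_nat_const open_UNIV)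
      (use h that in \<open>auto simp: Ck_def\<close>)
  have pG: "poly_bdd_Ck j (\<lambda>_. UNIV) G" if j: "enat j \<le> k" for j
  proof (rule poly_bdd_Ck_UNIV)
    have hj: "Ck_nat j UNIV h" using h j by (simp add: Ck_def)
    show "poly_bdd_Ck j S G"
      unfolding G_def[abs_def]
    proof (rule poly_bdd_Ck_mult)
      show "poly_bdd_Ck j S (\<lambda>n x. std_bump (s n *\<^sub>R (x - z n)))"
      proof (rule poly_bdd_Ck_subset[OF poly_bdd_Ck_scaled])
        show "\<bar>s n\<bar> \<le> K * (real n + 1) ^ 3" for n using s[of n] by (simp add: s_def N_def)
        show "std_bump x = 0" if "x \<notin> cball 0 2" for x :: 'e using that by (intro std_bump_eq_0) auto
      qed (auto intro: Ck_nat_std_bump)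
      show "poly_bdd_Ck j S (\<lambda>n x. exp ((N n)\<^sup>2 * h x + c n))"
      proof (rule poly_bdd_Ck_exp[OF _ expb hj])
        show "\<bar>(N n)\<^sup>2\<bar> \<le> 1 * (real n + 1) ^ 2" for n by (simp add: N_def)
        show "poly_bdd_Ck j S (\<lambda>n. h)" by (rule poly_bdd_Ck_fixed[OF compact_cball Ssub hj])
      qed
      show "Ck_nat j UNIV (\<lambda>x. std_bump (s n *\<^sub>R (x - z n)))" for n
        by (rule Ck_nat_compose[OF open_UNIV open_UNIV subset_UNIV Ck_nat_std_bump Ck_nat_affine])
      show "Ck_nat j UNIV (\<lambda>x. exp ((N n)\<^sup>2 * h x + c n))" for n
        by (intro Ck_nat_compose[OF open_UNIV open_UNIV subset_UNIV Ck_nat_exp] Ck_nat_add Ck_nat_const Ck_nat_mult hj open_UNIV)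
    qed
  qed (auto simp: S_def G0)
  have "Ck k UNIV F"
    unfolding Ck_def F_def[abs_def]
  proof (intro allI impI Ck_nat_suminf)
    fix j n assume j: "enat j \<le> k"
    show "Ck_nat j UNIV (\<lambda>x. exp (- real n) * G n x)" by (intro Ck_nat_mult Ck_nat_const CkG j open_UNIV)
    show "sum_bdd j (\<lambda>n x. exp (- real n) * G n x)" using sum_bdd_exp_weight[OF pG CkG] j by blast
  qed
  moreover have "F x = 0" if "x \<notin> cball p (2 * \<rho>)" for x
  proof -
    have "G n x = 0" for n using that Ssub[of n] by (intro G0) auto
    then show ?thesis by (simp add: F_def)
  qed
  moreover have "z \<longlonglongrightarrow> p"
  proof -
    have "(\<lambda>n. \<rho> * inverse (real (Suc n))) \<longlonglongrightarrow> \<rho> * 0" by (intro tendsto_mult tendsto_const LIMSEQ_inverse_real_of_nat)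
    then have "(\<lambda>n. p + (\<rho> * inverse (real (Suc n))) *\<^sub>R e) \<longlonglongrightarrow> p + (\<rho> * 0) *\<^sub>R e"
      by (intro tendsto_add tendsto_scaleR tendsto_const)
    then show ?thesis by (simp add: z_def[abs_def] N_def divide_inverse add.commute)
  qed
  moreover have "z n \<in> cball p \<rho>" for n using zb[of n] by (simp add: dist_norm norm_minus_commute)
  moreover have "\<exists>W. open W \<and> z n \<in> W \<and> (\<forall>w\<in>W. F w = exp ((real n + 1)\<^sup>2 * h w + of_int (l n)))" for n
  proof (intro exI conjI ballI)
    show "z n \<in> ball (z n) (1 / s n)" using s by simp
    fix w assume w: "w \<in> ball (z n) (1 / s n)"
    then have w1: "norm (w - z n) < 1 / s n" by (simp add: dist_norm norm_minus_commute)
    then have "norm (w - z n) \<le> 2 / s n" using s[of n] by (simp add: divide_simps)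
    then have wS: "w \<in> S n" by (simp add: S_def dist_norm norm_minus_commute)
    \<comment> \<open>The supports are pairwise disjoint, so only one term of the series survives
      near \<open>z n\<close>.\<close>
    have "w \<notin> S m" if "m \<noteq> n" for m
      using disj[of n m] disj[of m n] wS that by (cases "m < n") auto
    then have "(\<lambda>m. exp (- real m) * G m w) = (\<lambda>m. if m = n then exp (- real n) * G n w else 0)"
      using G0 by (intro ext) auto
    then have "F w = exp (- real n) * G n w" using sums_unique[OF sums_single[of n "\<lambda>_. exp (- real n) * G n w"]] by (simp add: F_def)
    also have "std_bump (s n *\<^sub>R (w - z n)) = 1"
      using w1 s[of n] by (intro std_bump_eq_1) (auto simp: less_divide_eq mult.commute)
    then have "exp (- real n) * G n w = exp ((real n + 1)\<^sup>2 * h w + of_int (l n))"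
      by (simp add: G_def l_def c_def N_def flip: exp_add)
    finally show "F w = exp ((real n + 1)\<^sup>2 * h w + of_int (l n))" .
  qed auto
  moreover have "\<bar>(real n + 1)\<^sup>2 * h (z n) + of_int (l n)\<bar> \<le> real n + 1" for n
    using fl[of n] by (simp add: l_def N_def abs_le_iff)
  ultimately show ?thesis by (rule that)
qed

section \<open>Functions of class \<open>C\<^sup>k\<close> on a manifold\<close>

lemma Ck_cong: "open U \<Longrightarrow> (\<And>x. x \<in> U \<Longrightarrow> f x = g x) \<Longrightarrow> Ck k U f \<Longrightarrow> Ck k U g"
  unfolding Ck_def using Ck_nat_cong by blast

lemma Ck_subset: "V \<subseteq> U \<Longrightarrow> Ck k U f \<Longrightarrow> Ck k V f"
  unfolding Ck_def using Ck_nat_subset by blast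

lemma Ck_local: "(\<And>x. x \<in> U \<Longrightarrow> \<exists>V. open V \<and> x \<in> V \<and> Ck k V f) \<Longrightarrow> Ck k U f"
  unfolding Ck_def by (meson Ck_nat_local)

lemma Ck_continuous_on: "Ck k U f \<Longrightarrow> continuous_on U f"
  unfolding Ck_def by (metis Ck_nat.simps(1) zero_enat_def zero_le)

lemma Ck_const: "open U \<Longrightarrow> Ck k U (\<lambda>x. c)"
  by (simp add: Ck_def Ck_nat_const)

lemma Ck_add: "open U \<Longrightarrow> Ck k U f \<Longrightarrow> Ck k U g \<Longrightarrow> Ck k U (\<lambda>x. f x + g x)"
  by (simp add: Ck_def Ck_nat_add)

lemma Ck_mult: "open U \<Longrightarrow> Ck k U f \<Longrightarrow> Ck k U g \<Longrightarrow> Ck k U (\<lambda>x. f x * g x :: real)"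
  by (simp add: Ck_def Ck_nat_mult)

lemma Ck_bounded_linear: "bounded_linear L \<Longrightarrow> open U \<Longrightarrow> Ck k U f \<Longrightarrow> Ck k U (\<lambda>x. L (f x))"
  by (simp add: Ck_def Ck_nat_bounded_linear)

lemma Ck_id: "open U \<Longrightarrow> Ck k U (\<lambda>x. x)"
  by (simp add: Ck_def Ck_nat_id)

lemma Ck_euclideanI:
  fixes f :: "'e::euclidean_space \<Rightarrow> 'd::euclidean_space"
  shows "open U \<Longrightarrow> (\<And>j. j \<in> Basis \<Longrightarrow> Ck k U (\<lambda>x. f x \<bullet> j)) \<Longrightarrow> Ck k U f"
  by (simp add: Ck_def Ck_nat_euclideanI)

lemma Ck_compose:
  fixes f :: "'d::euclidean_space \<Rightarrow> real" and g :: "'e::euclidean_space \<Rightarrow> 'd"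
  shows "open U \<Longrightarrow> open V \<Longrightarrow> g ` U \<subseteq> V \<Longrightarrow> Ck k V f \<Longrightarrow> Ck k U g \<Longrightarrow> Ck k U (\<lambda>x. f (g x))"
  unfolding Ck_def using Ck_nat_compose by blast

lemma compact_closed_subset:
  assumes "compact K" "closed S" "S \<subseteq> K"
  shows "compact S"
  using compact_Int_closed[OF assms(1,2)] assms(3) by (simp add: Int_absorb1)

lemma isCont_eventually_nhds:
  assumes "isCont u x" "eventually P (nhds (u x))"
  shows "\<forall>\<^sub>F y in nhds x. P (u y)"
  using assms by (auto simp: isCont_def tendsto_at_iff_tendsto_nhds intro: eventually_compose_filterlim)

lemma isCont_eventually_in_open:
  assumes "isCont f x" "open W" "f x \<in> W"
  shows "\<forall>\<^sub>F y in nhds x. f y \<in> W"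
  using assms topological_tendstoD unfolding isCont_def tendsto_at_iff_tendsto_nhds by blast

lemma isCont_eventually_nonzero: "isCont f x \<Longrightarrow> f x \<noteq> (0::real) \<Longrightarrow> \<forall>\<^sub>F y in nhds x. f y \<noteq> 0"
  using isCont_eventually_in_open[of x f "- {0}"] by auto

lemma isCont_eventually_pos: "isCont f x \<Longrightarrow> f x > (0::real) \<Longrightarrow> \<forall>\<^sub>F y in nhds x. f y > 0"
  using isCont_eventually_in_open[of x f "{0<..}"] by auto

locale Ck_manifold =
  fixes k :: enat
    and A :: "('a::{t2_space,second_countable_topology} set \<times> ('a \<Rightarrow> 'e::euclidean_space)) set"
  assumes k: "1 \<le> k" and atlas: "Ck_atlas k A"
begin

section \<open>Charts and regularity at a point\<close>

lemma chart:
  assumes "(U, \<phi>) \<in> A"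
  shows "open U" "inj_on \<phi> U" "open (\<phi> ` U)" "continuous_on U \<phi>" "continuous_on (\<phi> ` U) (inv_into U \<phi>)"
  using atlas assms unfolding Ck_atlas_def by blast+

lemma chart_at:
  obtains U \<phi> where "(U, \<phi>) \<in> A" "x \<in> U"
proof -
  have "x \<in> \<Union>(fst ` A)" using atlas unfolding Ck_atlas_def by auto
  then show ?thesis using that by force
qed

lemma transition:
  "(U, \<phi>) \<in> A \<Longrightarrow> (V, \<psi>) \<in> A \<Longrightarrow> Ck k (\<phi> ` (U \<inter> V)) (\<psi> \<circ> inv_into U \<phi>)"
  using atlas unfolding Ck_atlas_def by blast

lemma open_chart_image:
  assumes c: "(U, \<phi>) \<in> A" and "open W"
  shows "open (\<phi> ` (U \<inter> W))"
proof -
  have "open (\<phi> ` U \<inter> inv_into U \<phi> -` W)"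
    by (rule continuous_open_preimage[OF chart(5)[OF c] chart(3)[OF c] assms(2)])
  moreover have "\<phi> ` U \<inter> inv_into U \<phi> -` W = \<phi> ` (U \<inter> W)"
    using chart(2)[OF c] by (auto simp: inv_into_f_f)
  ultimately show ?thesis by simp
qed

lemma open_chart_preimage:
  assumes c: "(U, \<phi>) \<in> A" and "open W"
  shows "open (U \<inter> \<phi> -` W)"
  by (rule continuous_open_preimage[OF chart(4)[OF c] chart(1)[OF c] assms(2)])

text \<open>Regularity as a property of the germ at \<open>x\<close>. With all charts quantified,
  the passage from \<open>Ck_funs\<close> is immediate; in practice one chart around
  \<open>x\<close> is used, through the two lemmas that follow.\<close>

definition Ck_at :: "('a \<Rightarrow> real) \<Rightarrow> 'a \<Rightarrow> bool" where
  "Ck_at f x = (\<exists>W. open W \<and> x \<in> W \<and> (\<forall>(U,\<phi>)\<in>A. Ck k (\<phi> ` (U \<inter> W)) (f \<circ> inv_into U \<phi>)))"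

lemma Ck_at_chartD:
  assumes "Ck_at f x" and c: "(U, \<phi>) \<in> A" and x: "x \<in> U"
  obtains V where "open V" "\<phi> x \<in> V" "V \<subseteq> \<phi> ` U" "Ck k V (f \<circ> inv_into U \<phi>)"
proof -
  obtain W where W: "open W" "x \<in> W" "\<forall>(U,\<phi>)\<in>A. Ck k (\<phi> ` (U \<inter> W)) (f \<circ> inv_into U \<phi>)"
    using assms(1) by (auto simp: Ck_at_def)
  show ?thesis
    by (rule that[of "\<phi> ` (U \<inter> W)"]) (use W x c open_chart_image[OF c W(1)] in auto)
qed

text \<open>In any other chart the expression of \<open>f\<close> is the given one composed with a
  transition map, so one chart decides.\<close>

lemma Ck_at_chartI:
  assumes c: "(U, \<phi>) \<in> A" and x: "x \<in> U" and V: "open V" "\<phi> x \<in> V" "Ck k V (f \<circ> inv_into U \<phi>)"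
  shows "Ck_at f x"
  unfolding Ck_at_def
proof (intro exI conjI ballI)
  let ?W = "U \<inter> \<phi> -` V"
  show "open ?W" "x \<in> ?W" using open_chart_preimage[OF c V(1)] x V by auto
  show "case d of (U', \<psi>) \<Rightarrow> Ck k (\<psi> ` (U' \<inter> ?W)) (f \<circ> inv_into U' \<psi>)" if d: "d \<in> A" for d
  proof -
    obtain U' \<psi> where d': "d = (U', \<psi>)" by force
    then have dA: "(U', \<psi>) \<in> A" using d by simp
    have op: "open (\<psi> ` (U' \<inter> ?W))" using open_chart_image[OF dA] open_chart_preimage[OF c V(1)] by blast
    have "Ck k (\<psi> ` (U' \<inter> ?W)) (\<lambda>z. (f \<circ> inv_into U \<phi>) ((\<phi> \<circ> inv_into U' \<psi>) z))"
    proof (rule Ck_compose[OF op V(1) _ V(3)])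
      show "Ck k (\<psi> ` (U' \<inter> ?W)) (\<phi> \<circ> inv_into U' \<psi>)"
        by (rule Ck_subset[OF _ transition[OF dA c]]) auto
    qed (use chart(2)[OF dA] in \<open>auto simp: inv_into_f_f\<close>)
    then have "Ck k (\<psi> ` (U' \<inter> ?W)) (f \<circ> inv_into U' \<psi>)"
      by (rule Ck_cong[OF op, rotated]) (use chart(2)[OF dA] chart(2)[OF c] in \<open>auto simp: inv_into_f_f\<close>)
    then show ?thesis by (simp add: d')
  qed
qed

lemma Ck_funs_iff: "f \<in> Ck_funs k A \<longleftrightarrow> (\<forall>x. Ck_at f x)"
proof
  assume f: "f \<in> Ck_funs k A"
  show "\<forall>x. Ck_at f x"
    unfolding Ck_at_def by (rule allI, rule exI[of _ UNIV]) (use f in \<open>auto simp: Ck_funs_def\<close>)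
next
  assume f: "\<forall>x. Ck_at f x"
  have "Ck k (\<phi> ` U) (f \<circ> inv_into U \<phi>)" if c: "(U, \<phi>) \<in> A" for U \<phi>
  proof (rule Ck_local)
    fix z assume "z \<in> \<phi> ` U"
    then obtain x where x: "x \<in> U" "z = \<phi> x" by auto
    from Ck_at_chartD[OF f[rule_format] c x(1)] show "\<exists>V. open V \<and> z \<in> V \<and> Ck k V (f \<circ> inv_into U \<phi>)"
      using x(2) by metis
  qed
  then show "f \<in> Ck_funs k A" by (auto simp: Ck_funs_def)
qed

lemma Ck_at_cong:
  assumes "\<forall>\<^sub>F y in nhds x. f y = g y" "Ck_at f x"
  shows "Ck_at g x"
proof -
  obtain U \<phi> where c: "(U, \<phi>) \<in> A" "x \<in> U" by (rule chart_at)
  obtain V where V: "open V" "\<phi> x \<in> V" "V \<subseteq> \<phi> ` U" "Ck k V (f \<circ> inv_into U \<phi>)"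
    by (rule Ck_at_chartD[OF assms(2) c])
  obtain W where W: "open W" "x \<in> W" "\<And>y. y \<in> W \<Longrightarrow> f y = g y"
    using assms(1) by (auto simp: eventually_nhds)
  let ?V = "V \<inter> \<phi> ` (U \<inter> W)"
  have op: "open ?V" using V open_chart_image[OF c(1) W(1)] by blast
  have "Ck k ?V (g \<circ> inv_into U \<phi>)"
    by (rule Ck_cong[OF op _ Ck_subset[OF _ V(4)]])
      (use W chart(2)[OF c(1)] in \<open>auto simp: inv_into_f_f\<close>)
  then show ?thesis using Ck_at_chartI[OF c op] V W c by blast
qed

lemma Ck_at_eventually: "Ck_at f x \<Longrightarrow> \<forall>\<^sub>F y in nhds x. Ck_at f y"
  unfolding Ck_at_def eventually_nhds by blast

lemma Ck_at_const: "Ck_at (\<lambda>y. c) x"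
  unfolding Ck_at_def o_def
  by (rule exI[of _ UNIV]) (auto intro!: Ck_const chart)

lemma Ck_at_binop:
  assumes "Ck_at f x" "Ck_at g x"
    and P: "\<And>V u v. open V \<Longrightarrow> Ck k V u \<Longrightarrow> Ck k V v \<Longrightarrow> Ck k V (\<lambda>z::'e. P (u z) (v z))"
  shows "Ck_at (\<lambda>y. P (f y) (g y)) x"
proof -
  obtain U \<phi> where c: "(U, \<phi>) \<in> A" "x \<in> U" by (rule chart_at)
  obtain V where V: "open V" "\<phi> x \<in> V" "V \<subseteq> \<phi> ` U" "Ck k V (f \<circ> inv_into U \<phi>)"
    by (rule Ck_at_chartD[OF assms(1) c])
  obtain V' where V': "open V'" "\<phi> x \<in> V'" "V' \<subseteq> \<phi> ` U" "Ck k V' (g \<circ> inv_into U \<phi>)"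
    by (rule Ck_at_chartD[OF assms(2) c])
  have "Ck k (V \<inter> V') (\<lambda>z. P ((f \<circ> inv_into U \<phi>) z) ((g \<circ> inv_into U \<phi>) z))"
    by (intro P open_Int V V' Ck_subset[OF _ V(4)] Ck_subset[OF _ V'(4)]) auto
  then have "Ck k (V \<inter> V') ((\<lambda>y. P (f y) (g y)) \<circ> inv_into U \<phi>)" by (simp add: o_def)
  then show ?thesis using Ck_at_chartI[OF c open_Int[OF V(1) V'(1)]] V V' by blast
qed

lemma Ck_at_add: "Ck_at f x \<Longrightarrow> Ck_at g x \<Longrightarrow> Ck_at (\<lambda>y. f y + g y) x"
  by (rule Ck_at_binop[where P="(+)"]) (auto intro: Ck_add)

lemma Ck_at_mult: "Ck_at f x \<Longrightarrow> Ck_at g x \<Longrightarrow> Ck_at (\<lambda>y. f y * g y) x"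
  by (rule Ck_at_binop[where P="(*)"]) (auto intro: Ck_mult)

lemma Ck_at_sum: "(\<And>i. i \<in> I \<Longrightarrow> Ck_at (f i) x) \<Longrightarrow> Ck_at (\<lambda>y. \<Sum>i\<in>I. f i y) x"
  by (induction I rule: infinite_finite_induct) (auto intro: Ck_at_const Ck_at_add)

lemma Ck_at_isCont:
  assumes "Ck_at f x"
  shows "isCont f x"
proof -
  obtain U \<phi> where c: "(U, \<phi>) \<in> A" "x \<in> U" by (rule chart_at)
  obtain V where V: "open V" "\<phi> x \<in> V" "V \<subseteq> \<phi> ` U" "Ck k V (f \<circ> inv_into U \<phi>)"
    by (rule Ck_at_chartD[OF assms(1) c])
  have op: "open (U \<inter> \<phi> -` V)" using open_chart_preimage[OF c(1) V(1)] .
  have "continuous_on (U \<inter> \<phi> -` V) (\<lambda>y. (f \<circ> inv_into U \<phi>) (\<phi> y))"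
    by (rule continuous_on_compose2[OF Ck_continuous_on[OF V(4)]])
      (use chart(4)[OF c(1)] in \<open>auto intro: continuous_on_subset\<close>)
  then have "continuous_on (U \<inter> \<phi> -` V) f"
    by (rule continuous_on_eq) (use chart(2)[OF c(1)] in \<open>auto simp: inv_into_f_f\<close>)
  then show ?thesis using op c V by (simp add: continuous_on_eq_continuous_at)
qed

lemma Ck_at_compose:
  assumes "Ck_at f x" "open I" "f x \<in> I" "\<And>n. Ck_nat n I g"
  shows "Ck_at (\<lambda>y. g (f y)) x"
proof -
  obtain U \<phi> where c: "(U, \<phi>) \<in> A" "x \<in> U" by (rule chart_at)
  obtain V where V: "open V" "\<phi> x \<in> V" "V \<subseteq> \<phi> ` U" "Ck k V (f \<circ> inv_into U \<phi>)"
    by (rule Ck_at_chartD[OF assms(1) c])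
  let ?V = "V \<inter> (f \<circ> inv_into U \<phi>) -` I"
  have op: "open ?V" by (rule continuous_open_preimage[OF Ck_continuous_on[OF V(4)] V(1) assms(2)])
  have "Ck k ?V (\<lambda>z. g ((f \<circ> inv_into U \<phi>) z))"
    by (rule Ck_compose[OF op assms(2) _ _ Ck_subset[OF _ V(4)]]) (use assms in \<open>auto simp: Ck_def\<close>)
  then have "Ck k ?V ((\<lambda>y. g (f y)) \<circ> inv_into U \<phi>)" by (simp add: o_def)
  then show ?thesis 
    by (rule Ck_at_chartI[OF c op, rotated]) (use V c chart(2)[OF c(1)] assms in \<open>auto simp: inv_into_f_f\<close>)
qed

lemma Ck_at_exp: "Ck_at f x \<Longrightarrow> Ck_at (\<lambda>y. exp (f y)) x"
  by (rule Ck_at_compose[OF _ open_UNIV]) (auto intro: Ck_nat_exp)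

lemma Ck_at_ln: "Ck_at f x \<Longrightarrow> f x > 0 \<Longrightarrow> Ck_at (\<lambda>y. ln (f y)) x"
  by (rule Ck_at_compose[where I="{0<..}"]) (auto intro: Ck_nat_ln)

lemma Ck_at_inverse: "Ck_at f x \<Longrightarrow> f x \<noteq> 0 \<Longrightarrow> Ck_at (\<lambda>y. inverse (f y)) x"
  by (rule Ck_at_compose[where I="- {0}"]) (auto intro: Ck_nat_inverse)

lemma Ck_at_coordinate:
  assumes c: "(U, \<phi>) \<in> A" "x \<in> U"
  shows "Ck_at (\<lambda>y. \<phi> y \<bullet> j) x"
proof (rule Ck_at_chartI[OF c chart(3)[OF c(1)]])
  show "Ck k (\<phi> ` U) ((\<lambda>y. \<phi> y \<bullet> j) \<circ> inv_into U \<phi>)"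
    by (rule Ck_cong[OF _ _ Ck_bounded_linear[OF bounded_linear_inner_left[of j] _ Ck_id]])
      (use chart[OF c(1)] in \<open>auto simp: f_inv_into_f\<close>)
qed (use c in auto)

section \<open>Cut-off functions on the manifold\<close>

lemma Ck_c_funs_iff: "f \<in> Ck_c_funs k A \<longleftrightarrow> (\<forall>x. Ck_at f x) \<and> compact (closure {x. f x \<noteq> 0})"
  by (simp add: Ck_c_funs_def Ck_funs_iff)

lemma Ck_c_funs_D: "f \<in> Ck_c_funs k A \<Longrightarrow> Ck_at f x"
  by (simp add: Ck_c_funs_iff)

text \<open>Extension by zero. The Hausdorff property makes the compact set corresponding to
  \<open>C\<close> closed, so each point outside the chart has a neighbourhood on which
  \<open>g\<close> vanishes.\<close>

lemma pull_back_chart: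
  assumes c: "(U, \<phi>) \<in> A" and F: "Ck k UNIV F" and C: "compact C" "C \<subseteq> \<phi> ` U" "\<And>z. z \<notin> C \<Longrightarrow> F z = 0"
    and g_def: "\<And>x. g x = (if x \<in> U then F (\<phi> x) else 0)"
  shows "g \<in> Ck_c_funs k A" "closure {x. g x \<noteq> 0} \<subseteq> inv_into U \<phi> ` C"
proof -
  let ?D = "inv_into U \<phi> ` C"
  have D: "compact ?D" by (rule compact_continuous_image[OF continuous_on_subset[OF chart(5)[OF c] C(2)] C(1)])
  have sub: "{x. g x \<noteq> 0} \<subseteq> ?D"
  proof
    fix x assume "x \<in> {x. g x \<noteq> 0}"
    then have x: "x \<in> U" "F (\<phi> x) \<noteq> 0" by (auto simp: g_def split: if_splits)
    then have "\<phi> x \<in> C" using C(3) by blast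
    then show "x \<in> ?D" using x chart(2)[OF c] by (metis image_eqI inv_into_f_f)
  qed
  then show cl: "closure {x. g x \<noteq> 0} \<subseteq> ?D" using D by (simp add: closure_minimal compact_imp_closed)
  have "Ck_at g x" for x
  proof (cases "x \<in> U")
    case True
    show ?thesis
    proof (rule Ck_at_chartI[OF c True chart(3)[OF c]])
      show "Ck k (\<phi> ` U) (g \<circ> inv_into U \<phi>)"
        by (rule Ck_cong[OF chart(3)[OF c] _ Ck_subset[OF _ F]])
          (auto simp: g_def f_inv_into_f inv_into_into)
    qed (use True in auto)
  next
    case False
    have "?D \<subseteq> U" using C(2) by (auto intro: inv_into_into)
    then have "x \<in> - ?D" using False by auto
    moreover have "open (- ?D)" using D by (simp add: compact_imp_closed open_Compl)
    moreover have "0 = g y" if "y \<in> - ?D" for y using sub that by (cases "g y = 0") auto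
    ultimately have "\<forall>\<^sub>F y in nhds x. 0 = g y" unfolding eventually_nhds by (intro exI[of _ "- ?D"]) simp
    then show ?thesis by (rule Ck_at_cong) (rule Ck_at_const)
  qed
  moreover have "compact (closure {x. g x \<noteq> 0})"
    by (rule compact_closed_subset[OF D closed_closure cl])
  ultimately show "g \<in> Ck_c_funs k A" by (simp add: Ck_c_funs_iff)
qed

lemma exists_bump:
  assumes "open W" "x \<in> W"
  obtains b where "b \<in> Ck_c_funs k A" "\<forall>\<^sub>F y in nhds x. b y = 1" "closure {y. b y \<noteq> 0} \<subseteq> W"
proof -
  obtain U \<phi> where c: "(U, \<phi>) \<in> A" "x \<in> U" by (rule chart_at)
  have op: "open (\<phi> ` (U \<inter> W))" by (rule open_chart_image[OF c(1) assms(1)])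
  moreover have "\<phi> x \<in> \<phi> ` (U \<inter> W)" using c assms by auto
  ultimately obtain e where e: "e > 0" "cball (\<phi> x) e \<subseteq> \<phi> ` (U \<inter> W)" by (meson open_contains_cball)
  \<comment> \<open>The scaling puts the sphere of radius 2, beyond which \<open>std_bump\<close>
    vanishes, at distance \<open>e\<close>, and the unit sphere at distance
    \<open>e / 2\<close>.\<close>
  define F where "F z = std_bump ((2 / e) *\<^sub>R (z - \<phi> x))" for z
  define b where "b y = (if y \<in> U then F (\<phi> y) else 0)" for y
  have F: "Ck k UNIV F"
    unfolding F_def[abs_def] Ck_def
    by (intro allI impI Ck_nat_compose[OF open_UNIV open_UNIV subset_UNIV Ck_nat_std_bump Ck_nat_affine])
  have F0: "F z = 0" if "z \<notin> cball (\<phi> x) e" for z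
  proof -
    have "e < norm (z - \<phi> x)" using that by (simp add: dist_norm norm_minus_commute)
    then have "2 \<le> 2 / e * norm (z - \<phi> x)" using e(1) by (simp add: le_divide_eq)
    then show ?thesis unfolding F_def using e(1) by (intro std_bump_eq_0) (simp del: scaleR_diff_right)
  qed
  have sub: "cball (\<phi> x) e \<subseteq> \<phi> ` U" using e by auto
  have pb: "b \<in> Ck_c_funs k A" "closure {y. b y \<noteq> 0} \<subseteq> inv_into U \<phi> ` cball (\<phi> x) e"
    by (rule pull_back_chart[OF c(1) F compact_cball sub _ b_def], erule F0)+
  have "inv_into U \<phi> ` cball (\<phi> x) e \<subseteq> W"
  proof
    fix y assume "y \<in> inv_into U \<phi> ` cball (\<phi> x) e"
    then obtain w where "w \<in> U \<inter> W" "y = inv_into U \<phi> (\<phi> w)" using e by blast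
    then show "y \<in> W" using chart(2)[OF c(1)] by (auto simp: inv_into_f_f)
  qed
  then have "closure {y. b y \<noteq> 0} \<subseteq> W" using pb(2) by simp
  moreover have "\<forall>\<^sub>F y in nhds x. b y = 1"
    unfolding eventually_nhds
  proof (intro exI conjI ballI)
    show "open (U \<inter> \<phi> -` ball (\<phi> x) (e / 2))" by (rule open_chart_preimage[OF c(1)]) auto
    show "x \<in> U \<inter> \<phi> -` ball (\<phi> x) (e / 2)" using c e by auto
    fix y assume "y \<in> U \<inter> \<phi> -` ball (\<phi> x) (e / 2)"
    then have y: "y \<in> U" "norm (\<phi> y - \<phi> x) < e / 2" by (auto simp: dist_norm norm_minus_commute)
    then have "2 / e * norm (\<phi> y - \<phi> x) \<le> 1" using e(1) by (simp add: divide_le_eq)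
    then show "b y = 1" using y(1) e(1) unfolding b_def F_def
      by (auto intro!: std_bump_eq_1 simp del: scaleR_diff_right)
  qed
  ultimately show ?thesis using that pb(1) by blast
qed

text \<open>Off the support of \<open>f\<close> the product is zero near the point, so regularity of
  \<open>g\<close> matters on that support alone. This is how locally regular expressions are cut
  off.\<close>

lemma Ck_c_funs_mult:
  assumes "f \<in> Ck_c_funs k A" "\<And>x. x \<in> closure {x. f x \<noteq> 0} \<Longrightarrow> Ck_at g x"
  shows "(\<lambda>x. f x * g x) \<in> Ck_c_funs k A"
proof -
  have "Ck_at (\<lambda>x. f x * g x) x" for x
  proof (cases "x \<in> closure {x. f x \<noteq> 0}")
    case True
    then show ?thesis using assms by (intro Ck_at_mult) (auto simp: Ck_c_funs_D)
  next
    case False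
    have "\<forall>\<^sub>F y in nhds x. 0 = f y * g y"
      unfolding eventually_nhds by (rule exI[of _ "- closure {x. f x \<noteq> 0}"]) (use False closure_subset[of "{x. f x \<noteq> 0}"] in auto)
    then show ?thesis by (rule Ck_at_cong) (rule Ck_at_const)
  qed
  moreover have "compact (closure {x. f x * g x \<noteq> 0})"
  proof -
    have "closure {x. f x * g x \<noteq> 0} \<subseteq> closure {x. f x \<noteq> 0}" by (intro closure_mono) auto
    then show ?thesis using assms(1) unfolding Ck_c_funs_iff
      by (intro compact_closed_subset[OF _ closed_closure]) auto
  qed
  ultimately show ?thesis by (simp add: Ck_c_funs_iff)
qed

text \<open>Every germ is realised by a compactly supported function, which lies in each of the
  three spaces; so \<open>T\<close> can be evaluated on germs of constants, inverses, logarithms and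
  coordinates.\<close>

lemma Ck_at_extend:
  assumes "Ck_at f x"
  obtains g where "g \<in> Ck_c_funs k A" "\<forall>\<^sub>F y in nhds x. g y = f y"
proof -
  obtain W where W: "open W" "x \<in> W" "\<And>y. y \<in> W \<Longrightarrow> Ck_at f y"
    using Ck_at_eventually[OF assms] by (auto simp: eventually_nhds)
  obtain b where b: "b \<in> Ck_c_funs k A" "\<forall>\<^sub>F y in nhds x. b y = 1" "closure {y. b y \<noteq> 0} \<subseteq> W"
    using exists_bump[OF W(1,2)] .
  have "(\<lambda>y. b y * f y) \<in> Ck_c_funs k A" using b W by (intro Ck_c_funs_mult) auto
  moreover have "\<forall>\<^sub>F y in nhds x. b y * f y = f y" using b(2) by eventually_elim auto
  ultimately show ?thesis using that by blast
qed

text \<open>A manifold modelled on a \<open>euclidean_space\<close> type has positive dimension,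
  hence no isolated points.\<close>

lemma exists_other_point:
  fixes x :: 'a
  assumes "open W" "x \<in> W"
  obtains y where "y \<in> W" "y \<noteq> x"
proof -
  obtain U \<phi> where c: "(U, \<phi>) \<in> A" "x \<in> U" by (rule chart_at)
  have "open (\<phi> ` (U \<inter> W))" by (rule open_chart_image[OF c(1) assms(1)])
  moreover have "\<phi> x \<in> \<phi> ` (U \<inter> W)" using c assms by auto
  ultimately have "\<phi> ` (U \<inter> W) \<noteq> {\<phi> x}" using not_open_singleton by metis
  then show ?thesis using that assms c by blast
qed

text \<open>It suffices to test composites with functions, because near \<open>u x\<close> every
  coordinate of a chart agrees with a member of \<open>Ck_c_funs\<close>.\<close>

lemma Ck_mapI:
  assumes u: "continuous_on UNIV u" and f: "\<And>f x. f \<in> Ck_c_funs k A \<Longrightarrow> Ck_at (\<lambda>x. f (u x)) x"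
  shows "Ck_map k A u"
proof -
  have "Ck k (\<phi> ` (U \<inter> u -` V)) (\<psi> \<circ> u \<circ> inv_into U \<phi>)" if c: "(U, \<phi>) \<in> A" "(V, \<psi>) \<in> A" for U \<phi> V \<psi>
  proof (rule Ck_euclideanI)
    have ov: "open (u -` V)" using u chart(1)[OF c(2)] by (simp add: continuous_on_open_vimage)
    show "open (\<phi> ` (U \<inter> u -` V))" by (rule open_chart_image[OF c(1) ov])
    show "Ck k (\<phi> ` (U \<inter> u -` V)) (\<lambda>z. (\<psi> \<circ> u \<circ> inv_into U \<phi>) z \<bullet> j)" for j
    proof (rule Ck_local)
      fix z assume "z \<in> \<phi> ` (U \<inter> u -` V)"
      then obtain x where x: "x \<in> U" "u x \<in> V" "z = \<phi> x" by auto
      obtain g where g: "g \<in> Ck_c_funs k A" "\<forall>\<^sub>F y in nhds (u x). g y = \<psi> y \<bullet> j"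
        by (rule Ck_at_extend[OF Ck_at_coordinate[OF c(2) x(2)]])
      have "isCont u x" using u by (simp add: continuous_on_eq_continuous_at)
      then have "\<forall>\<^sub>F y in nhds x. g (u y) = \<psi> (u y) \<bullet> j"
        by (rule isCont_eventually_nhds) (rule g(2))
      then have "Ck_at (\<lambda>y. \<psi> (u y) \<bullet> j) x" by (rule Ck_at_cong) (rule f[OF g(1)])
      from Ck_at_chartD[OF this c(1) x(1)]
      show "\<exists>V. open V \<and> z \<in> V \<and> Ck k V (\<lambda>z. (\<psi> \<circ> u \<circ> inv_into U \<phi>) z \<bullet> j)"
        unfolding x(3) by (auto simp: o_def)
    qed
  qed
  then show ?thesis using u by (auto simp: Ck_map_def)
qed

end

section \<open>Euclidean space as a manifold, and constructions carried over by charts\<close>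

lemma Ck_atlas_id: "Ck_atlas k (id_atlas :: ('e::euclidean_space set \<times> ('e \<Rightarrow> 'e)) set)"
  by (auto simp: Ck_atlas_def id_atlas_def inv_id o_def id_def[symmetric] intro!: Ck_id[unfolded id_def[symmetric]])

lemma Ck_funs_id: "Ck_funs k (id_atlas :: ('e::euclidean_space set \<times> ('e \<Rightarrow> 'e)) set) = {f. Ck k UNIV f}"
  by (auto simp: Ck_funs_def id_atlas_def inv_id)

context Ck_manifold
begin

lemma exists_spikes_manifold:
  assumes "Ck_at h x"
  obtains F xs and l :: "nat \<Rightarrow> int" where "F \<in> Ck_c_funs k A" "xs \<longlonglongrightarrow> x"
    "\<And>n. \<forall>\<^sub>F w in nhds (xs n). F w = exp ((real n + 1)\<^sup>2 * h w + of_int (l n))"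
    "\<And>n. \<bar>(real n + 1)\<^sup>2 * h (xs n) + of_int (l n)\<bar> \<le> real n + 1"
proof -
  \<comment> \<open>\<open>h\<close> is given only near \<open>x\<close>, whereas
    \<open>exists_spikes\<close> takes a function on the whole space. Regarding Euclidean space as a
    manifold with one chart gives the extension \<open>h'\<close> of the coordinate
    expression.\<close>
  interpret E: Ck_manifold k "id_atlas :: ('e set \<times> ('e \<Rightarrow> 'e)) set"
    using k Ck_atlas_id by unfold_locales
  obtain U \<phi> where c: "(U, \<phi>) \<in> A" "x \<in> U" by (rule chart_at)
  obtain V where V: "open V" "\<phi> x \<in> V" "V \<subseteq> \<phi> ` U" "Ck k V (h \<circ> inv_into U \<phi>)"
    by (rule Ck_at_chartD[OF assms(1) c])
  have "E.Ck_at (h \<circ> inv_into U \<phi>) (\<phi> x)"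
    by (rule E.Ck_at_chartI[where U=UNIV and \<phi>=id, OF _ _ V(1)]) (use V in \<open>auto simp: id_atlas_def inv_id\<close>)
  then obtain h' where h': "h' \<in> Ck_c_funs k id_atlas" "\<forall>\<^sub>F z in nhds (\<phi> x). h' z = (h \<circ> inv_into U \<phi>) z"
    by (rule E.Ck_at_extend)
  obtain O' where O': "open O'" "\<phi> x \<in> O'" "\<And>z. z \<in> O' \<Longrightarrow> h' z = (h \<circ> inv_into U \<phi>) z"
    using h'(2) unfolding eventually_nhds by blast
  have "open (O' \<inter> V)" "\<phi> x \<in> O' \<inter> V" using O' V by auto
  then obtain e where e: "e > 0" "cball (\<phi> x) e \<subseteq> O' \<inter> V" by (meson open_contains_cball)
  \<comment> \<open>The spikes reach out to radius \<open>2 * \<rho>\<close>, which must stay inside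
    \<open>cball (\<phi> x) e\<close>.\<close>
  define \<rho> where "\<rho> = e / 2"
  have \<rho>: "\<rho> > 0" "2 * \<rho> = e" using e by (auto simp: \<rho>_def)
  have "Ck k UNIV h'" using h'(1) by (auto simp: Ck_c_funs_def Ck_funs_id)
  then obtain F z and l :: "nat \<Rightarrow> int" where F: 
    "Ck k UNIV F" "\<And>y. y \<notin> cball (\<phi> x) (2 * \<rho>) \<Longrightarrow> F y = 0" "z \<longlonglongrightarrow> \<phi> x" "\<And>n. z n \<in> cball (\<phi> x) \<rho>"
    "\<And>n. \<exists>W. open W \<and> z n \<in> W \<and> (\<forall>w\<in>W. F w = exp ((real n + 1)\<^sup>2 * h' w + of_int (l n)))"
    "\<And>n. \<bar>(real n + 1)\<^sup>2 * h' (z n) + of_int (l n)\<bar> \<le> real n + 1"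
    using exists_spikes[OF _ k \<rho>(1)] by metis
  have zn: "z n \<in> O'" "z n \<in> \<phi> ` U" for n
  proof -
    have "z n \<in> cball (\<phi> x) e" using F(4)[of n] \<rho> by auto
    then show "z n \<in> O'" "z n \<in> \<phi> ` U" using e V by blast+
  qed
  have sub: "cball (\<phi> x) (2 * \<rho>) \<subseteq> \<phi> ` U" using e V \<rho> by blast
  define G where "G y = (if y \<in> U then F (\<phi> y) else 0)" for y
  define xs where "xs n = inv_into U \<phi> (z n)" for n
  have xs: "xs n \<in> U" "\<phi> (xs n) = z n" for n
    using zn(2)[of n] by (auto simp: xs_def inv_into_into f_inv_into_f)
  have "G \<in> Ck_c_funs k A"
    by (rule pull_back_chart(1)[OF c(1) F(1) compact_cball sub _ G_def]) (rule F(2))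
  moreover have "xs \<longlonglongrightarrow> x"
  proof -
    have "isCont (inv_into U \<phi>) (\<phi> x)"
      using chart(3,5)[OF c(1)] c(2) by (simp add: continuous_on_eq_continuous_at)
    from isCont_tendsto_compose[OF this F(3)] show ?thesis
      using chart(2)[OF c(1)] c(2) by (simp add: xs_def[abs_def] inv_into_f_f)
  qed
  moreover have "\<forall>\<^sub>F w in nhds (xs n). G w = exp ((real n + 1)\<^sup>2 * h w + of_int (l n))" for n
  proof -
    obtain W where W: "open W" "z n \<in> W" "\<forall>w\<in>W. F w = exp ((real n + 1)\<^sup>2 * h' w + of_int (l n))"
      using F(5) by blast
    show ?thesis unfolding eventually_nhds
    proof (intro exI conjI ballI)
      show "open (U \<inter> \<phi> -` (W \<inter> O'))" by (rule open_chart_preimage[OF c(1)]) (use W O' in auto)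
      show "xs n \<in> U \<inter> \<phi> -` (W \<inter> O')" using xs zn W by auto
      fix w assume w: "w \<in> U \<inter> \<phi> -` (W \<inter> O')"
      then have "h' (\<phi> w) = h w" using O'(3) chart(2)[OF c(1)] by (simp add: inv_into_f_f)
      then show "G w = exp ((real n + 1)\<^sup>2 * h w + of_int (l n))" using w W by (simp add: G_def)
    qed
  qed
  moreover have "\<bar>(real n + 1)\<^sup>2 * h (xs n) + of_int (l n)\<bar> \<le> real n + 1" for n
    using F(6)[of n] O'(3)[OF zn(1)[of n]] by (simp add: xs_def)
  ultimately show ?thesis by (rule that)
qed

text \<open>For \<open>p x < 1\<close> the function \<open>sgn t * \<bar>t\<bar> powr p\<close> would have an infinite slope at \<open>t = 0\<close>.\<close>
lemma exponent_ge_1: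
  assumes c: "(U, \<phi>) \<in> A" "x \<in> U" and e: "e \<in> Basis" and p: "isCont p x"
    and f: "Ck_at f x" and feq: "\<forall>\<^sub>F y in nhds x. f y = sgn ((\<phi> y - \<phi> x) \<bullet> e) * \<bar>(\<phi> y - \<phi> x) \<bullet> e\<bar> powr p y"
  shows "p x \<ge> 1"
proof (rule ccontr)
  assume "\<not> p x \<ge> 1"
  \<comment> \<open>Half the gap, so that \<open>p\<close> stays below \<open>1 - \<delta>\<close>
    near \<open>x\<close>. For \<open>0 < t < 1\<close> small, the difference quotient
    \<open>t powr (p (c t) - 1)\<close> along the coordinate line \<open>c\<close> is then at least
    \<open>t powr (- \<delta>)\<close>, which is unbounded as \<open>t\<close> tends to 0.\<close>
  define \<delta> where "\<delta> = (1 - p x) / 2"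
  have \<delta>: "\<delta> > 0" "p x < 1 - \<delta>" using \<open>\<not> p x \<ge> 1\<close> by (auto simp: \<delta>_def field_simps)
  define c where "c t = inv_into U \<phi> (\<phi> x + t *\<^sub>R e)" for t :: real
  obtain V where V: "open V" "\<phi> x \<in> V" "V \<subseteq> \<phi> ` U" "Ck k V (f \<circ> inv_into U \<phi>)"
    by (rule Ck_at_chartD[OF f \<open>(U, \<phi>) \<in> A\<close> assms(2)])
  have "Ck_nat 1 V (f \<circ> inv_into U \<phi>)" using V(4) k unfolding Ck_def by (simp only: one_enat_def)
  then have "(f \<circ> inv_into U \<phi>) differentiable (at (\<phi> x))" using V(2) by simp
  then obtain D where D: "((f \<circ> inv_into U \<phi>) has_derivative D) (at (\<phi> x + 0 *\<^sub>R e))"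
    by (auto simp: differentiable_def)
  then have "((\<lambda>t. (f \<circ> inv_into U \<phi>) (\<phi> x + t *\<^sub>R e)) has_derivative (\<lambda>t. D (t *\<^sub>R e))) (at 0)"
    by (rule has_derivative_compose[rotated]) (auto intro!: derivative_eq_intros)
  then have "((\<lambda>t. f (c t)) has_derivative (\<lambda>t. D (t *\<^sub>R e))) (at 0)" by (simp add: c_def[abs_def])
  moreover have "linear D" using D by (rule has_derivative_linear)
  then have "(\<lambda>t. D (t *\<^sub>R e)) = (*) (D e)" by (intro ext) (simp add: linear_scale)
  ultimately have "((\<lambda>t. f (c t)) has_real_derivative D e) (at 0)"
    by (simp add: has_field_derivative_def)
  then have lim: "((\<lambda>t. (f (c t) - f (c 0)) / t) \<longlongrightarrow> D e) (at_right 0)"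
    by (auto simp: has_field_derivative_iff intro: tendsto_mono[OF at_le])
  have c0: "c 0 = x" using chart(2)[OF assms(1)] assms(2) by (simp add: c_def inv_into_f_f)
  have tend: "((\<lambda>t. \<phi> x + t *\<^sub>R e) \<longlongrightarrow> \<phi> x) (at_right 0)"
    by (auto intro!: tendsto_eq_intros)
  have "isCont (inv_into U \<phi>) (\<phi> x)"
    using chart(3,5)[OF assms(1)] assms(2) by (simp add: continuous_on_eq_continuous_at)
  then have cx: "(c \<longlongrightarrow> x) (at_right 0)"
    using isCont_tendsto_compose[OF _ tend] c0 unfolding c_def[abs_def] by fastforce
  have inU: "\<forall>\<^sub>F t in at_right 0. \<phi> x + t *\<^sub>R e \<in> \<phi> ` U"
    using topological_tendstoD[OF tend chart(3)[OF assms(1)]] assms(2) by auto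
  have "\<forall>\<^sub>F y in nhds x. p y < 1 - \<delta>" 
    using isCont_eventually_nhds[OF p, of "\<lambda>t. t < 1 - \<delta>"] \<delta>(2)
    by (simp add: eventually_nhds) (meson lessThan_iff open_lessThan)
  then have "\<forall>\<^sub>F t in at_right 0. p (c t) < 1 - \<delta>" "\<forall>\<^sub>F t in at_right 0. f (c t) = sgn ((\<phi> (c t) - \<phi> x) \<bullet> e) * \<bar>(\<phi> (c t) - \<phi> x) \<bullet> e\<bar> powr p (c t)"
    using cx feq unfolding filterlim_def le_filter_def eventually_filtermap by auto
  moreover have "\<forall>\<^sub>F t in at_right 0. (f (c t) - f (c 0)) / t < D e + 1"
    using order_tendstoD(2)[OF lim, of "D e + 1"] by simp
  moreover have "filterlim (\<lambda>t::real. t powr (- \<delta>)) at_top (at_right 0)"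
    using \<delta>(1) by real_asymp
  then have "\<forall>\<^sub>F t in at_right 0. t powr (- \<delta>) > D e + 1" by (simp add: filterlim_at_top_dense)
  moreover have "\<forall>\<^sub>F t in at_right 0. (0::real) < t \<and> t < 1"
    using eventually_at_right_real[of 0 "1::real"] by simp
  ultimately have "\<forall>\<^sub>F t in at_right (0::real). False"
    using inU
  proof eventually_elim
    case (elim t)
    have t: "0 < t" "t < 1" using elim by auto
    have "\<phi> (c t) = \<phi> x + t *\<^sub>R e" using elim by (simp add: c_def f_inv_into_f)
    then have "f (c t) = t powr p (c t)" using elim e by (simp add: inner_left_distrib)
    moreover have "f (c 0) = 0" using feq eventually_nhds_x_imp_x c0 by fastforce
    ultimately have "(f (c t) - f (c 0)) / t = t powr (p (c t) - 1)" using t by (simp add: powr_diff)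
    also have "\<dots> \<ge> t powr (- \<delta>)" using t elim by (intro powr_mono') auto
    finally show False using elim by linarith
  qed
  then show False by (simp add: eventually_False)
qed

end

section \<open>Mutually inverse multiplicative maps\<close>

text \<open>That such a point exists is \<open>near_one_transfer\<close>. The definition precedes
  the locale, so that the inverse map is the same construction applied to \<open>S\<close>.\<close>

definition point_map :: "('a::topological_space \<Rightarrow> real) set \<Rightarrow> (('a \<Rightarrow> real) \<Rightarrow> ('a \<Rightarrow> real)) \<Rightarrow> 'a \<Rightarrow> 'a" where
  "point_map B T x = (SOME y. \<forall>g\<in>B. (\<forall>\<^sub>F z in nhds x. g z = 1) \<longrightarrow> (\<forall>\<^sub>F z in nhds y. T g z = 1))"

text \<open>The assumptions are symmetric in \<open>T\<close> and \<open>S\<close>, so that every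
  result can be reused with the roles exchanged; this is how statements about \<open>v\<close> and
  those about \<open>u\<close> yield each other. The last two isolate the step that is proved
  differently for the different function spaces.\<close>

locale multiplicative_pair = Ck_manifold k A
  for k :: enat and A :: "('a::{t2_space,second_countable_topology} set \<times> ('a \<Rightarrow> 'e::euclidean_space)) set" +
  fixes B :: "('a \<Rightarrow> real) set" and T S :: "('a \<Rightarrow> real) \<Rightarrow> ('a \<Rightarrow> real)"
  assumes B_c: "Ck_c_funs k A \<subseteq> B" and B_Ck: "B \<subseteq> Ck_funs k A"
    and T_B: "f \<in> B \<Longrightarrow> T f \<in> B" and S_B: "f \<in> B \<Longrightarrow> S f \<in> B"
    and ST: "f \<in> B \<Longrightarrow> S (T f) = f" and TS: "f \<in> B \<Longrightarrow> T (S f) = f"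
    and T_mult: "f \<in> B \<Longrightarrow> g \<in> B \<Longrightarrow> T (\<lambda>x. f x * g x) = (\<lambda>x. T f x * T g x)"
    and S_mult: "f \<in> B \<Longrightarrow> g \<in> B \<Longrightarrow> S (\<lambda>x. f x * g x) = (\<lambda>x. S f x * S g x)"
    and T_supports_meet: "\<exists>y. \<forall>g\<in>Ck_c_funs k A. (\<forall>\<^sub>F z in nhds x. g z = 1) \<longrightarrow> y \<in> closure {z. T g z \<noteq> 0}"
    and S_supports_meet: "\<exists>y. \<forall>g\<in>Ck_c_funs k A. (\<forall>\<^sub>F z in nhds x. g z = 1) \<longrightarrow> y \<in> closure {z. S g z \<noteq> 0}"
begin

section \<open>The homeomorphism determined by \<open>T\<close>\<close>

lemma dual: "multiplicative_pair k A B S T"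
  by unfold_locales (use B_c B_Ck T_B S_B ST TS T_mult S_mult T_supports_meet S_supports_meet in auto)

abbreviation "u \<equiv> point_map B T"
abbreviation "v \<equiv> point_map B S"

lemma B_Ck_at: "f \<in> B \<Longrightarrow> Ck_at f x"
  using B_Ck Ck_funs_iff by blast

lemma B_cont: "f \<in> B \<Longrightarrow> isCont f x"
  using B_Ck_at Ck_at_isCont by blast

lemma Bc: "f \<in> Ck_c_funs k A \<Longrightarrow> f \<in> B"
  using B_c by blast

text \<open>The relation \<open>a * b = a\<close> says that \<open>b\<close> is 1 where
  \<open>a\<close> is nonzero, and \<open>T\<close> preserves it. Two nested cut-offs are needed:
  the common point \<open>y\<close> is only in the closure of the set where \<open>T g''\<close> is
  nonzero, so continuity first gives \<open>T g' y = 1\<close>; then \<open>T g'\<close> is nonzero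
  near \<open>y\<close>, which forces \<open>T g = 1\<close> there.\<close>

lemma near_one_transfer:
  "\<exists>y. \<forall>g\<in>B. (\<forall>\<^sub>F z in nhds x. g z = 1) \<longrightarrow> (\<forall>\<^sub>F z in nhds y. T g z = 1)"
proof -
  obtain y where y: "\<And>g. g \<in> Ck_c_funs k A \<Longrightarrow> (\<forall>\<^sub>F z in nhds x. g z = 1) \<Longrightarrow> y \<in> closure {z. T g z \<noteq> 0}"
    using T_supports_meet[of x] by blast
  have "\<forall>\<^sub>F z in nhds y. T g z = 1" if g: "g \<in> B" "\<forall>\<^sub>F z in nhds x. g z = 1" for g
  proof -
    obtain W where W: "open W" "x \<in> W" "\<forall>z\<in>W. g z = 1" using g(2) by (auto simp: eventually_nhds)
    obtain g' where g': "g' \<in> Ck_c_funs k A" "\<forall>\<^sub>F z in nhds x. g' z = 1" "closure {z. g' z \<noteq> 0} \<subseteq> W"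
      by (rule exists_bump[OF W(1,2)])
    obtain W' where W': "open W'" "x \<in> W'" "\<forall>z\<in>W'. g' z = 1" using g'(2) by (auto simp: eventually_nhds)
    obtain g'' where g'': "g'' \<in> Ck_c_funs k A" "\<forall>\<^sub>F z in nhds x. g'' z = 1" "closure {z. g'' z \<noteq> 0} \<subseteq> W'"
      by (rule exists_bump[OF W'(1,2)])
    have absorb: "(\<lambda>z. a z * b z) = a" if "closure {z. a z \<noteq> 0} \<subseteq> V" "\<forall>z\<in>V. b z = 1" for a b :: "'a \<Rightarrow> real" and V
    proof
      fix z show "a z * b z = a z" using that closure_subset[of "{z. a z \<noteq> 0}"] by (cases "a z = 0") auto
    qed
    have 1: "T g' z * T g z = T g' z" for z
      using fun_cong[OF T_mult[OF Bc[OF g'(1)] g(1)], of z] by (simp add: absorb[OF g'(3) W(3)])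
    have 2: "T g'' z * T g' z = T g'' z" for z
      using fun_cong[OF T_mult[OF Bc[OF g''(1)] Bc[OF g'(1)]], of z] by (simp add: absorb[OF g''(3) W'(3)])
    have cont: "isCont (T g') z" for z using B_cont T_B Bc g'(1) by blast
    have "closed {z. T g' z = 1}"
      using cont by (intro closed_Collect_eq) (auto intro: continuous_at_imp_continuous_on)
    moreover have "{z. T g'' z \<noteq> 0} \<subseteq> {z. T g' z = 1}"
    proof
      fix z assume "z \<in> {z. T g'' z \<noteq> 0}"
      then show "z \<in> {z. T g' z = 1}" using 2[of z] by simp
    qed
    ultimately have "closure {z. T g'' z \<noteq> 0} \<subseteq> {z. T g' z = 1}" by (intro closure_minimal)
    then have "T g' y = 1" using y[OF g''(1,2)] by blast
    then have "\<forall>\<^sub>F z in nhds y. T g' z > 0"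
      using isCont_eventually_pos[OF cont] by simp
    then show ?thesis by eventually_elim (use 1 in force)
  qed
  then show ?thesis by blast
qed

lemma near_one: "g \<in> B \<Longrightarrow> \<forall>\<^sub>F z in nhds x. g z = 1 \<Longrightarrow> \<forall>\<^sub>F z in nhds (u x). T g z = 1"
  using someI_ex[OF near_one_transfer[of x]] unfolding point_map_def by blast

text \<open>Otherwise a bump \<open>b\<close> at \<open>x\<close> supported away from
  \<open>v (u x)\<close> would come back as \<open>S (T b) = b\<close> with the value 1 at
  \<open>v (u x)\<close>.\<close>

lemma v_u: "v (u x) = x"
proof (rule ccontr)
  interpret dual: multiplicative_pair k A B S T by (rule dual)
  assume "v (u x) \<noteq> x"
  then obtain W where W: "open W" "x \<in> W" "v (u x) \<notin> W" by (metis t1_space)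
  obtain b where b: "b \<in> Ck_c_funs k A" "\<forall>\<^sub>F z in nhds x. b z = 1" "closure {z. b z \<noteq> 0} \<subseteq> W"
    by (rule exists_bump[OF W(1,2)])
  have "\<forall>\<^sub>F z in nhds (v (u x)). S (T b) z = 1"
    using near_one[OF Bc[OF b(1)] b(2)] dual.near_one[OF T_B[OF Bc[OF b(1)]]] by blast
  then have "b (v (u x)) = 1" using ST[OF Bc[OF b(1)]] eventually_nhds_x_imp_x by fastforce
  then have "v (u x) \<in> {z. b z \<noteq> 0}" by simp
  then show False using b(3) W(3) closure_subset[of "{z. b z \<noteq> 0}"] by blast
qed

text \<open>Some \<open>h\<close> inverts \<open>f\<close> near \<open>x\<close>, so
  \<open>T h * T f\<close> is 1 at \<open>u x\<close>.\<close>

lemma nonzero: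
  assumes f: "f \<in> B" "f x \<noteq> 0"
  shows "T f (u x) \<noteq> 0"
proof -
  obtain h where h: "h \<in> Ck_c_funs k A" "\<forall>\<^sub>F y in nhds x. h y = inverse (f y)"
    by (rule Ck_at_extend[OF Ck_at_inverse[OF B_Ck_at[OF f(1)] f(2)]])
  have "(\<lambda>y. h y * f y) \<in> Ck_c_funs k A" using h(1) B_Ck_at[OF f(1)] by (intro Ck_c_funs_mult)
  moreover have "\<forall>\<^sub>F y in nhds x. f y \<noteq> 0"
    using isCont_eventually_nonzero[OF B_cont[OF f(1)]] f(2) by simp
  then have "\<forall>\<^sub>F y in nhds x. h y * f y = 1" using h(2) by eventually_elim auto
  ultimately have "\<forall>\<^sub>F y in nhds (u x). T (\<lambda>y. h y * f y) y = 1" using near_one Bc by blast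
  then have "T (\<lambda>y. h y * f y) (u x) = 1" by (rule eventually_nhds_x_imp_x)
  then show ?thesis using T_mult[OF Bc[OF h(1)] f(1)] by auto
qed

lemma nonzero_iff:
  assumes f: "f \<in> B"
  shows "T f (u x) = 0 \<longleftrightarrow> f x = 0"
proof -
  interpret dual: multiplicative_pair k A B S T by (rule dual)
  show ?thesis using nonzero[OF f, of x] dual.nonzero[OF T_B[OF f], of "u x"] ST[OF f] v_u by auto
qed

text \<open>For a bump \<open>b\<close> at \<open>u x\<close> inside \<open>W\<close>, the set where
  \<open>S b\<close> is nonzero is an open neighbourhood of \<open>x\<close> that \<open>u\<close>
  maps into the support of \<open>b\<close>.\<close>

lemma u_cont: "isCont u x"
  unfolding isCont_def tendsto_at_iff_tendsto_nhds
proof (rule topological_tendstoI)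
  interpret dual: multiplicative_pair k A B S T by (rule dual)
  fix W assume W: "open W" "u x \<in> W"
  obtain b where b: "b \<in> Ck_c_funs k A" "\<forall>\<^sub>F z in nhds (u x). b z = 1" "closure {z. b z \<noteq> 0} \<subseteq> W"
    by (rule exists_bump[OF W])
  have "b (u x) \<noteq> 0" using eventually_nhds_x_imp_x[OF b(2)] by simp
  then have "S b x \<noteq> 0" using dual.nonzero[OF Bc[OF b(1)], of "u x"] v_u by simp
  then have "\<forall>\<^sub>F y in nhds x. S b y \<noteq> 0"
    by (rule isCont_eventually_nonzero[OF B_cont[OF S_B[OF Bc[OF b(1)]]]])
  then show "\<forall>\<^sub>F y in nhds x. u y \<in> W"
  proof eventually_elim
    case (elim y)
    then have "b (u y) \<noteq> 0" using nonzero[OF S_B[OF Bc[OF b(1)]] elim] TS[OF Bc[OF b(1)]] by simp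
    then show ?case using b(3) closure_subset[of "{z. b z \<noteq> 0}"] by auto
  qed
qed

text \<open>Multiplication by a bump \<open>b\<close> makes \<open>f\<close> and \<open>g\<close>
  equal, and the factor \<open>T b (u x) = 1\<close> cancels.\<close>

lemma T_local:
  assumes f: "f \<in> B" "g \<in> B" "\<forall>\<^sub>F y in nhds x. f y = g y"
  shows "T f (u x) = T g (u x)"
proof -
  obtain W where W: "open W" "x \<in> W" "\<And>z. z \<in> W \<Longrightarrow> f z = g z" using f(3) by (auto simp: eventually_nhds)
  obtain b where b: "b \<in> Ck_c_funs k A" "\<forall>\<^sub>F z in nhds x. b z = 1" "closure {z. b z \<noteq> 0} \<subseteq> W"
    by (rule exists_bump[OF W(1,2)])
  have "(\<lambda>z. b z * f z) = (\<lambda>z. b z * g z)"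
  proof
    fix z show "b z * f z = b z * g z" using W(3) b(3) closure_subset[of "{z. b z \<noteq> 0}"] by (cases "b z = 0") auto
  qed
  then have "T b (u x) * T f (u x) = T b (u x) * T g (u x)"
    using T_mult[OF Bc[OF b(1)] f(1)] T_mult[OF Bc[OF b(1)] f(2)] by metis
  moreover have "T b (u x) = 1" using near_one[OF Bc[OF b(1)] b(2)] by (rule eventually_nhds_x_imp_x)
  ultimately show ?thesis by simp
qed

text \<open>The action of \<open>T\<close> on the germ of \<open>f\<close> at \<open>x\<close>, where \<open>f\<close> need not belong to \<open>B\<close>.\<close>
definition germ_map :: "('a \<Rightarrow> real) \<Rightarrow> 'a \<Rightarrow> real" where
  "germ_map f x = T (SOME g. g \<in> B \<and> (\<forall>\<^sub>F y in nhds x. g y = f y)) (u x)"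

lemma germ_map_eqI:
  assumes "g \<in> B" "\<forall>\<^sub>F y in nhds x. g y = f y"
  shows "germ_map f x = T g (u x)"
proof -
  have "(SOME g. g \<in> B \<and> (\<forall>\<^sub>F y in nhds x. g y = f y)) \<in> B \<and> (\<forall>\<^sub>F y in nhds x. (SOME g. g \<in> B \<and> (\<forall>\<^sub>F y in nhds x. g y = f y)) y = f y)"
    (is "?h \<in> B \<and> _") by (rule someI[of _ g]) (use assms in auto)
  then have h: "?h \<in> B" "\<forall>\<^sub>F y in nhds x. ?h y = f y" by auto
  have "\<forall>\<^sub>F y in nhds x. ?h y = g y" using h(2) assms(2) by eventually_elim auto
  from T_local[OF h(1) assms(1) this] show ?thesis by (simp add: germ_map_def)
qed

lemma germ_map_B: "f \<in> B \<Longrightarrow> germ_map f x = T f (u x)"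
  by (rule germ_map_eqI) auto

lemma germ_map_cong:
  assumes "Ck_at f x" "\<forall>\<^sub>F y in nhds x. f y = g y"
  shows "germ_map f x = germ_map g x"
proof -
  obtain h where h: "h \<in> Ck_c_funs k A" "\<forall>\<^sub>F y in nhds x. h y = f y" by (rule Ck_at_extend[OF assms(1)])
  have "\<forall>\<^sub>F y in nhds x. h y = g y" using h(2) assms(2) by eventually_elim auto
  then show ?thesis using h germ_map_eqI Bc by metis
qed

lemma germ_map_mult:
  assumes "Ck_at f x" "Ck_at g x"
  shows "germ_map (\<lambda>y. f y * g y) x = germ_map f x * germ_map g x"
proof -
  obtain f' where f': "f' \<in> Ck_c_funs k A" "\<forall>\<^sub>F y in nhds x. f' y = f y" by (rule Ck_at_extend[OF assms(1)])
  obtain g' where g': "g' \<in> Ck_c_funs k A" "\<forall>\<^sub>F y in nhds x. g' y = g y" by (rule Ck_at_extend[OF assms(2)])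
  have fg: "(\<lambda>y. f' y * g' y) \<in> B" using Ck_c_funs_mult[OF f'(1)] Ck_c_funs_D[OF g'(1)] Bc by blast
  have "\<forall>\<^sub>F y in nhds x. f' y * g' y = f y * g y" using f'(2) g'(2) by eventually_elim auto
  then show ?thesis
    using germ_map_eqI[OF Bc[OF f'(1)] f'(2)] germ_map_eqI[OF Bc[OF g'(1)] g'(2)] germ_map_eqI[OF fg]
      T_mult[OF Bc[OF f'(1)] Bc[OF g'(1)]] by metis
qed

lemma germ_map_1: "germ_map (\<lambda>y. 1) x = 1"
proof -
  obtain b where b: "b \<in> Ck_c_funs k A" "\<forall>\<^sub>F z in nhds x. b z = 1" by (rule exists_bump[of UNIV x]) auto
  then show ?thesis using germ_map_eqI[OF Bc[OF b(1)], where x=x and f="\<lambda>y. 1"] eventually_nhds_x_imp_x[OF near_one[OF Bc[OF b(1)] b(2)]] by simp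
qed

text \<open>One function \<open>h\<close> realises the germs of \<open>f\<close> at all points near
  \<open>x\<close>, so the germ map is there the continuous function \<open>T h\<close> composed
  with \<open>u\<close>.\<close>

lemma germ_map_isCont:
  assumes "Ck_at f x"
  shows "isCont (germ_map f) x"
proof -
  obtain h where h: "h \<in> Ck_c_funs k A" "\<forall>\<^sub>F y in nhds x. h y = f y" by (rule Ck_at_extend[OF assms(1)])
  have "\<forall>\<^sub>F y in nhds x. \<forall>\<^sub>F y in nhds y. h y = f y" using h(2) by (simp add: eventually_eventually)
  then have "\<forall>\<^sub>F y in nhds x. germ_map f y = T h (u y)"
    by eventually_elim (use germ_map_eqI Bc[OF h(1)] in blast)
  moreover have "isCont (\<lambda>y. T h (u y)) x"
    using isCont_o2[OF u_cont B_cont[OF T_B[OF Bc[OF h(1)]]]] .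
  ultimately show ?thesis using isCont_cong by fast
qed

section \<open>Logarithms of positive germs\<close>

definition log_map :: "('a \<Rightarrow> real) \<Rightarrow> 'a \<Rightarrow> real" where
  "log_map h x = ln (germ_map (\<lambda>y. exp (h y)) x)"

text \<open>The germ of \<open>exp h\<close> is the square of an invertible germ, so its image is a
  nonzero square.\<close>

lemma germ_map_exp_pos:
  assumes "Ck_at h x"
  shows "germ_map (\<lambda>y. exp (h y)) x > 0"
proof -
  have h2: "Ck_at (\<lambda>y. exp (1/2 * h y)) x" by (intro Ck_at_exp Ck_at_mult Ck_at_const assms)
  have h3: "Ck_at (\<lambda>y. exp (-1/2 * h y)) x" by (intro Ck_at_exp Ck_at_mult Ck_at_const assms)
  have "germ_map (\<lambda>y. exp (h y)) x = germ_map (\<lambda>y. exp (1/2 * h y)) x * germ_map (\<lambda>y. exp (1/2 * h y)) x"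
    unfolding germ_map_mult[OF h2 h2, symmetric] by (simp flip: exp_add)
  moreover have "germ_map (\<lambda>y. exp (1/2 * h y)) x * germ_map (\<lambda>y. exp (-1/2 * h y)) x = 1"
    unfolding germ_map_mult[OF h2 h3, symmetric] by (simp add: germ_map_1 flip: exp_add)
  ultimately show ?thesis by (metis mult_eq_0_iff not_real_square_gt_zero zero_neq_one)
qed

lemma germ_map_exp: "Ck_at h x \<Longrightarrow> germ_map (\<lambda>y. exp (h y)) x = exp (log_map h x)"
  by (simp add: log_map_def germ_map_exp_pos)

lemma log_map_add:
  assumes "Ck_at h x" "Ck_at h' x"
  shows "log_map (\<lambda>y. h y + h' y) x = log_map h x + log_map h' x"
  using assms germ_map_exp_pos[OF assms(1)] germ_map_exp_pos[OF assms(2)]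
  by (simp add: log_map_def exp_add germ_map_mult Ck_at_exp ln_mult)

lemma log_map_0: "log_map (\<lambda>y. 0) x = 0"
  by (simp add: log_map_def germ_map_1)

lemma log_map_minus:
  assumes "Ck_at h x"
  shows "log_map (\<lambda>y. - h y) x = - log_map h x"
proof -
  have "Ck_at (\<lambda>y. - h y) x" using Ck_at_mult[OF Ck_at_const[of "-1"] assms] by simp
  from log_map_add[OF assms this] show ?thesis by (simp add: log_map_0)
qed

lemma log_map_nat:
  assumes "Ck_at h x"
  shows "log_map (\<lambda>y. of_nat n * h y) x = of_nat n * log_map h x"
proof (induction n)
  case (Suc n)
  have "log_map (\<lambda>y. h y + of_nat n * h y) x = log_map h x + log_map (\<lambda>y. of_nat n * h y) x"
    by (intro log_map_add Ck_at_mult Ck_at_const assms)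
  then show ?case using Suc by (simp add: algebra_simps)
qed (simp add: log_map_0)

lemma log_map_int:
  assumes "Ck_at h x"
  shows "log_map (\<lambda>y. of_int m * h y) x = of_int m * log_map h x"
proof (cases "m \<ge> 0")
  case True
  then show ?thesis using log_map_nat[OF assms, of "nat m"] by simp
next
  case False
  have "Ck_at (\<lambda>y. of_nat (nat (- m)) * h y) x" by (intro Ck_at_mult Ck_at_const assms)
  from log_map_minus[OF this] show ?thesis using False log_map_nat[OF assms, of "nat (- m)"] by simp
qed

lemma log_map_isCont:
  assumes "Ck_at h x"
  shows "isCont (log_map h) x"
proof -
  have "isCont (\<lambda>y. ln (germ_map (\<lambda>y. exp (h y)) y)) x"
    using germ_map_isCont[OF Ck_at_exp[OF assms]] germ_map_exp_pos[OF assms] by (intro isCont_ln') auto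
  then show ?thesis by (simp add: log_map_def[abs_def])
qed

definition exponent :: "'a \<Rightarrow> real" where
  "exponent x = log_map (\<lambda>y. 1) x"

lemma exponent_isCont: "isCont exponent x"
  using log_map_isCont[OF Ck_at_const[of 1 x]] by (simp add: exponent_def[abs_def])

text \<open>A single \<open>F\<close> has to realise infinitely many exponents, so each gets its own
  point \<open>xs n\<close>; continuity at \<open>x\<close> of \<open>log_map h\<close>,
  \<open>exponent\<close> and \<open>T F\<close> composed with \<open>u\<close> then ties the values
  together. The opposite inequality comes from \<open>- h\<close>.\<close>

lemma log_map_le:
  assumes h: "Ck_at h x"
  shows "log_map h x \<le> h x * exponent x"
proof (rule ccontr)
  assume "\<not> log_map h x \<le> h x * exponent x"
  \<comment> \<open>Half of the assumed excess, so that a positive excess persists at the points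
    \<open>xs n\<close> for large \<open>n\<close>.\<close>
  define c where "c = (log_map h x - h x * exponent x) / 2"
  have c: "c > 0" "log_map h x - h x * exponent x > c" using \<open>\<not> _\<close> by (auto simp: c_def field_simps)
  define P where "P = \<bar>exponent x\<bar> + 1"
  obtain F xs and l :: "nat \<Rightarrow> int" where F: "F \<in> Ck_c_funs k A" "xs \<longlonglongrightarrow> x"
    "\<And>n. \<forall>\<^sub>F w in nhds (xs n). F w = exp ((real n + 1)\<^sup>2 * h w + of_int (l n))"
    "\<And>n. \<bar>(real n + 1)\<^sup>2 * h (xs n) + of_int (l n)\<bar> \<le> real n + 1"
    by (rule exists_spikes_manifold[OF h]) (rule that)
  have "isCont (\<lambda>y. log_map h y - h y * exponent y) x"
    by (intro continuous_intros log_map_isCont h exponent_isCont Ck_at_isCont)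
  then have "((\<lambda>n. log_map h (xs n) - h (xs n) * exponent (xs n)) \<longlongrightarrow> log_map h x - h x * exponent x) sequentially"
    by (rule isCont_tendsto_compose[OF _ F(2)])
  then have ev1: "\<forall>\<^sub>F n in sequentially. log_map h (xs n) - h (xs n) * exponent (xs n) > c"
    using c(2) by (rule order_tendstoD)
  have "((\<lambda>n. \<bar>exponent (xs n)\<bar>) \<longlongrightarrow> \<bar>exponent x\<bar>) sequentially"
    by (intro tendsto_rabs isCont_tendsto_compose[OF exponent_isCont F(2)])
  then have ev2: "\<forall>\<^sub>F n in sequentially. \<bar>exponent (xs n)\<bar> < P"
    by (rule order_tendstoD) (simp add: P_def)
  have ev3: "\<forall>\<^sub>F n in sequentially. Ck_at h (xs n)"
    using F(2) Ck_at_eventually[OF h] by (rule eventually_compose_filterlim[rotated])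
  have "isCont (\<lambda>y. T F (u y)) x" using isCont_o2[OF u_cont B_cont[OF T_B[OF Bc[OF F(1)]]]] .
  then have "(\<lambda>n. T F (u (xs n))) \<longlonglongrightarrow> T F (u x)" by (rule isCont_tendsto_compose[OF _ F(2)])
  then have ev4: "\<forall>\<^sub>F n in sequentially. T F (u (xs n)) < T F (u x) + 1"
    by (rule order_tendstoD) simp
  have "filterlim (\<lambda>n. (real n + 1)\<^sup>2 * c - (real n + 1) * P) at_top sequentially"
    using c(1) by real_asymp
  then have ev5: "\<forall>\<^sub>F n in sequentially. (real n + 1)\<^sup>2 * c - (real n + 1) * P > T F (u x) + 1"
    by (simp add: filterlim_at_top_dense)
  have "\<forall>\<^sub>F n in sequentially. False"
    using ev1 ev2 ev3 ev4 ev5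
  proof eventually_elim
    case (elim n)
    define N where "N = real n + 1"
    let ?y = "xs n"
    let ?a = "N\<^sup>2 * h ?y + of_int (l n)"
    \<comment> \<open>Additivity allows integer factors only: the square is written as an integer
      and the shift as an integer multiple of the constant 1, which brings in
      \<open>exponent\<close>.\<close>
    have C1: "Ck_at (\<lambda>y. of_int ((int n + 1)\<^sup>2) * h y) ?y" and C2: "Ck_at (\<lambda>y. of_int (l n) * 1) ?y"
      by (intro Ck_at_mult Ck_at_const elim)+
    have "log_map (\<lambda>y. N\<^sup>2 * h y + of_int (l n)) ?y = N\<^sup>2 * log_map h ?y + of_int (l n) * exponent ?y"
      using log_map_add[OF C1 C2] log_map_int[OF elim(3), of "(int n + 1)\<^sup>2"] log_map_int[OF Ck_at_const[of 1], of "l n" ?y]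
      by (simp add: N_def exponent_def)
    \<comment> \<open>Regrouping: the excess over \<open>h * exponent\<close> carries the factor
      \<open>N\<^sup>2\<close>, while the whole exponent \<open>?a\<close> is at most
      \<open>N\<close> in absolute value.\<close>
    also have "\<dots> = N\<^sup>2 * (log_map h ?y - h ?y * exponent ?y) + ?a * exponent ?y"
      by (simp add: algebra_simps)
    also have "\<dots> \<ge> N\<^sup>2 * c - N * P"
    proof -
      have "\<bar>?a * exponent ?y\<bar> \<le> N * P"
        unfolding abs_mult using F(4)[of n] elim(2) by (intro mult_mono) (auto simp: N_def)
      moreover have "N\<^sup>2 * c \<le> N\<^sup>2 * (log_map h ?y - h ?y * exponent ?y)" using elim(1) by (intro mult_left_mono) auto
      ultimately show ?thesis by linarith
    qed
    finally have ge: "N\<^sup>2 * c - N * P \<le> log_map (\<lambda>y. N\<^sup>2 * h y + of_int (l n)) ?y" .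
    have "T F (u ?y) = germ_map (\<lambda>y. exp (N\<^sup>2 * h y + of_int (l n))) ?y"
      using germ_map_eqI[OF Bc[OF F(1)] F(3)] by (simp add: N_def)
    also have "\<dots> = exp (log_map (\<lambda>y. N\<^sup>2 * h y + of_int (l n)) ?y)"
      by (intro germ_map_exp Ck_at_add Ck_at_mult Ck_at_const elim)
    also have "\<dots> \<ge> 1 + log_map (\<lambda>y. N\<^sup>2 * h y + of_int (l n)) ?y" by (rule exp_ge_add_one_self)
    finally show False using ge elim(4,5) by (simp add: N_def)
  qed
  then show False by simp
qed

lemma log_map_eq:
  assumes h: "Ck_at h x"
  shows "log_map h x = h x * exponent x"
proof -
  have "Ck_at (\<lambda>y. - h y) x" using Ck_at_mult[OF Ck_at_const[of "-1"] h] by simp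
  from log_map_le[OF this] log_map_le[OF h] log_map_minus[OF h] show ?thesis by simp
qed

section \<open>The formula with a variable exponent\<close>

lemma germ_map_pos:
  assumes f: "Ck_at f x" "f x > 0"
  shows "germ_map f x = f x powr exponent x"
proof -
  have ln: "Ck_at (\<lambda>y. ln (f y)) x" using f by (rule Ck_at_ln)
  have "\<forall>\<^sub>F y in nhds x. f y > 0"
    using isCont_eventually_pos[OF Ck_at_isCont[OF f(1)]] f(2) by simp
  then have "\<forall>\<^sub>F y in nhds x. f y = exp (ln (f y))" by eventually_elim simp
  from germ_map_cong[OF f(1) this] show ?thesis
    using germ_map_exp[OF ln] log_map_eq[OF ln] f(2) by (simp add: powr_def mult.commute)
qed

lemma bump_multiple:
  obtains f where "f \<in> B" "f x = c"
proof -
  obtain f where "f \<in> Ck_c_funs k A" "\<forall>\<^sub>F y in nhds x. f y = c" by (rule Ck_at_extend[OF Ck_at_const])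
  then show ?thesis using that Bc eventually_nhds_x_imp_x by blast
qed

lemma T_value_surj:
  obtains f where "f \<in> B" "T f (u x) = c"
proof -
  obtain g where "g \<in> B" "g (u x) = c" by (rule bump_multiple)
  then show ?thesis using that[of "S g"] S_B TS by simp
qed

text \<open>The germ of -1 goes to a square root of 1. The root 1 is excluded because
  \<open>T\<close> would then take no negative value at \<open>u x\<close>, against
  surjectivity.\<close>

lemma T_formula:
  assumes f: "f \<in> B"
  shows "T f (u x) = sgn (f x) * \<bar>f x\<bar> powr exponent x"
proof -
  define s where "s = germ_map (\<lambda>y. - 1) x"
  have "s * s = 1" using germ_map_mult[OF Ck_at_const[of "-1" x] Ck_at_const[of "-1" x]] germ_map_1 by (simp add: s_def)
  then have s: "s = 1 \<or> s = -1" by algebra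
  have neg: "T g (u x) = s * \<bar>g x\<bar> powr exponent x" if g: "g \<in> B" "g x < 0" for g
  proof -
    have C: "Ck_at (\<lambda>y. - 1 * g y) x" by (intro Ck_at_mult Ck_at_const B_Ck_at g)
    have "T g (u x) = germ_map (\<lambda>y. - 1 * (- 1 * g y)) x" using germ_map_B[OF g(1)] by simp
    also have "\<dots> = s * germ_map (\<lambda>y. - 1 * g y) x" unfolding s_def by (rule germ_map_mult[OF Ck_at_const C])
    finally show ?thesis using germ_map_pos[OF C] g(2) by simp
  qed
  have pos: "T g (u x) = \<bar>g x\<bar> powr exponent x" if g: "g \<in> B" "g x > 0" for g
    using germ_map_pos[OF B_Ck_at[OF g(1)] g(2)] germ_map_B[OF g(1)] g(2) by simp
  have "s \<noteq> 1"
  proof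
    assume "s = 1"
    obtain g where g: "g \<in> B" "T g (u x) = - 1" by (rule T_value_surj)
    have "T g (u x) \<ge> 0" using pos[OF g(1)] neg[OF g(1)] nonzero_iff[OF g(1), of x] \<open>s = 1\<close>
      by (cases "g x" "0::real" rule: linorder_cases) auto
    then show False using g by simp
  qed
  then have "s = -1" using s by simp
  then show ?thesis using pos[OF f] neg[OF f] nonzero_iff[OF f, of x]
    by (cases "f x" "0::real" rule: linorder_cases) auto
qed

text \<open>With exponent 0 the values of \<open>T\<close> at \<open>u x\<close> would be restricted
  to -1, 0 and 1.\<close>

lemma exponent_nonzero: "exponent x \<noteq> 0"
proof
  assume "exponent x = 0"
  obtain g where g: "g \<in> B" "T g (u x) = 2" by (rule T_value_surj)
  then show False using T_formula[OF g(1), of x] \<open>exponent x = 0\<close> by (auto simp: sgn_if split: if_splits)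
qed

section \<open>Regularity of \<open>u\<close> and the value of the exponent\<close>

lemma u_v: "u (v y) = y"
proof -
  interpret dual: multiplicative_pair k A B S T by (rule dual)
  show ?thesis by (rule dual.v_u)
qed

lemma v_cont: "isCont v y"
proof -
  interpret dual: multiplicative_pair k A B S T by (rule dual)
  show ?thesis by (rule dual.u_cont)
qed

text \<open>Near \<open>y\<close> the function is \<open>ln (T f)\<close> for an \<open>f\<close>
  that equals \<open>exp 1\<close> near \<open>v y\<close>. Regularity is obtained on the target
  side, along \<open>v\<close>, because \<open>T f\<close> is regular there, while \<open>u\<close>
  is so far only known to be a homeomorphism.\<close>

lemma Ck_at_exponent_v: "Ck_at (\<lambda>y. exponent (v y)) y"
proof -
  obtain f where f: "f \<in> Ck_c_funs k A" "\<forall>\<^sub>F z in nhds (v y). f z = exp 1" by (rule Ck_at_extend[OF Ck_at_const])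
  have eq: "T f z = exp (exponent (v z))" if "f (v z) = exp 1" for z
    using T_formula[OF Bc[OF f(1)], of "v z"] that u_v by (simp add: powr_def)
  have "\<forall>\<^sub>F z in nhds y. f (v z) = exp 1" using isCont_eventually_nhds[OF v_cont] f(2) .
  then have "\<forall>\<^sub>F z in nhds y. ln (T f z) = exponent (v z)" by eventually_elim (simp add: eq)
  moreover have "Ck_at (\<lambda>z. ln (T f z)) y"
    using eq[of y] eventually_nhds_x_imp_x[OF f(2)] by (intro Ck_at_ln B_Ck_at T_B Bc f) auto
  ultimately show ?thesis by (rule Ck_at_cong)
qed

text \<open>Solves \<open>T g z = g (v z) powr exponent (v z)\<close> for \<open>g (v z)\<close>,
  which works as the exponent is regular along \<open>v\<close> and never zero.\<close>

lemma Ck_at_compose_v: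
  assumes f: "Ck_at f (v y)"
  shows "Ck_at (\<lambda>z. f (v z)) y"
proof -
  \<comment> \<open>The shift makes the function positive at \<open>v y\<close>, so that logarithms
    can be taken; it is subtracted at the end.\<close>
  define c where "c = \<bar>f (v y)\<bar> + 1"
  obtain g where g: "g \<in> Ck_c_funs k A" "\<forall>\<^sub>F z in nhds (v y). g z = f z + c"
    by (rule Ck_at_extend[OF Ck_at_add[OF f Ck_at_const]])
  have gp: "g (v y) > 0" using eventually_nhds_x_imp_x[OF g(2)] by (auto simp: c_def)
  have eq: "T g z = exp (exponent (v z) * ln (g (v z)))" if "g (v z) > 0" for z
    using T_formula[OF Bc[OF g(1)], of "v z"] that u_v by (simp add: powr_def)
  have ev: "\<forall>\<^sub>F z in nhds y. g (v z) > 0"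
    using isCont_eventually_pos[OF isCont_o2[OF v_cont Ck_at_isCont[OF Ck_c_funs_D[OF g(1)]]]] gp by simp
  have cancel: "exponent w * t * inverse (exponent w) = t" for w t
    using exponent_nonzero[of w] by (simp add: field_simps)
  have "\<forall>\<^sub>F z in nhds y. exp (ln (T g z) * inverse (exponent (v z))) + (- c) = f (v z)"
    using ev isCont_eventually_nhds[OF v_cont g(2)]
    by eventually_elim (simp add: eq cancel)
  moreover have "Ck_at (\<lambda>z. exp (ln (T g z) * inverse (exponent (v z))) + (- c)) y"
    using eq[OF gp] exponent_nonzero
    by (intro Ck_at_add Ck_at_exp Ck_at_mult Ck_at_ln Ck_at_inverse Ck_at_const Ck_at_exponent_v B_Ck_at T_B Bc g) auto
  ultimately show ?thesis by (rule Ck_at_cong)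
qed

lemma Ck_at_compose_u:
  assumes f: "Ck_at f (u x)"
  shows "Ck_at (\<lambda>z. f (u z)) x"
proof -
  interpret dual: multiplicative_pair k A B S T by (rule dual)
  show ?thesis using assms by (rule dual.Ck_at_compose_v)
qed

text \<open>A coordinate function centred at \<open>x\<close> provides the simple zero. The
  regularity of \<open>u\<close> has to come first, since it is \<open>T g\<close> composed with
  \<open>u\<close> whose differentiability is used.\<close>

lemma exponent_ge: "exponent x \<ge> 1"
proof -
  obtain U \<phi> where c: "(U, \<phi>) \<in> A" "x \<in> U" by (rule chart_at)
  obtain e :: 'e where e: "e \<in> Basis" using nonempty_Basis by blast
  have "Ck_at (\<lambda>y. \<phi> y \<bullet> e + - (\<phi> x \<bullet> e)) x" by (intro Ck_at_add Ck_at_coordinate[OF c] Ck_at_const)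
  then obtain g where g: "g \<in> Ck_c_funs k A" "\<forall>\<^sub>F y in nhds x. g y = \<phi> y \<bullet> e + - (\<phi> x \<bullet> e)"
    by (rule Ck_at_extend)
  have "Ck_at (\<lambda>y. T g (u y)) x" by (intro Ck_at_compose_u B_Ck_at T_B Bc g)
  moreover have "\<forall>\<^sub>F y in nhds x. T g (u y) = sgn ((\<phi> y - \<phi> x) \<bullet> e) * \<bar>(\<phi> y - \<phi> x) \<bullet> e\<bar> powr exponent y"
    using g(2) by eventually_elim (simp add: T_formula[OF Bc[OF g(1)]] inner_diff_left)
  ultimately show ?thesis by (rule exponent_ge_1[OF c e exponent_isCont])
qed

lemma exponent_eq_1: "exponent x = 1"
proof -
  interpret dual: multiplicative_pair k A B S T by (rule dual)
  obtain f where f: "f \<in> B" "f x = exp 1" by (rule bump_multiple)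
  have "T f (u x) = exp (exponent x)" using T_formula[OF f(1), of x] f(2) by (simp add: powr_def)
  \<comment> \<open>Applying \<open>S\<close> after \<open>T\<close> multiplies the
    exponents.\<close>
  then have "exp 1 = exp (exponent x * dual.exponent (u x))"
    using dual.T_formula[OF T_B[OF f(1)], of "u x"] ST[OF f(1)] f(2) v_u by (simp add: powr_def mult.commute)
  then have "exponent x * dual.exponent (u x) = 1" by simp
  then show ?thesis
    using exponent_ge[of x] dual.exponent_ge[of "u x"] mult_left_mono[of 1 "dual.exponent (u x)" "exponent x"]
    by simp
qed

lemma T_eq: "f \<in> B \<Longrightarrow> T f (u x) = f x"
  using T_formula[of f x] exponent_eq_1 by (auto simp: sgn_if)

lemma bij_u: "bij u" and inv_u: "inv u = v"
proof -
  show "bij u" using v_u u_v by (rule o_bij[OF ext ext, unfolded o_def id_def])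
  show "inv u = v" using v_u u_v by (intro inv_equality)
qed

lemma Ck_diffeo_u: "Ck_diffeo k A u"
proof -
  have "Ck_map k A u"
    by (rule Ck_mapI) (use u_cont Ck_at_compose_u Ck_c_funs_D in \<open>auto simp: continuous_at_imp_continuous_on\<close>)
  moreover have "Ck_map k A v"
    by (rule Ck_mapI) (use v_cont Ck_at_compose_v Ck_c_funs_D in \<open>auto simp: continuous_at_imp_continuous_on\<close>)
  ultimately show ?thesis by (simp add: Ck_diffeo_def bij_u inv_u)
qed

lemma induced:
  assumes lin: "\<And>f g a b. f \<in> B \<Longrightarrow> g \<in> B \<Longrightarrow> (\<lambda>x. a * f x + b * g x) \<in> B"
  shows "induced_by_diffeo k A B T"
proof -
  have "T (\<lambda>x. a * f x + b * g x) = (\<lambda>x. a * T f x + b * T g x)" if "f \<in> B" "g \<in> B" for f g and a b :: real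
  proof
    fix y
    show "T (\<lambda>x. a * f x + b * g x) y = a * T f y + b * T g y"
      using T_eq[OF lin[OF that], of a b "v y"] T_eq[OF that(1), of "v y"] T_eq[OF that(2), of "v y"] u_v by simp
  qed
  then show ?thesis unfolding induced_by_diffeo_def using Ck_diffeo_u T_eq by blast
qed

end

section \<open>The three function spaces\<close>

lemma mult_bij_inverse:
  assumes T: "mult_bij B T" and prod: "\<forall>f\<in>B. \<forall>g\<in>B. (\<lambda>x. f x * g x) \<in> B"
  defines "S \<equiv> inv_into B T"
  shows "\<And>f. f \<in> B \<Longrightarrow> T f \<in> B" "\<And>f. f \<in> B \<Longrightarrow> S f \<in> B"
    "\<And>f. f \<in> B \<Longrightarrow> S (T f) = f" "\<And>f. f \<in> B \<Longrightarrow> T (S f) = f"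
    "\<And>f g. f \<in> B \<Longrightarrow> g \<in> B \<Longrightarrow> T (\<lambda>x. f x * g x) = (\<lambda>x. T f x * T g x)"
    "\<And>f g. f \<in> B \<Longrightarrow> g \<in> B \<Longrightarrow> S (\<lambda>x. f x * g x) = (\<lambda>x. S f x * S g x)"
    "mult_bij B S"
proof -
  have bij: "bij_betw T B B" using T by (simp add: mult_bij_def)
  show TB: "T f \<in> B" if "f \<in> B" for f using bij that by (rule bij_betw_apply)
  show SB: "S f \<in> B" if "f \<in> B" for f unfolding S_def using bij_betw_inv_into[OF bij] that by (rule bij_betw_apply)
  show ST: "S (T f) = f" if "f \<in> B" for f unfolding S_def using bij that by (rule bij_betw_inv_into_left)
  show TS: "T (S f) = f" if "f \<in> B" for f unfolding S_def using bij that by (rule bij_betw_inv_into_right)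
  show TM: "T (\<lambda>x. f x * g x) = (\<lambda>x. T f x * T g x)" if "f \<in> B" "g \<in> B" for f g
    using T that by (simp add: mult_bij_def)
  show SM: "S (\<lambda>x. f x * g x) = (\<lambda>x. S f x * S g x)" if "f \<in> B" "g \<in> B" for f g
    using TM[OF SB[OF that(1)] SB[OF that(2)]] ST[OF prod[rule_format, OF SB[OF that(1)] SB[OF that(2)]]] TS that by simp
  show "mult_bij B S" using bij_betw_inv_into[OF bij] SM by (simp add: mult_bij_def S_def)
qed

text \<open>By surjectivity some \<open>T f\<close> is zero, and \<open>T 0 = T (0 * f)\<close> has
  \<open>T f\<close> as a factor.\<close>

lemma mult_bij_0:
  assumes T: "mult_bij B T" and 0: "(\<lambda>x. 0) \<in> B"
  shows "T (\<lambda>x. 0) = (\<lambda>x. 0)"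
proof -
  have "(\<lambda>x. 0) \<in> T ` B" using T 0 by (simp add: mult_bij_def bij_betw_def)
  then obtain f where f: "f \<in> B" "T f = (\<lambda>x. 0)" by (rule imageE) simp
  have "\<forall>f\<in>B. \<forall>g\<in>B. T (\<lambda>x. f x * g x) = (\<lambda>x. T f x * T g x)" using T unfolding mult_bij_def by (rule conjunct2)
  from this[rule_format, OF 0 f(1)] show ?thesis unfolding f(2) mult_zero_left mult_zero_right .
qed

lemma mult_bij_nonzero:
  assumes T: "mult_bij B T" and 0: "(\<lambda>x. 0) \<in> B" and f: "f \<in> B" "f \<noteq> (\<lambda>x. 0)"
  obtains z where "T f z \<noteq> 0"
proof -
  have "T f \<noteq> T (\<lambda>x. 0)" using T 0 f by (auto simp: mult_bij_def bij_betw_def inj_on_eq_iff)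
  then show ?thesis using that mult_bij_0[OF T 0] by auto
qed

context Ck_manifold
begin

section \<open>Common points of the supports\<close>

lemma zero_Ck_c: "(\<lambda>x. 0) \<in> Ck_c_funs k A"
  by (simp add: Ck_c_funs_iff Ck_at_const)

text \<open>Finite intersection property in the compact support of one \<open>T b\<close>. A product
  of finitely many functions that are 1 near \<open>x\<close> is again such a function, hence
  nonzero; by injectivity its image is nonzero somewhere, and that point lies in all the
  supports.\<close>

lemma supports_meet_compact:
  assumes T: "mult_bij B T" and B: "Ck_c_funs k A \<subseteq> B"
    and cpt: "\<And>g. g \<in> Ck_c_funs k A \<Longrightarrow> compact (closure {z. T g z \<noteq> 0})"
  shows "\<exists>y. \<forall>g\<in>Ck_c_funs k A. (\<forall>\<^sub>F z in nhds x. g z = 1) \<longrightarrow> y \<in> closure {z. T g z \<noteq> 0}"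
proof -
  define N where "N = {g \<in> Ck_c_funs k A. \<forall>\<^sub>F z in nhds x. g z = 1}"
  define supp where "supp g = closure {z. T g z \<noteq> 0}" for g
  obtain b where b: "b \<in> N" using exists_bump[of UNIV x] by (auto simp: N_def)
  have N_mult: "(\<lambda>z. f z * g z) \<in> N" if "f \<in> N" "g \<in> N" for f g
  proof -
    have "\<forall>\<^sub>F z in nhds x. f z * g z = 1"
      using that unfolding N_def by (auto elim: eventually_elim2)
    then show ?thesis using that Ck_c_funs_mult Ck_c_funs_D by (auto simp: N_def)
  qed
  have T_mult: "T (\<lambda>z. f z * g z) z = T f z * T g z" if "f \<in> N" "g \<in> N" for f g z
    using T that B unfolding mult_bij_def N_def by (auto simp: subset_iff)
  \<comment> \<open>\<open>b\<close> is inserted so that the point found also lies in the compact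
    set \<open>supp b\<close>.\<close>
  have below: "\<exists>h\<in>N. \<forall>g\<in>insert b G. {z. T h z \<noteq> 0} \<subseteq> {z. T g z \<noteq> 0}" if "finite G" "G \<subseteq> N" for G
    using that
  proof (induction G)
    case empty
    then show ?case using b by auto
  next
    case (insert g G)
    then obtain h where h: "h \<in> N" "\<forall>g\<in>insert b G. {z. T h z \<noteq> 0} \<subseteq> {z. T g z \<noteq> 0}" by auto
    have g: "g \<in> N" using insert by auto
    show ?case
      by (rule bexI[OF _ N_mult[OF h(1) g]]) (use h T_mult[OF h(1) g] in auto)
  qed
  have "supp b \<inter> \<Inter> (supp ` N) \<noteq> {}"
  proof (rule compact_imp_fip)
    show "compact (supp b)" using cpt b by (auto simp: supp_def N_def)
    show "closed C" if "C \<in> supp ` N" for C using that by (auto simp: supp_def)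
    fix F' assume "finite F'" "F' \<subseteq> supp ` N"
    then obtain G where G: "G \<subseteq> N" "finite G" "F' = supp ` G" by (meson finite_subset_image)
    obtain h where h: "h \<in> N" "\<forall>g\<in>insert b G. {z. T h z \<noteq> 0} \<subseteq> {z. T g z \<noteq> 0}" using below[OF G(2,1)] by blast
    have "h x = 1" using h(1) eventually_nhds_x_imp_x by (fastforce simp: N_def)
    then have "h \<noteq> (\<lambda>x. 0)" by auto
    moreover have "h \<in> B" "(\<lambda>x. 0) \<in> B" using h(1) B zero_Ck_c by (auto simp: N_def)
    ultimately obtain z where z: "T h z \<noteq> 0" using mult_bij_nonzero[OF T] by blast
    have "z \<in> supp g" if "g \<in> insert b G" for g
      using h(2) that z closure_subset[of "{z. T g z \<noteq> 0}"] unfolding supp_def by blast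
    then show "supp b \<inter> \<Inter> F' \<noteq> {}" using G(3) by auto
  qed
  then obtain y where "y \<in> \<Inter> (supp ` N)" by blast
  then show ?thesis by (intro exI[of _ y]) (auto simp: supp_def N_def)
qed

text \<open>One step of the sequence used next. Beside a smaller \<open>g'\<close> at
  \<open>x\<close>, a bump \<open>c\<close> with \<open>d\<close> inside it is placed at a nearby
  point \<open>p\<close>, away from the support of \<open>g'\<close>; this needs a point other than
  \<open>x\<close>. Inclusion and disjointness are stated as product identities, the form that
  survives \<open>T\<close>.\<close>

lemma exists_shrinking_step:
  assumes g: "g \<in> Ck_c_funs k A" "\<forall>\<^sub>F z in nhds x. g z = 1" and W: "open W" "x \<in> W"
  obtains g' c d p where
    "g' \<in> Ck_c_funs k A" "\<forall>\<^sub>F z in nhds x. g' z = 1" "closure {z. g' z \<noteq> 0} \<subseteq> W" "\<And>z. g' z * g z = g' z"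
    "c \<in> Ck_c_funs k A" "\<And>z. c z * g z = c z" "\<And>z. c z * g' z = 0"
    "d \<in> Ck_c_funs k A" "\<And>z. d z * c z = d z" "p \<in> W" "d p = 1"
proof -
  obtain V where V: "open V" "x \<in> V" "\<And>z. z \<in> V \<Longrightarrow> g z = 1" using g(2) by (auto simp: eventually_nhds)
  have VW: "open (V \<inter> W)" "x \<in> V \<inter> W" using V W by auto
  obtain p where p: "p \<in> V \<inter> W" "p \<noteq> x" by (rule exists_other_point[OF VW])
  have "open (V \<inter> W - {p})" "x \<in> V \<inter> W - {p}" using VW p by auto
  then obtain g' where g': "g' \<in> Ck_c_funs k A" "\<forall>\<^sub>F z in nhds x. g' z = 1" "closure {z. g' z \<noteq> 0} \<subseteq> V \<inter> W - {p}"
    by (rule exists_bump)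
  have sub: "a z = 0 \<or> z \<in> O'" if "closure {z. a z \<noteq> 0} \<subseteq> O'" for a :: "'a \<Rightarrow> real" and z O'
    using that closure_subset[of "{z. a z \<noteq> 0}"] by auto
  have "open (V \<inter> W - closure {z. g' z \<noteq> 0})" "p \<in> V \<inter> W - closure {z. g' z \<noteq> 0}" using VW p g'(3) by auto
  then obtain c where c: "c \<in> Ck_c_funs k A" "\<forall>\<^sub>F z in nhds p. c z = 1" "closure {z. c z \<noteq> 0} \<subseteq> V \<inter> W - closure {z. g' z \<noteq> 0}"
    by (rule exists_bump)
  obtain V' where V': "open V'" "p \<in> V'" "\<And>z. z \<in> V' \<Longrightarrow> c z = 1" using c(2) by (auto simp: eventually_nhds)
  obtain d where d: "d \<in> Ck_c_funs k A" "\<forall>\<^sub>F z in nhds p. d z = 1" "closure {z. d z \<noteq> 0} \<subseteq> V'"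
    by (rule exists_bump[OF V'(1,2)])
  have "g' z * g z = g' z" for z using sub[OF g'(3), of z] V(3)[of z] by auto
  moreover have "c z * g z = c z" for z using sub[OF c(3), of z] V(3)[of z] by auto
  moreover have "c z * g' z = 0" for z using sub[OF c(3), of z] closure_subset[of "{z. g' z \<noteq> 0}"] by auto
  moreover have "d z * c z = d z" for z using sub[OF d(3), of z] V'(3)[of z] by auto
  moreover have "d p = 1" using d(2) by (rule eventually_nhds_x_imp_x)
  moreover have "closure {z. g' z \<noteq> 0} \<subseteq> W" using g'(3) by auto
  ultimately show ?thesis using that g' c d p by blast
qed

text \<open>If the supports of the \<open>T (g n)\<close> had no common point, they would be locally finite, and one function
  \<open>H\<close> could be \<open>1\<close> on the supports of the \<open>T (d n)\<close> for even \<open>n\<close> and \<open>0\<close> for odd \<open>n\<close>. Its preimage under \<open>T\<close> does 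
  the same for the \<open>d n\<close>, whose supports converge to \<open>x\<close>, and so it is discontinuous at \<open>x\<close>.\<close>
lemma supports_meet_Ck:
  assumes T: "mult_bij (Ck_funs k A) T"
  shows "\<exists>y. \<forall>g\<in>Ck_c_funs k A. (\<forall>\<^sub>F z in nhds x. g z = 1) \<longrightarrow> y \<in> closure {z. T g z \<noteq> 0}"
proof (rule ccontr)
  assume neg: "\<not> ?thesis"
  define B where "B = Ck_funs k A"
  have B: "f \<in> B \<longleftrightarrow> (\<forall>x. Ck_at f x)" for f by (simp add: B_def Ck_funs_iff)
  have Bc: "f \<in> B" if "f \<in> Ck_c_funs k A" for f using that by (simp add: B_def Ck_c_funs_def)
  have prod: "\<forall>f\<in>B. \<forall>g\<in>B. (\<lambda>x. f x * g x) \<in> B" by (auto simp: B intro: Ck_at_mult)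
  define S where "S = inv_into B T"
  note TS = mult_bij_inverse[OF T[folded B_def] prod, folded S_def]
  have T_B: "T f \<in> B" if "f \<in> B" for f using TS(1) that by blast
  have S_B: "S f \<in> B" if "f \<in> B" for f using TS(2) that by blast
  have ST: "S (T f) = f" if "f \<in> B" for f using TS(3) that by blast
  have Tm: "T (\<lambda>x. f x * g x) = (\<lambda>x. T f x * T g x)" if "f \<in> B" "g \<in> B" for f g using TS(5) that by blast
  have Sm: "S (\<lambda>x. f x * g x) = (\<lambda>x. S f x * S g x)" if "f \<in> B" "g \<in> B" for f g using TS(6) that by blast
  have Tmz: "T h z = T f z * T g z" if "f \<in> B" "g \<in> B" "\<And>z. f z * g z = h z" for f g h z
    using fun_cong[OF Tm[OF that(1,2)], of z] that(3) by simp
  have zero_B: "(\<lambda>x. 0) \<in> B" using zero_Ck_c Bc by blast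
  have T0: "T (\<lambda>x. 0) = (\<lambda>x. 0)" using mult_bij_0[OF T[folded B_def] zero_B] .
  have S0: "S (\<lambda>x. 0) = (\<lambda>x. 0)" using ST[OF zero_B] T0 by simp
  \<comment> \<open>Second countability enters here, through first countability: a countable
    neighbourhood base makes the points \<open>p n\<close> converge to \<open>x\<close>.\<close>
  obtain W :: "nat \<Rightarrow> 'a set" where W: "\<And>n. open (W n)" "\<And>n. x \<in> W n"
      "\<And>V. open V \<Longrightarrow> x \<in> V \<Longrightarrow> \<forall>\<^sub>F n in sequentially. W n \<subseteq> V"
    by (rule countable_basis_at_decseq[of x]) blast
  define N where "N = {g \<in> Ck_c_funs k A. \<forall>\<^sub>F z in nhds x. g z = 1}"
  define step where "step n g g' c d p \<longleftrightarrow> closure {z. g' z \<noteq> 0} \<subseteq> W n \<and> (\<forall>z. g' z * g z = g' z) \<and>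
    c \<in> Ck_c_funs k A \<and> (\<forall>z. c z * g z = c z) \<and> (\<forall>z. c z * g' z = 0) \<and>
    d \<in> Ck_c_funs k A \<and> (\<forall>z. d z * c z = d z) \<and> p \<in> W n \<and> d p = 1" for n and g g' c d :: "'a \<Rightarrow> real" and p
  have "\<exists>g. \<forall>n. g n \<in> N \<and> (\<exists>c d p. step n (g n) (g (Suc n)) c d p)"
  proof (rule dependent_nat_choice)
    show "\<exists>g. g \<in> N" using exists_bump[of UNIV x] by (auto simp: N_def)
    fix g n assume "g \<in> N"
    then have "g \<in> Ck_c_funs k A" "\<forall>\<^sub>F z in nhds x. g z = 1" by (auto simp: N_def)
    from exists_shrinking_step[OF this W(1,2)[of n]]
    show "\<exists>g'. g' \<in> N \<and> (\<exists>c d p. step n g g' c d p)" unfolding step_def N_def by (smt (verit) mem_Collect_eq)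
  qed
  then obtain g where g: "\<And>n. g n \<in> N" "\<And>n. \<exists>c d p. step n (g n) (g (Suc n)) c d p" by blast
  from g(2) obtain c d p where st: "\<And>n. step n (g n) (g (Suc n)) (c n) (d n) (p n)" by metis
  have gB: "g n \<in> B" for n using g(1) Bc by (auto simp: N_def)
  have cB: "c n \<in> B" and dB: "d n \<in> B" for n using st[of n] Bc by (auto simp: step_def)
  have gg: "g (Suc n) z * g n z = g (Suc n) z" and cg: "c n z * g n z = c n z" and cg': "c n z * g (Suc n) z = 0"
    and dc: "d n z * c n z = d n z" and p: "p n \<in> W n" "d n (p n) = 1" and gW: "closure {z. g (Suc n) z \<noteq> 0} \<subseteq> W n" for n z
    using st[of n] by (auto simp: step_def)
  have gmono: "g m z * g n z = g m z" if "n < m" for n m z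
    using that
  proof (induction m)
    case (Suc m)
    show ?case
    proof (cases "n = m")
      case True
      then show ?thesis using gg by simp
    next
      case False
      then have "g m z * g n z = g m z" using Suc by simp
      then show ?thesis using gg[of m z] by (metis mult.assoc)
    qed
  qed simp
  \<comment> \<open>\<open>c m\<close> is absorbed by \<open>g (Suc n)\<close>, which annihilates
    \<open>c n\<close>.\<close>
  have cc_less: "c n z * c m z = 0" if "n < m" for n m z
  proof -
    have "c m z * g (Suc n) z = c m z"
    proof (cases "Suc n = m")
      case False
      then have "g m z * g (Suc n) z = g m z" using that by (intro gmono) simp
      then show ?thesis using cg[of m z] by (metis mult.assoc)
    qed (use cg in auto)
    then show ?thesis using cg'[of n z] by (metis mult.assoc mult.commute mult_zero_left)
  qed
  have cc: "c n z * c m z = 0" if "n \<noteq> m" for n m z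
    using that cc_less[of n m z] cc_less[of m n z] by (cases "n < m") (auto simp: mult.commute)
  define supp where "supp n = closure {z. T (g n) z \<noteq> 0}" for n
  have Tgg: "T (g m) z = T (g m) z * T (g n) z" if "n < m" for n m z using Tmz[OF gB gB gmono[OF that]] .
  have Tcg: "T (c n) z = T (c n) z * T (g n) z" for n z using Tmz[OF cB gB cg] .
  have Tdc: "T (d n) z = T (d n) z * T (c n) z" for n z using Tmz[OF dB cB dc] .
  have Tcc: "T (c n) z * T (c m) z = 0" if "n \<noteq> m" for n m z
    using Tmz[OF cB cB, of n m "\<lambda>z. 0" z] cc[OF that] T0 by simp
  \<comment> \<open>The assumed failure provides \<open>h\<close> with \<open>z\<close> outside the
    support of \<open>T h\<close>; as soon as \<open>W n\<close> lies where \<open>h = 1\<close>,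
    the support of \<open>T (g (Suc n))\<close> lies inside that of \<open>T h\<close>.\<close>
  have no_common: "\<exists>n. z \<notin> supp n" for z
  proof -
    obtain h where h: "h \<in> Ck_c_funs k A" "\<forall>\<^sub>F z in nhds x. h z = 1" "z \<notin> closure {z. T h z \<noteq> 0}"
      using neg by blast
    obtain V where V: "open V" "x \<in> V" "\<And>z. z \<in> V \<Longrightarrow> h z = 1" using h(2) by (auto simp: eventually_nhds)
    obtain n where n: "W n \<subseteq> V" using W(3)[OF V(1,2)] by (auto simp: eventually_sequentially)
    have "g (Suc n) z * h z = g (Suc n) z" for z
    proof (cases "g (Suc n) z = 0")
      case False
      then have "z \<in> W n" using gW[of n] closure_subset[of "{z. g (Suc n) z \<noteq> 0}"] by auto
      then show ?thesis using n V(3) by auto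
    qed simp
    from Tmz[OF gB Bc[OF h(1)] this] have "T (g (Suc n)) z = T (g (Suc n)) z * T h z" for z .
    then have "{z. T (g (Suc n)) z \<noteq> 0} \<subseteq> {z. T h z \<noteq> 0}" by (metis (mono_tags, lifting) Collect_mono mult_zero_right)
    then have "supp (Suc n) \<subseteq> closure {z. T h z \<noteq> 0}" unfolding supp_def by (rule closure_mono)
    then show ?thesis using h(3) by blast
  qed
  \<comment> \<open>Near a point outside \<open>supp m\<close> the terms with
    \<open>n \<ge> m\<close> vanish, so the series is locally a finite sum.\<close>
  define H where "H z = (\<Sum>n. if even n then T (c n) z else 0)" for z
  have "H \<in> B"
    unfolding B
  proof
    fix y
    obtain m where m: "y \<notin> supp m" using no_common by blast
    have "T (c n) z = 0" if "z \<in> - supp m" "n \<ge> m" for z n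
    proof -
      have "T (g m) z = 0" using that(1) closure_subset[of "{z. T (g m) z \<noteq> 0}"] by (auto simp: supp_def)
      then have "T (g n) z = 0" using Tgg[of m n z] that(2) by (cases "m = n") auto
      then show ?thesis using Tcg[of n z] by simp
    qed
    then have "H z = (\<Sum>n\<in>{..<m}. if even n then T (c n) z else 0)" if "z \<in> - supp m" for z
      unfolding H_def using that by (intro suminf_finite) auto
    then have ev: "\<forall>\<^sub>F z in nhds y. (\<Sum>n\<in>{..<m}. if even n then T (c n) z else 0) = H z"
      unfolding eventually_nhds using m by (intro exI[of _ "- supp m"]) (auto simp: supp_def)
    have "Ck_at (\<lambda>z. if even n then T (c n) z else 0) y" for n
      using T_B[OF cB[of n]] Ck_at_const by (cases "even n") (auto simp: B)
    then show "Ck_at H y" by (intro Ck_at_cong[OF ev] Ck_at_sum)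
  qed
  \<comment> \<open>Where \<open>T (d m)\<close> is nonzero, \<open>T (c m)\<close> is 1 and every
    other \<open>T (c n)\<close> is 0, so \<open>H\<close> there records the parity of
    \<open>m\<close>.\<close>
  have Hd: "H z * T (d m) z = (if even m then T (d m) z else 0)" for z m
  proof (cases "T (d m) z = 0")
    case False
    then have 1: "T (c m) z = 1" using Tdc[of m z] by simp
    then have "T (c n) z = 0" if "n \<noteq> m" for n using Tcc[OF that, of z] by simp
    then have "(\<lambda>n. if even n then T (c n) z else 0) = (\<lambda>n. if n = m then (if even m then 1 else 0) else 0)"
      using 1 by (intro ext, rename_tac n, case_tac "n = m") auto
    then have "H z = (if even m then 1 else 0)"
      using sums_unique[OF sums_single[of m "\<lambda>_. if even m then 1 else 0 :: real"]] by (simp add: H_def)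
    then show ?thesis by simp
  qed simp
  define h where "h = S H"
  have hB: "h \<in> B" using S_B \<open>H \<in> B\<close> by (simp add: h_def)
  \<comment> \<open>\<open>S\<close> turns the identity for \<open>H * T (d m)\<close> into one for
    \<open>h * d m\<close>, which is evaluated at \<open>p m\<close>, where \<open>d m\<close> is
    1.\<close>
  have hp: "h (p m) = (if even m then 1 else 0)" for m
  proof -
    have "(\<lambda>z. h z * d m z) = S (\<lambda>z. H z * T (d m) z)"
      using Sm[OF \<open>H \<in> B\<close> T_B[OF dB]] ST[OF dB] by (simp add: h_def)
    also have "\<dots> = (\<lambda>z. if even m then d m z else 0)" unfolding Hd using ST[OF dB] S0 by auto
    finally have "(\<lambda>z. h z * d m z) = (\<lambda>z. if even m then d m z else 0)" .
    from fun_cong[OF this, of "p m"] show ?thesis using p(2)[of m] by simp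
  qed
  have px: "p \<longlonglongrightarrow> x"
  proof (rule topological_tendstoI)
    fix V assume "open V" "x \<in> V"
    from W(3)[OF this] show "\<forall>\<^sub>F n in sequentially. p n \<in> V" by eventually_elim (use p in blast)
  qed
  have "isCont h x" using hB B Ck_at_isCont by blast
  from isCont_tendsto_compose[OF this px] have lim: "(\<lambda>n. h (p n)) \<longlonglongrightarrow> h x" .
  have "(\<lambda>n. h (p (2 * n))) \<longlonglongrightarrow> h x" "(\<lambda>n. h (p (2 * n + 1))) \<longlonglongrightarrow> h x"
    using lim by (auto intro!: filterlim_compose[OF lim] filterlim_subseq simp: strict_mono_def)
  then have "(\<lambda>n::nat. 1) \<longlonglongrightarrow> h x" "(\<lambda>n::nat. 0) \<longlonglongrightarrow> h x" by (simp_all add: hp)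
  then have "h x = 1" "h x = 0" using LIMSEQ_const_iff by metis+
  then show False by simp
qed

text \<open>\<open>meet\<close> ranges over all multiplicative bijections of \<open>B\<close>
  because it is applied to \<open>T\<close> and to its inverse.\<close>

lemma induced_by_diffeoI:
  assumes T: "mult_bij B T" and B: "Ck_c_funs k A \<subseteq> B" "B \<subseteq> Ck_funs k A"
    and prod: "\<And>f g. f \<in> B \<Longrightarrow> g \<in> B \<Longrightarrow> (\<lambda>x. f x * g x) \<in> B"
    and lin: "\<And>f g a b. f \<in> B \<Longrightarrow> g \<in> B \<Longrightarrow> (\<lambda>x. a * f x + b * g x) \<in> B"
    and meet: "\<And>T x. mult_bij B T \<Longrightarrow> \<exists>y. \<forall>g\<in>Ck_c_funs k A. (\<forall>\<^sub>F z in nhds x. g z = 1) \<longrightarrow> y \<in> closure {z. T g z \<noteq> 0}"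
  shows "induced_by_diffeo k A B T"
proof -
  have "\<forall>f\<in>B. \<forall>g\<in>B. (\<lambda>x. f x * g x) \<in> B" using prod by blast
  note inv = mult_bij_inverse[OF T this]
  interpret multiplicative_pair k A B T "inv_into B T"
  proof unfold_locales
    fix f g assume f: "f \<in> B"
    show "T f \<in> B" "inv_into B T f \<in> B" "inv_into B T (T f) = f" "T (inv_into B T f) = f"
      using f by (fact inv)+
    assume g: "g \<in> B"
    show "T (\<lambda>x. f x * g x) = (\<lambda>x. T f x * T g x)"
      "inv_into B T (\<lambda>x. f x * g x) = (\<lambda>x. inv_into B T f x * inv_into B T g x)"
      using f g by (fact inv)+
  qed (fact B meet[OF T] meet[OF inv(7)])+
  show ?thesis by (rule induced[OF lin])
qed

lemma Ck_at_lin: "Ck_at f x \<Longrightarrow> Ck_at g x \<Longrightarrow> Ck_at (\<lambda>x. a * f x + b * g x) x"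
  by (intro Ck_at_add Ck_at_mult Ck_at_const)

lemma induced_by_diffeo_Ck:
  assumes T: "mult_bij (Ck_funs k A) T"
  shows "induced_by_diffeo k A (Ck_funs k A) T"
  by (rule induced_by_diffeoI[OF T _ _ _ _ supports_meet_Ck])
    (auto simp: Ck_c_funs_def Ck_funs_iff intro: Ck_at_mult Ck_at_lin)

lemma Ck_c_funs_lin:
  assumes "f \<in> Ck_c_funs k A" "g \<in> Ck_c_funs k A"
  shows "(\<lambda>x. a * f x + b * g x) \<in> Ck_c_funs k A"
proof -
  have "closure {x. a * f x + b * g x \<noteq> 0} \<subseteq> closure {x. f x \<noteq> 0} \<union> closure {x. g x \<noteq> 0}"
    unfolding closure_Un[symmetric] by (rule closure_mono) auto
  then have "compact (closure {x. a * f x + b * g x \<noteq> 0})"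
    using assms by (intro compact_closed_subset[OF compact_Un closed_closure]) (auto simp: Ck_c_funs_iff)
  then show ?thesis using assms by (auto simp: Ck_c_funs_iff intro: Ck_at_lin)
qed

lemma induced_by_diffeo_Ck_c:
  assumes T: "mult_bij (Ck_c_funs k A) T"
  shows "induced_by_diffeo k A (Ck_c_funs k A) T"
proof (rule induced_by_diffeoI[OF T])
  show "(\<lambda>x. f x * g x) \<in> Ck_c_funs k A" if "f \<in> Ck_c_funs k A" "g \<in> Ck_c_funs k A" for f g
    using that by (auto intro: Ck_c_funs_mult Ck_c_funs_D)
  show "\<exists>y. \<forall>g\<in>Ck_c_funs k A. (\<forall>\<^sub>F z in nhds x. g z = 1) \<longrightarrow> y \<in> closure {z. T g z \<noteq> 0}"
    if T: "mult_bij (Ck_c_funs k A) T" for T x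
  proof (rule supports_meet_compact[OF T])
    fix g assume "g \<in> Ck_c_funs k A"
    then have "T g \<in> Ck_c_funs k A" using T bij_betw_apply unfolding mult_bij_def by metis
    then show "compact (closure {z. T g z \<noteq> 0})" by (simp add: Ck_c_funs_def)
  qed auto
qed (use Ck_c_funs_lin in \<open>auto simp: Ck_c_funs_def\<close>)

end

section \<open>Schwartz functions\<close>

lemma Ck_inf_iff: "Ck \<infinity> U f \<longleftrightarrow> (\<forall>n. Ck_nat n U f)"
  by (simp add: Ck_def)

lemma Ck_inf_deriv: "Ck \<infinity> UNIV f \<Longrightarrow> i \<in> Basis \<Longrightarrow> Ck \<infinity> UNIV (\<lambda>x. frechet_derivative f (at x) i)"
  unfolding Ck_inf_iff by (metis Ck_nat.simps(2))

lemma Ck_inf_differentiable: "Ck \<infinity> UNIV f \<Longrightarrow> f differentiable (at x)"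
  unfolding Ck_inf_iff by (metis Ck_nat.simps(2) UNIV_I)

lemma Ck_pderivs: "Ck \<infinity> UNIV f \<Longrightarrow> set is \<subseteq> Basis \<Longrightarrow> Ck \<infinity> UNIV (pderivs is f)"
  by (induction "is") (auto intro: Ck_inf_deriv)

text \<open>The last index of the list is the one applied first. Splitting it off turns a derivative
  of \<open>f\<close> into a lower-order one of another function, the form used to differentiate
  products and to see that derivatives stay in \<open>Schwartz\<close>.\<close>

lemma pderivs_snoc: "pderivs (is @ [i]) f = pderivs is (\<lambda>x. frechet_derivative f (at x) i)"
  by (induction "is") auto

lemma pderivs_lin:
  assumes "Ck \<infinity> UNIV f" "Ck \<infinity> UNIV g" "set is \<subseteq> Basis"
  shows "pderivs is (\<lambda>x. a * f x + b * g x) = (\<lambda>x. a * pderivs is f x + b * pderivs is g x)"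
  using assms(3)
proof (induction "is")
  case (Cons i "is")
  have D: "((\<lambda>x. a * pderivs is f x + b * pderivs is g x) has_derivative
      (\<lambda>h. a * frechet_derivative (pderivs is f) (at x) h + b * frechet_derivative (pderivs is g) (at x) h)) (at x)" for x
    using Cons.prems assms
    by (intro has_derivative_add has_derivative_mult_right has_derivative_frechet Ck_inf_differentiable Ck_pderivs) auto
  show ?case using Cons by (simp add: frechet_derivative_eqI[OF D])
qed simp

definition rapid :: "('e::euclidean_space \<Rightarrow> real) \<Rightarrow> bool" where
  "rapid f = (\<forall>l. \<exists>C. \<forall>x. \<bar>f x\<bar> * (1 + norm x ^ l) \<le> C)"

lemma Schwartz_iff: "f \<in> Schwartz \<longleftrightarrow> Ck \<infinity> UNIV f \<and> (\<forall>is. set is \<subseteq> Basis \<longrightarrow> rapid (pderivs is f))"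
proof -
  have "bounded (range (\<lambda>x. \<bar>h x\<bar> * (1 + norm x ^ l))) \<longleftrightarrow> (\<exists>C. \<forall>x. \<bar>h x\<bar> * (1 + norm x ^ l) \<le> C)" for h :: "'a \<Rightarrow> real" and l
  proof -
    have "norm (\<bar>h x\<bar> * (1 + norm x ^ l)) = \<bar>h x\<bar> * (1 + norm x ^ l)" for x
      by (simp add: abs_mult)
    then show ?thesis unfolding bounded_iff by auto
  qed
  then show ?thesis unfolding Schwartz_def rapid_def by auto
qed

lemma rapid_lin:
  assumes "rapid f" "rapid g"
  shows "rapid (\<lambda>x. a * f x + b * g x)"
  unfolding rapid_def
proof
  fix l
  obtain C D where C: "\<And>x. \<bar>f x\<bar> * (1 + norm x ^ l) \<le> C" "\<And>x. \<bar>g x\<bar> * (1 + norm x ^ l) \<le> D"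
    using assms unfolding rapid_def by blast
  have "\<bar>a * f x + b * g x\<bar> * (1 + norm x ^ l) \<le> \<bar>a\<bar> * C + \<bar>b\<bar> * D" for x
  proof -
    have "\<bar>a * f x + b * g x\<bar> * (1 + norm x ^ l) \<le> (\<bar>a\<bar> * \<bar>f x\<bar> + \<bar>b\<bar> * \<bar>g x\<bar>) * (1 + norm x ^ l)"
      using abs_triangle_ineq[of "a * f x" "b * g x"] by (intro mult_right_mono) (auto simp: abs_mult)
    also have "\<dots> = \<bar>a\<bar> * (\<bar>f x\<bar> * (1 + norm x ^ l)) + \<bar>b\<bar> * (\<bar>g x\<bar> * (1 + norm x ^ l))"
      by (simp add: algebra_simps)
    also have "\<dots> \<le> \<bar>a\<bar> * C + \<bar>b\<bar> * D" using C by (intro add_mono mult_left_mono) auto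
    finally show ?thesis .
  qed
  then show "\<exists>C. \<forall>x. \<bar>a * f x + b * g x\<bar> * (1 + norm x ^ l) \<le> C" by blast
qed

lemma rapid_mult:
  assumes "rapid f" "rapid g"
  shows "rapid (\<lambda>x. f x * g x)"
  unfolding rapid_def
proof
  fix l
  obtain C D where C: "\<And>x. \<bar>f x\<bar> * (1 + norm x ^ l) \<le> C" "\<And>x. \<bar>g x\<bar> * (1 + norm x ^ 0) \<le> D"
    using assms unfolding rapid_def by blast
  have "\<bar>f x * g x\<bar> * (1 + norm x ^ l) \<le> C * D" for x
  proof -
    have "\<bar>g x\<bar> \<le> D" using C(2)[of x] by simp
    then have "(\<bar>f x\<bar> * (1 + norm x ^ l)) * \<bar>g x\<bar> \<le> C * D" using C(1)[of x] by (intro mult_mono') auto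
    then show ?thesis by (simp add: abs_mult mult_ac)
  qed
  then show "\<exists>C. \<forall>x. \<bar>f x * g x\<bar> * (1 + norm x ^ l) \<le> C" by blast
qed

lemma Schwartz_lin:
  assumes "f \<in> Schwartz" "g \<in> Schwartz"
  shows "(\<lambda>x. a * f x + b * g x) \<in> Schwartz"
proof -
  have "Ck \<infinity> UNIV (\<lambda>x. a * f x + b * g x)"
    using assms by (intro Ck_add Ck_mult Ck_const) (auto simp: Schwartz_iff)
  moreover have "rapid (pderivs is (\<lambda>x. a * f x + b * g x))" if "set is \<subseteq> Basis" for "is"
    using assms that by (simp add: pderivs_lin Schwartz_iff rapid_lin)
  ultimately show ?thesis by (simp add: Schwartz_iff)
qed

lemma Schwartz_deriv:
  assumes "f \<in> Schwartz" "i \<in> Basis"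
  shows "(\<lambda>x. frechet_derivative f (at x) i) \<in> Schwartz"
  using assms Ck_inf_deriv pderivs_snoc[of _ i f, symmetric] by (auto simp: Schwartz_iff)

text \<open>In place of a general Leibniz formula, the innermost derivative is split off and the
  product rule gives two products of Schwartz functions, to which the induction hypothesis applies
  because \<open>f\<close> and \<open>g\<close> are arbitrary in it.\<close>

lemma Schwartz_mult:
  assumes "f \<in> Schwartz" "g \<in> Schwartz"
  shows "(\<lambda>x. f x * g x) \<in> Schwartz"
proof -
  have C: "Ck \<infinity> UNIV (\<lambda>x. f x * g x)" if "f \<in> Schwartz" "g \<in> Schwartz" for f g :: "'a \<Rightarrow> real"
    using that by (intro Ck_mult) (auto simp: Schwartz_iff)
  have "rapid (pderivs is (\<lambda>x. f x * g x))" if "set is \<subseteq> Basis" for "is"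
    using that assms
  proof (induction "is" arbitrary: f g rule: rev_induct)
    case Nil
    have "rapid (pderivs [] f)" "rapid (pderivs [] g)" using Nil by (auto simp: Schwartz_iff simp del: pderivs.simps)
    then show ?case by (simp add: rapid_mult)
  next
    case (snoc i "is")
    let ?f' = "\<lambda>x. frechet_derivative f (at x) i" and ?g' = "\<lambda>x. frechet_derivative g (at x) i"
    have i: "i \<in> Basis" "set is \<subseteq> Basis" using snoc.prems by auto
    have f': "?f' \<in> Schwartz" and g': "?g' \<in> Schwartz" using Schwartz_deriv snoc.prems i by auto
    \<comment> \<open>The factors 1 match the shape of \<open>pderivs_lin\<close> and
      \<open>rapid_lin\<close>.\<close>
    have "frechet_derivative (\<lambda>x. f x * g x) (at x) i = 1 * (f x * ?g' x) + 1 * (?f' x * g x)" for x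
    proof -
      have "((\<lambda>x. f x * g x) has_derivative (\<lambda>h. f x * frechet_derivative g (at x) h + frechet_derivative f (at x) h * g x)) (at x)"
        using snoc.prems by (intro has_derivative_mult has_derivative_frechet Ck_inf_differentiable) (auto simp: Schwartz_iff)
      then show ?thesis by (simp add: frechet_derivative_eqI)
    qed
    then have "pderivs (is @ [i]) (\<lambda>x. f x * g x) = pderivs is (\<lambda>x. 1 * (f x * ?g' x) + 1 * (?f' x * g x))"
      by (simp only: pderivs_snoc)
    also have "\<dots> = (\<lambda>x. 1 * pderivs is (\<lambda>x. f x * ?g' x) x + 1 * pderivs is (\<lambda>x. ?f' x * g x) x)"
      using snoc.prems i f' g' by (intro pderivs_lin C) auto
    finally show ?case using snoc.IH[OF i(2) snoc.prems(2) g'] snoc.IH[OF i(2) f' snoc.prems(3)]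
      by (simp only: rapid_lin)
  qed
  then show ?thesis using C[OF assms] by (simp add: Schwartz_iff)
qed

lemma Ck_c_funs_id_iff: "f \<in> Ck_c_funs k (id_atlas :: ('e::euclidean_space set \<times> ('e \<Rightarrow> 'e)) set) \<longleftrightarrow> Ck k UNIV f \<and> compact (closure {x. f x \<noteq> 0})"
  by (simp add: Ck_c_funs_def Ck_funs_id)

text \<open>Partial derivatives vanish off the compact support and are continuous on it, hence
  bounded with any polynomial weight.\<close>

lemma Ck_c_subset_Schwartz: "Ck_c_funs \<infinity> (id_atlas :: ('e::euclidean_space set \<times> ('e \<Rightarrow> 'e)) set) \<subseteq> Schwartz"
proof
  fix f :: "'e \<Rightarrow> real" assume "f \<in> Ck_c_funs \<infinity> id_atlas"
  then have f: "Ck \<infinity> UNIV f" "compact (closure {x. f x \<noteq> 0})" by (auto simp: Ck_c_funs_id_iff)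
  let ?K = "closure {x. f x \<noteq> 0}"
  have "rapid (pderivs is f)" if "is": "set is \<subseteq> Basis" for "is"
    unfolding rapid_def
  proof
    fix l
    have out: "pderivs is f x = 0" if "x \<notin> ?K" for x
      using that
    proof (induction "is" arbitrary: x)
      case Nil
      then show ?case using closure_subset[of "{x. f x \<noteq> 0}"] by auto
    next
      case (Cons i "is")
      show ?case unfolding pderivs.simps
        by (rule frechet_derivative_eq_0_outside[OF closed_closure _ Cons.prems]) (rule Cons.IH)
    qed
    have "continuous_on UNIV (pderivs is f)" using Ck_pderivs[OF f(1) "is"] by (rule Ck_continuous_on)
    then have "continuous_on ?K (\<lambda>x. \<bar>pderivs is f x\<bar> * (1 + norm x ^ l))"
      by (intro continuous_intros) (auto intro: continuous_on_subset)
    from compact_imp_bounded[OF compact_continuous_image[OF this f(2)]]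
    obtain C where C: "\<And>x. x \<in> ?K \<Longrightarrow> \<bar>\<bar>pderivs is f x\<bar> * (1 + norm x ^ l)\<bar> \<le> C" unfolding bounded_iff by auto
    have "\<bar>pderivs is f x\<bar> * (1 + norm x ^ l) \<le> max C 0" for x
      using C[of x] out[of x] by (cases "x \<in> ?K") auto
    then show "\<exists>C. \<forall>x. \<bar>pderivs is f x\<bar> * (1 + norm x ^ l) \<le> C" by blast
  qed
  then show "f \<in> Schwartz" using f(1) by (simp add: Schwartz_iff)
qed

text \<open>Expresses boundedness of the support by the relation \<open>g * h = g\<close>, which a
  multiplicative map transports.\<close>

lemma bounded_support_absorbed:
  fixes g :: "'e::euclidean_space \<Rightarrow> real"
  assumes "bounded {x. g x \<noteq> 0}"
  obtains h where "h \<in> Ck_c_funs k id_atlas" "\<And>x. g x * h x = g x"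
proof -
  obtain R where R: "R > 0" "\<And>x. g x \<noteq> 0 \<Longrightarrow> norm x \<le> R" using assms unfolding bounded_pos by auto
  define h where "h x = std_bump (inverse R *\<^sub>R (x - 0))" for x :: 'e
  have C: "Ck k UNIV h"
    unfolding h_def[abs_def] Ck_def
    by (intro allI impI Ck_nat_compose[OF open_UNIV open_UNIV subset_UNIV Ck_nat_std_bump Ck_nat_affine])
  have "{x. h x \<noteq> 0} \<subseteq> cball 0 (2 * R)"
  proof
    fix x assume "x \<in> {x. h x \<noteq> 0}"
    then have "\<not> 2 \<le> norm (inverse R *\<^sub>R x)" using std_bump_eq_0[of "inverse R *\<^sub>R x"] by (auto simp: h_def)
    then have "inverse R * norm x < 2" using R(1) by simp
    then show "x \<in> cball 0 (2 * R)" using R(1) by (simp add: field_simps)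
  qed
  then have "compact (closure {x. h x \<noteq> 0})"
    by (intro compact_closed_subset[OF compact_cball closed_closure] closure_minimal) auto
  moreover have "g x * h x = g x" for x
    using R by (cases "g x = 0") (auto simp: h_def field_simps intro!: std_bump_eq_1)
  ultimately show ?thesis using that C by (simp add: Ck_c_funs_id_iff)
qed

lemma induced_by_diffeo_Schwartz:
  assumes T: "mult_bij (Schwartz :: ('e::euclidean_space \<Rightarrow> real) set) T"
  shows "induced_by_diffeo \<infinity> (id_atlas :: ('e set \<times> ('e \<Rightarrow> 'e)) set) Schwartz T"
proof -
  interpret Ck_manifold \<infinity> "id_atlas :: ('e set \<times> ('e \<Rightarrow> 'e)) set"
    by unfold_locales (auto simp: Ck_atlas_id)
  show ?thesis
  proof (rule induced_by_diffeoI[OF T Ck_c_subset_Schwartz])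
    show "(Schwartz :: ('e \<Rightarrow> real) set) \<subseteq> Ck_funs \<infinity> id_atlas" by (auto simp: Ck_funs_id Schwartz_iff)
    show "\<exists>y. \<forall>g\<in>Ck_c_funs \<infinity> id_atlas. (\<forall>\<^sub>F z in nhds x. g z = 1) \<longrightarrow> y \<in> closure {z. T g z \<noteq> 0}"
      if T: "mult_bij (Schwartz :: ('e \<Rightarrow> real) set) T" for T x
    proof (rule supports_meet_compact[OF T Ck_c_subset_Schwartz])
      \<comment> \<open>That \<open>T\<close> preserves compact supports is not given. But
        \<open>g\<close> is absorbed by a compactly supported \<open>h\<close>, so
        \<open>T h = 1\<close> wherever \<open>T g\<close> is nonzero; since \<open>T h\<close>
        decays at infinity, that set is bounded.\<close>
      fix g :: "'e \<Rightarrow> real" assume g: "g \<in> Ck_c_funs \<infinity> id_atlas"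
      then have "bounded {x. g x \<noteq> 0}"
        using compact_imp_bounded bounded_subset closure_subset by (auto simp: Ck_c_funs_id_iff)
      then obtain h :: "'e \<Rightarrow> real" where h: "h \<in> Ck_c_funs \<infinity> id_atlas" "\<And>x. g x * h x = g x"
        by (rule bounded_support_absorbed) blast
      have gS: "g \<in> Schwartz" and hS: "h \<in> Schwartz" using g h(1) Ck_c_subset_Schwartz by auto
      have "T (\<lambda>x. g x * h x) = (\<lambda>x. T g x * T h x)" using T gS hS by (simp add: mult_bij_def)
      then have eq: "T g x = T g x * T h x" for x using h(2) by (simp add: fun_eq_iff)
      have "T h \<in> Schwartz" using T hS bij_betw_apply unfolding mult_bij_def by metis
      then have "rapid (pderivs [] (T h))" unfolding Schwartz_iff by (metis empty_subsetI list.set(1))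
      then obtain C where C: "\<And>x. \<bar>T h x\<bar> * (1 + norm x ^ 1) \<le> C" unfolding rapid_def pderivs.simps by blast
      have "{x. T g x \<noteq> 0} \<subseteq> cball 0 C"
      proof
        fix x assume "x \<in> {x. T g x \<noteq> 0}"
        then have "T h x = 1" using eq[of x] by simp
        then show "x \<in> cball 0 C" using C[of x] by simp
      qed
      then show "compact (closure {x. T g x \<noteq> 0})"
        by (intro compact_closed_subset[OF compact_cball closed_closure] closure_minimal) auto
    qed
  qed (auto intro: Schwartz_mult Schwartz_lin)
qed

theorem theorem1p6:
  fixes k :: enat
    and A :: "('a::{t2_space,second_countable_topology} set \<times> ('a \<Rightarrow> 'e::euclidean_space)) set"
  assumes "1 \<le> k" and "Ck_atlas k A"
  shows "(\<forall>B T. (B = Ck_funs k A \<or> B = Ck_c_funs k A) \<longrightarrow> mult_bij B T \<longrightarrow>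
                 induced_by_diffeo k A B T) \<and>
         (\<forall>T :: ('e \<Rightarrow> real) \<Rightarrow> ('e \<Rightarrow> real). k = \<infinity> \<longrightarrow> mult_bij Schwartz T \<longrightarrow>
                 induced_by_diffeo \<infinity> (id_atlas :: ('e set \<times> ('e \<Rightarrow> 'e)) set) Schwartz T)"
proof -
  interpret Ck_manifold k A using assms by unfold_locales
  show ?thesis
    using induced_by_diffeo_Ck induced_by_diffeo_Ck_c induced_by_diffeo_Schwartz by blast
qed

end
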